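(* For every Heyting algebra $H$ the following are equivalent: (1) $H$ is existentially closed; (2) $H$ has the Density, Splitting and QE properties; (3) $H$ has the Density and Splitting properties, and $h_{l,d}(H)=h_{l,d}(\mathcal H_0)$ for all integers $l,d$. In particular, the model-completion of the theory of Heyting algebras is axiomatised by the Density and Splitting axioms together with, for all integers $l,d$, the sentence $\mathrm{FC}^{h_{l,d}(\mathcal H_0)}_{l,d}$.
   Context: Heyting algebras are in the language $\{\mathbf 0,\mathbf 1,\vee,\wedge,\to\}$. $H$ is existentially closed if every existential formula with parameters in $H$ true in some Heyting algebra extending $H$ is true in $H$. Strong order: $b\gg a$ iff $b\to a=a$ and $b\geq a$. Density: for all $a,c$ with $c\gg a\neq\mathbf 1$ there is $b\neq\mathbf 1$ with $c\gg b\gg a$. Splitting: for all $a,b_1,b_2$ with $b_1\wedge b_2\gg a\neq\mathbf 1$ there are $a_1,a_2\neq\mathbf 1$ with $a_2\to a=a_1\le b_1$, $a_1\to a=a_2\le b_2$, $a_1\vee a_2=b_1\vee b_2$. IPC formulas in variables $\bar p=(p_1,\dots,p_l)$ are identified with Heyting algebra terms; the degree of a formula is the maximal number of nested occurrences of $\to$. For $\bar a\in A^l$ and $n\ge0$, $\mathrm{Th}_n(\bar a)$ is the set of formulas $\varphi(\bar p)$ of degree $\le n$ with $\varphi(\bar a)=\mathbf 1$; write $\bar a\approx_n\bar a'$ if $\mathrm{Th}_n(\bar a)=\mathrm{Th}_n(\bar a')$. A system of degree $\le d$ in $(\bar p,q)$ is a formula $t(\bar p,q)=\mathbf 1\wedge\bigwedge_{k\le\kappa}s_k(\bar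 p,q)\neq\mathbf 1$ with $t,s_k$ IPC formulas of degree $\le d$. The $(l,d)$-index $h_{l,d}(A)$ of a Heyting algebra $A$ is the least $n$ such that for all $\bar a,\bar a'\in A^l$ with $\bar a\approx_n\bar a'$ and every system $S(\bar p,q)$ of degree $\le d$, $S(\bar a,q)$ has a solution in $A$ iff $S(\bar a',q)$ has a solution in $A$ ($h_{l,d}(A)=+\infty$ if no such $n$). $A$ has the QE property if $h_{l,d}(A)<\infty$ for all $l,d$. $\mathrm{FC}^n_{l,d}$ is the first-order sentence (a finite conjunction over representatives of systems of degree $\le d$) expressing, for every $\bar p,\bar p'$: if $\bar p\approx_n\bar p'$ and $\exists q\,S(\bar p',q)$ then $\exists q\, S(\bar p,q)$; it holds in $A$ iff $h_{l,d}(A)\le n$. Construction of $\mathcal H_0$: fix a non-trivial existentially closed Heyting algebra $\widetilde H$, let $H_0\subseteq\widetilde H$ be the two-element subalgebra. Given finite $H_n\subseteq\widetilde H$, let $A_1,\dots,A_\alpha$ be its subalgebras with at most $n$ join-irreducible elements and $B_{i,1},\dots,B_{i,\beta_i}$ representatives up to isomorphism over $A_i$ of the minimal proper finite extensions of $A_i$; going through the pairs $(i,j)$ lexicographically starting from $C=H_n$, replace $C$ by the subalgebra of $\widetilde H$ generated by $C\cup\varphi(B)$, where $D$ is a finite Heyting algebra containing $C$ and a copy $B$ of $B_{i,j}$ containing $A_i$, and $\varphi:D\to\widetilde H$ is an embedding fixing $C$ pointwise; $H_{n+1}$ is the final $C$, and $\mathcal H_0=\bigcup_nH_n$ (it is a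 countable, locally finite, existentially closed Heyting algebra).
   Formalization: The equivalence with (3) is stated only for non-trivial H: the one-element Heyting algebra is existentially closed and satisfies (2), but all its indices are 0 while h_{1,1}(𝓗₀) ≥ 1, so (3) fails for it; (1)⇔(2) and the axiomatisation are proved for all Heyting algebras. *)

theory Defs
  imports "HOL-Library.Equipollence" "HOL-Library.Countable_Set" "HOL-Library.Extended_Nat"
begin

section \<open>Heyting algebras\<close>

record 'a hstruct =
  carrier :: "'a set"
  zero :: 'a
  one :: 'a
  join :: "'a \<Rightarrow> 'a \<Rightarrow> 'a"
  meet :: "'a \<Rightarrow> 'a \<Rightarrow> 'a"
  imp :: "'a \<Rightarrow> 'a \<Rightarrow> 'a"

definition closed_under_ops :: "'a hstruct \<Rightarrow> 'a set \<Rightarrow> bool" where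
  "closed_under_ops A X \<longleftrightarrow> zero A \<in> X \<and> one A \<in> X \<and>
     (\<forall>x\<in>X. \<forall>y\<in>X. join A x y \<in> X \<and> meet A x y \<in> X \<and> imp A x y \<in> X)"

definition fo_structure :: "'a hstruct \<Rightarrow> bool" where
  "fo_structure A \<longleftrightarrow> closed_under_ops A (carrier A)"

definition le :: "'a hstruct \<Rightarrow> 'a \<Rightarrow> 'a \<Rightarrow> bool" where
  "le A x y \<longleftrightarrow> meet A x y = x"

definition heyting_algebra :: "'a hstruct \<Rightarrow> bool" where
  "heyting_algebra A \<longleftrightarrow> fo_structure A \<and>
     (\<forall>x\<in>carrier A. meet A x (one A) = x \<and> join A x (zero A) = x) \<and>
     (\<forall>x\<in>carrier A. \<forall>y\<in>carrier A.
        join A x y = join A y x \<and> meet A x y = meet A y x \<and>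
        join A x (meet A x y) = x \<and> meet A x (join A x y) = x) \<and>
     (\<forall>x\<in>carrier A. \<forall>y\<in>carrier A. \<forall>z\<in>carrier A.
        join A (join A x y) z = join A x (join A y z) \<and>
        meet A (meet A x y) z = meet A x (meet A y z) \<and>
        (le A (meet A x y) z \<longleftrightarrow> le A x (imp A y z)))"

definition nontrivial :: "'a hstruct \<Rightarrow> bool" where
  "nontrivial A \<longleftrightarrow> zero A \<noteq> one A"

definition embedding :: "('a \<Rightarrow> 'b) \<Rightarrow> 'a hstruct \<Rightarrow> 'b hstruct \<Rightarrow> bool" where
  "embedding e A B \<longleftrightarrow> e ` carrier A \<subseteq> carrier B \<and> inj_on e (carrier A) \<and>
     e (zero A) = zero B \<and> e (one A) = one B \<and>
     (\<forall>x\<in>carrier A. \<forall>y\<in>carrier A.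
        e (join A x y) = join B (e x) (e y) \<and>
        e (meet A x y) = meet B (e x) (e y) \<and>
        e (imp A x y) = imp B (e x) (e y))"

definition subalgebra :: "'a hstruct \<Rightarrow> 'a set \<Rightarrow> bool" where
  "subalgebra A X \<longleftrightarrow> X \<subseteq> carrier A \<and> closed_under_ops A X"

definition restr :: "'a hstruct \<Rightarrow> 'a set \<Rightarrow> 'a hstruct" where
  "restr A X = A\<lparr>carrier := X\<rparr>"

definition generated :: "'a hstruct \<Rightarrow> 'a set \<Rightarrow> 'a set" where
  "generated A X = \<Inter>{Y. subalgebra A Y \<and> X \<subseteq> Y}"

definition join_irreducible :: "'a hstruct \<Rightarrow> 'a \<Rightarrow> bool" where
  "join_irreducible A x \<longleftrightarrow> x \<in> carrier A \<and> x \<noteq> zero A \<and>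
     (\<forall>y\<in>carrier A. \<forall>z\<in>carrier A. x = join A y z \<longrightarrow> x = y \<or> x = z)"


section \<open>Density and Splitting\<close>

definition strong_gt :: "'a hstruct \<Rightarrow> 'a \<Rightarrow> 'a \<Rightarrow> bool" where
  "strong_gt A b a \<longleftrightarrow> imp A b a = a \<and> le A a b"

definition density :: "'a hstruct \<Rightarrow> bool" where
  "density A \<longleftrightarrow> (\<forall>a\<in>carrier A. \<forall>c\<in>carrier A. strong_gt A c a \<and> a \<noteq> one A \<longrightarrow>
     (\<exists>b\<in>carrier A. b \<noteq> one A \<and> strong_gt A c b \<and> strong_gt A b a))"

definition splitting :: "'a hstruct \<Rightarrow> bool" where
  "splitting A \<longleftrightarrow> (\<forall>a\<in>carrier A. \<forall>b1\<in>carrier A. \<forall>b2\<in>carrier A.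
     strong_gt A (meet A b1 b2) a \<and> a \<noteq> one A \<longrightarrow>
     (\<exists>a1\<in>carrier A. \<exists>a2\<in>carrier A. a1 \<noteq> one A \<and> a2 \<noteq> one A \<and>
        imp A a2 a = a1 \<and> le A a1 b1 \<and> imp A a1 a = a2 \<and> le A a2 b2 \<and>
        join A a1 a2 = join A b1 b2))"


section \<open>Formulas\<close>

datatype 'v ipc = Var 'v | Bot | Top
  | Or "'v ipc" "'v ipc" | And "'v ipc" "'v ipc" | To "'v ipc" "'v ipc"

instance ipc :: (countable) countable
  by countable_datatype

primrec degree :: "'v ipc \<Rightarrow> nat" where
  "degree (Var x) = 0"
| "degree Bot = 0"
| "degree Top = 0"
| "degree (Or s t) = max (degree s) (degree t)"
| "degree (And s t) = max (degree s) (degree t)"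
| "degree (To s t) = Suc (max (degree s) (degree t))"

primrec eval :: "'a hstruct \<Rightarrow> ('v \<Rightarrow> 'a) \<Rightarrow> 'v ipc \<Rightarrow> 'a" where
  "eval A v (Var x) = v x"
| "eval A v Bot = zero A"
| "eval A v Top = one A"
| "eval A v (Or s t) = join A (eval A v s) (eval A v t)"
| "eval A v (And s t) = meet A (eval A v s) (eval A v t)"
| "eval A v (To s t) = imp A (eval A v s) (eval A v t)"

datatype fm = Eq "nat ipc" "nat ipc" | Neg fm | Conj fm fm | Disj fm fm
  | Impl fm fm | All nat fm | Ex nat fm

instance fm :: countable
  by countable_datatype

primrec sat :: "'a hstruct \<Rightarrow> (nat \<Rightarrow> 'a) \<Rightarrow> fm \<Rightarrow> bool" where
  "sat A v (Eq s t) \<longleftrightarrow> eval A v s = eval A v t"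
| "sat A v (Neg p) \<longleftrightarrow> \<not> sat A v p"
| "sat A v (Conj p q) \<longleftrightarrow> sat A v p \<and> sat A v q"
| "sat A v (Disj p q) \<longleftrightarrow> sat A v p \<or> sat A v q"
| "sat A v (Impl p q) \<longleftrightarrow> (sat A v p \<longrightarrow> sat A v q)"
| "sat A v (All x p) \<longleftrightarrow> (\<forall>a\<in>carrier A. sat A (v(x := a)) p)"
| "sat A v (Ex x p) \<longleftrightarrow> (\<exists>a\<in>carrier A. sat A (v(x := a)) p)"

primrec free_vars :: "fm \<Rightarrow> nat set" where
  "free_vars (Eq s t) = set_ipc s \<union> set_ipc t"
| "free_vars (Neg p) = free_vars p"
| "free_vars (Conj p q) = free_vars p \<union> free_vars q"
| "free_vars (Disj p q) = free_vars p \<union> free_vars q"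
| "free_vars (Impl p q) = free_vars p \<union> free_vars q"
| "free_vars (All x p) = free_vars p - {x}"
| "free_vars (Ex x p) = free_vars p - {x}"

primrec quantifier_free :: "fm \<Rightarrow> bool" where
  "quantifier_free (Eq s t) \<longleftrightarrow> True"
| "quantifier_free (Neg p) \<longleftrightarrow> quantifier_free p"
| "quantifier_free (Conj p q) \<longleftrightarrow> quantifier_free p \<and> quantifier_free q"
| "quantifier_free (Disj p q) \<longleftrightarrow> quantifier_free p \<and> quantifier_free q"
| "quantifier_free (Impl p q) \<longleftrightarrow> quantifier_free p \<and> quantifier_free q"
| "quantifier_free (All x p) \<longleftrightarrow> False"
| "quantifier_free (Ex x p) \<longleftrightarrow> False"

inductive existential :: "fm \<Rightarrow> bool" where
  "quantifier_free p \<Longrightarrow> existential p"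
| "existential p \<Longrightarrow> existential (Ex x p)"

definition sentence :: "fm \<Rightarrow> bool" where
  "sentence p \<longleftrightarrow> free_vars p = {}"

definition models :: "'a hstruct \<Rightarrow> fm set \<Rightarrow> bool" where
  "models A T \<longleftrightarrow> fo_structure A \<and> (\<forall>p\<in>T. \<forall>v. range v \<subseteq> carrier A \<longrightarrow> sat A v p)"


section \<open>Existentially closed algebras and model completions\<close>

text \<open>
  The parameters of a formula are the values of its free variables.

  A definition in HOL cannot quantify over the types of the extensions of an algebra on \<open>'a\<close>.
  The infinite type \<open>'a + nat\<close> has room for an elementary substructure of any extension that
  contains the algebra itself, so nothing is lost by restricting to it: see
  \<open>ex_closed_any_type\<close> and \<open>model_completion_any_type\<close> below.
\<close>

definition ex_closed :: "'a hstruct \<Rightarrow> bool" where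
  "ex_closed H \<longleftrightarrow> heyting_algebra H \<and>
     (\<forall>(K :: ('a + nat) hstruct) e p v.
        heyting_algebra K \<and> embedding e H K \<and> existential p \<and> range v \<subseteq> carrier H \<and>
        sat K (e \<circ> v) p \<longrightarrow> sat H v p)"

text \<open>
  \<open>S\<close> is a model completion of \<open>T\<close>: \<open>S\<close> extends \<open>T\<close>, and for every model \<open>M\<close> of \<open>T\<close> (here: on
  the type \<open>'a\<close>) the theory \<open>S\<close> together with the diagram of \<open>M\<close> is consistent and complete.
\<close>

definition model_completion :: "'a itself \<Rightarrow> fm set \<Rightarrow> fm set \<Rightarrow> bool" where
  "model_completion (ty :: 'a itself) T S \<longleftrightarrow>
     (\<forall>p\<in>T \<union> S. sentence p) \<and>
     (\<forall>M :: 'a hstruct. models M S \<longrightarrow> models M T) \<and>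
     (\<forall>M :: 'a hstruct. models M T \<longrightarrow>
        (\<exists>(N :: ('a + nat) hstruct) e. models N S \<and> embedding e M N) \<and>
        (\<forall>(N1 :: ('a + nat) hstruct) e1 (N2 :: ('a + nat) hstruct) e2.
           models N1 S \<and> embedding e1 M N1 \<and> models N2 S \<and> embedding e2 M N2 \<longrightarrow>
           (\<forall>p v. range v \<subseteq> carrier M \<longrightarrow> (sat N1 (e1 \<circ> v) p \<longleftrightarrow> sat N2 (e2 \<circ> v) p))))"


section \<open>The index and the QE property\<close>

definition ipc_formulas :: "nat \<Rightarrow> nat \<Rightarrow> nat ipc set" where
  "ipc_formulas l n = {t. set_ipc t \<subseteq> {..<l} \<and> degree t \<le> n}"

definition tuples :: "'a hstruct \<Rightarrow> nat \<Rightarrow> 'a list set" where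
  "tuples A l = {as. length as = l \<and> set as \<subseteq> carrier A}"

definition Th :: "'a hstruct \<Rightarrow> nat \<Rightarrow> 'a list \<Rightarrow> nat ipc set" where
  "Th A n as = {t \<in> ipc_formulas (length as) n. eval A (nth as) t = one A}"

text \<open>
  The pair \<open>(t, ss)\<close> stands for the system \<open>t = 1 \<and> (\<And>s\<in>ss. s \<noteq> 1)\<close>; \<open>Var 0, \<dots>, Var (l - 1)\<close> are
  the parameters and \<open>Var l\<close> is the unknown.
\<close>

type_synonym system = "nat ipc \<times> nat ipc list"

definition systems :: "nat \<Rightarrow> nat \<Rightarrow> system set" where
  "systems l d = {(t, ss). t \<in> ipc_formulas (Suc l) d \<and> set ss \<subseteq> ipc_formulas (Suc l) d}"

definition solvable :: "'a hstruct \<Rightarrow> system \<Rightarrow> 'a list \<Rightarrow> bool" where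
  "solvable A S as \<longleftrightarrow> (\<exists>q\<in>carrier A. eval A (nth (as @ [q])) (fst S) = one A \<and>
     (\<forall>s\<in>set (snd S). eval A (nth (as @ [q])) s \<noteq> one A))"

definition index_bound :: "nat \<Rightarrow> nat \<Rightarrow> 'a hstruct \<Rightarrow> nat \<Rightarrow> bool" where
  "index_bound l d A n \<longleftrightarrow> (\<forall>as\<in>tuples A l. \<forall>as'\<in>tuples A l. Th A n as = Th A n as' \<longrightarrow>
     (\<forall>S\<in>systems l d. solvable A S as \<longleftrightarrow> solvable A S as'))"

definition index :: "nat \<Rightarrow> nat \<Rightarrow> 'a hstruct \<Rightarrow> enat" where
  "index l d A = (if \<exists>n. index_bound l d A n then enat (LEAST n. index_bound l d A n) else \<infinity>)"

definition QE_property :: "'a hstruct \<Rightarrow> bool" where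
  "QE_property A \<longleftrightarrow> (\<forall>l d. index l d A < \<infinity>)"


section \<open>The axioms\<close>

abbreviation Iff :: "fm \<Rightarrow> fm \<Rightarrow> fm" where
  "Iff p q \<equiv> Conj (Impl p q) (Impl q p)"

definition conjs :: "fm list \<Rightarrow> fm" where
  "conjs ps = foldr Conj ps (Eq Top Top)"

definition alls :: "nat \<Rightarrow> fm \<Rightarrow> fm" where
  "alls n p = foldr All [0..<n] p"

definition le_fm :: "nat ipc \<Rightarrow> nat ipc \<Rightarrow> fm" where
  "le_fm s t = Eq (And s t) s"

definition strong_gt_fm :: "nat ipc \<Rightarrow> nat ipc \<Rightarrow> fm" where
  "strong_gt_fm t s = Conj (Eq (To t s) s) (le_fm s t)"

definition heyting_axioms :: "fm set" where
  "heyting_axioms = (let x = Var 0; y = Var 1; z = Var 2 in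
    {alls 1 (Eq (And x Top) x),
     alls 1 (Eq (Or x Bot) x),
     alls 2 (Eq (Or x y) (Or y x)),
     alls 2 (Eq (And x y) (And y x)),
     alls 2 (Eq (Or x (And x y)) x),
     alls 2 (Eq (And x (Or x y)) x),
     alls 3 (Eq (Or (Or x y) z) (Or x (Or y z))),
     alls 3 (Eq (And (And x y) z) (And x (And y z))),
     alls 3 (Iff (le_fm (And x y) z) (le_fm x (To y z)))})"

definition density_axiom :: fm where
  "density_axiom = (let a = Var 0; c = Var 1; b = Var 2 in
     alls 2 (Impl (Conj (strong_gt_fm c a) (Neg (Eq a Top)))
       (Ex 2 (Conj (Neg (Eq b Top)) (Conj (strong_gt_fm c b) (strong_gt_fm b a))))))"

definition splitting_axiom :: fm where
  "splitting_axiom = (let a = Var 0; b1 = Var 1; b2 = Var 2; a1 = Var 3; a2 = Var 4 in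
     alls 3 (Impl (Conj (strong_gt_fm (And b1 b2) a) (Neg (Eq a Top)))
       (Ex 3 (Ex 4 (conjs
         [Neg (Eq a1 Top), Neg (Eq a2 Top),
          Eq (To a2 a) a1, le_fm a1 b1, Eq (To a1 a) a2, le_fm a2 b2,
          Eq (Or a1 a2) (Or b1 b2)])))))"

text \<open>
  Two IPC formulas are equivalent if they are equal in every Heyting algebra; countable ones
  suffice, see \<open>ipc_equiv_any_type\<close> below.
\<close>

definition ipc_equiv :: "nat ipc \<Rightarrow> nat ipc \<Rightarrow> bool" where
  "ipc_equiv s t \<longleftrightarrow> (\<forall>(A :: nat hstruct) v. heyting_algebra A \<and> range v \<subseteq> carrier A \<longrightarrow>
     eval A v s = eval A v t)"

definition ipc_reps :: "nat \<Rightarrow> nat \<Rightarrow> nat ipc list" where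
  "ipc_reps l n = (SOME ts. set ts \<subseteq> ipc_formulas l n \<and>
     (\<forall>s\<in>ipc_formulas l n. \<exists>t\<in>set ts. ipc_equiv s t))"

definition system_reps :: "nat \<Rightarrow> nat \<Rightarrow> system list" where
  "system_reps l d = List.product (ipc_reps (Suc l) d) (subseqs (ipc_reps (Suc l) d))"

definition system_fm :: "(nat \<Rightarrow> nat) \<Rightarrow> system \<Rightarrow> fm" where
  "system_fm r S = Conj (Eq (map_ipc r (fst S)) Top)
     (conjs (map (\<lambda>s. Neg (Eq (map_ipc r s) Top)) (snd S)))"

text \<open>
  In \<open>FC l d n\<close> the tuple \<open>p\<close> is \<open>Var 0, \<dots>, Var (l - 1)\<close>, the tuple \<open>p'\<close> is
  \<open>Var l, \<dots>, Var (2 * l - 1)\<close> and \<open>q\<close> is \<open>Var (2 * l)\<close>. The renamings \<open>r\<close> and \<open>r'\<close>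
  turn a system \<open>S\<close> into \<open>S(p, q)\<close> and \<open>S(p', q)\<close>.
\<close>

definition FC :: "nat \<Rightarrow> nat \<Rightarrow> nat \<Rightarrow> fm" where
  "FC l d n = (let r = (\<lambda>i. if i < l then i else 2 * l); r' = (\<lambda>i. l + i) in
     conjs (map (\<lambda>S. alls (2 * l)
       (Impl
         (Conj
           (conjs (map (\<lambda>t. Iff (Eq (map_ipc r t) Top) (Eq (map_ipc r' t) Top)) (ipc_reps l n)))
           (Ex (2 * l) (system_fm r' S)))
         (Ex (2 * l) (system_fm r S))))
       (system_reps l d)))"


section \<open>Construction of the locally finite existentially closed algebra\<close>

text \<open>
  A finite extension of \<open>A\<close> is an embedding \<open>e\<close> of \<open>A\<close> into a finite algebra \<open>B\<close>, whose carrier can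
  be taken in \<open>nat\<close>.
\<close>

definition min_extension :: "'a hstruct \<Rightarrow> nat hstruct \<times> ('a \<Rightarrow> nat) \<Rightarrow> bool" where
  "min_extension A = (\<lambda>(B, e). heyting_algebra B \<and> finite (carrier B) \<and> embedding e A B \<and>
     e ` carrier A \<noteq> carrier B \<and>
     (\<forall>X. subalgebra B X \<and> e ` carrier A \<subseteq> X \<longrightarrow> X = e ` carrier A \<or> X = carrier B))"

definition iso_over ::
    "'a hstruct \<Rightarrow> nat hstruct \<times> ('a \<Rightarrow> nat) \<Rightarrow> nat hstruct \<times> ('a \<Rightarrow> nat) \<Rightarrow> bool" where
  "iso_over A = (\<lambda>(B, e) (B', e'). \<exists>f. embedding f B B' \<and> f ` carrier B = carrier B' \<and>
     (\<forall>a\<in>carrier A. f (e a) = e' a))"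

definition min_extension_reps ::
    "'a hstruct \<Rightarrow> (nat hstruct \<times> ('a \<Rightarrow> nat)) list \<Rightarrow> bool" where
  "min_extension_reps A Bs \<longleftrightarrow>
     (\<forall>E\<in>set Bs. min_extension A E) \<and>
     (\<forall>E. min_extension A E \<longrightarrow> (\<exists>E'\<in>set Bs. iso_over A E E')) \<and>
     (\<forall>i<length Bs. \<forall>j<length Bs. i \<noteq> j \<longrightarrow> \<not> iso_over A (Bs ! i) (Bs ! j))"

text \<open>
  One replacement of \<open>C\<close> by \<open>C'\<close> inside \<open>Ht\<close>, for a subalgebra \<open>X\<close> of \<open>C\<close> and an extension
  \<open>(B, e)\<close> of \<open>X\<close>. The embeddings \<open>f\<close> and \<open>g\<close> realise \<open>C\<close> and a copy of \<open>B\<close> inside \<open>D\<close>; they agree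
  on \<open>X\<close>.
\<close>

definition extend_step ::
    "'a hstruct \<Rightarrow> 'a set \<times> nat hstruct \<times> ('a \<Rightarrow> nat) \<Rightarrow> 'a set \<Rightarrow> 'a set \<Rightarrow> bool" where
  "extend_step Ht = (\<lambda>(X, B, e) C C'. \<exists>(D :: nat hstruct) f g \<phi>.
     heyting_algebra D \<and> finite (carrier D) \<and>
     embedding f (restr Ht C) D \<and> embedding g B D \<and> (\<forall>x\<in>X. g (e x) = f x) \<and>
     embedding \<phi> D Ht \<and> (\<forall>c\<in>C. \<phi> (f c) = c) \<and>
     C' = generated Ht (C \<union> \<phi> ` g ` carrier B))"

inductive extend_steps ::
    "'a hstruct \<Rightarrow> ('a set \<times> nat hstruct \<times> ('a \<Rightarrow> nat)) list \<Rightarrow> 'a set \<Rightarrow> 'a set \<Rightarrow> bool"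
  for Ht where
  "extend_steps Ht [] C C"
| "extend_step Ht E C C' \<Longrightarrow> extend_steps Ht Es C' C'' \<Longrightarrow> extend_steps Ht (E # Es) C C''"

definition next_stage :: "'a hstruct \<Rightarrow> nat \<Rightarrow> 'a set \<Rightarrow> 'a set \<Rightarrow> bool" where
  "next_stage Ht n H H' \<longleftrightarrow> (\<exists>Xs Bss.
     distinct Xs \<and>
     set Xs = {X. subalgebra (restr Ht H) X \<and> card {x. join_irreducible (restr Ht X) x} \<le> n} \<and>
     list_all2 (\<lambda>X Bs. min_extension_reps (restr Ht X) Bs) Xs Bss \<and>
     extend_steps Ht (concat (map2 (\<lambda>X Bs. map (Pair X) Bs) Xs Bss)) H H')"

definition H0_construction :: "'a hstruct \<Rightarrow> 'a hstruct \<Rightarrow> bool" where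
  "H0_construction Ht H0 \<longleftrightarrow> (\<exists>H :: nat \<Rightarrow> 'a set.
     H 0 = {zero Ht, one Ht} \<and> (\<forall>n. next_stage Ht n (H n) (H (Suc n))) \<and>
     H0 = restr Ht (\<Union>n. H n))"

definition mc_axioms :: "'a hstruct \<Rightarrow> fm set" where
  "mc_axioms H0 = heyting_axioms \<union> {density_axiom, splitting_axiom} \<union>
     {FC l d (the_enat (index l d H0)) | l d. True}"


section \<open>Adequacy of the definitions\<close>

lemma alls_Suc: "alls (Suc n) p = alls n (All n p)"
  by (simp add: alls_def)

lemma alls_0: "alls 0 p = p"
  by (simp add: alls_def)

lemmas alls_numeral = alls_0 alls_Suc numeral_2_eq_2 numeral_3_eq_3 One_nat_def

lemma all_assignments_iff:
  assumes "fo_structure A" and "\<And>v. P v \<longleftrightarrow> Q"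
  shows "(\<forall>v :: nat \<Rightarrow> 'a. range v \<subseteq> carrier A \<longrightarrow> P v) \<longleftrightarrow> Q"
proof -
  have "range (\<lambda>_ :: nat. zero A) \<subseteq> carrier A"
    using assms(1) by (auto simp: fo_structure_def closed_under_ops_def)
  then show ?thesis
    using assms(2) by blast
qed

lemma models_density_axiom: "fo_structure A \<Longrightarrow> models A {density_axiom} \<longleftrightarrow> density A"
  unfolding models_def
  apply (simp)
  apply (rule all_assignments_iff, assumption)
  by (simp add: density_axiom_def density_def alls_numeral strong_gt_fm_def le_fm_def
      strong_gt_def le_def Let_def)

lemma models_splitting_axiom: "fo_structure A \<Longrightarrow> models A {splitting_axiom} \<longleftrightarrow> splitting A"
  unfolding models_def
  apply (simp)
  apply (rule all_assignments_iff, assumption)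
  by (simp add: splitting_axiom_def splitting_def alls_def upt_rec conjs_def strong_gt_fm_def le_fm_def
      strong_gt_def le_def Let_def)

lemma models_heyting_axioms: "models A heyting_axioms \<longleftrightarrow> heyting_algebra A"
proof (cases "fo_structure A")
  case True
  have "(\<forall>v. range v \<subseteq> carrier A \<longrightarrow> (\<forall>p\<in>heyting_axioms. sat A v p)) \<longleftrightarrow> heyting_algebra A"
    apply (rule all_assignments_iff[OF True])
    apply (simp add: heyting_axioms_def heyting_algebra_def alls_def upt_rec le_fm_def
      le_def Let_def True iff_conv_conj_imp[symmetric])
    by blast
  then show ?thesis
    using True by (auto simp: models_def)
qed (auto simp: models_def heyting_algebra_def)


subsection \<open>Restriction to a type of sufficient size\<close>

lemma lepoll_times_infinite:
  assumes inf: "infinite (UNIV :: 'k set)"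
    and "A \<lesssim> (UNIV :: 'k set)" and "B \<lesssim> (UNIV :: 'k set)"
  shows "A \<times> B \<lesssim> (UNIV :: 'k set)"
proof -
  have "(card_of ((UNIV :: 'k set) \<times> (UNIV :: 'k set)), card_of (UNIV :: 'k set)) \<in> ordLeq"
    using card_of_Times_same_infinite[OF inf] ordIso_imp_ordLeq by blast
  then have "(UNIV :: 'k set) \<times> (UNIV :: 'k set) \<lesssim> (UNIV :: 'k set)"
    by (simp add: lepoll_def flip: card_of_ordLeq)
  then show ?thesis
    using times_lepoll_mono[OF assms(2,3)] lepoll_trans by blast
qed

lemma countable_lepoll_infinite:
  assumes "infinite (UNIV :: 'k set)"
  shows "(UNIV :: 'c :: countable set) \<lesssim> (UNIV :: 'k set)"
proof -
  have "(UNIV :: 'c set) \<lesssim> (UNIV :: nat set)"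
    unfolding lepoll_def using inj_to_nat by blast
  then show ?thesis
    using assms infinite_le_lepoll lepoll_trans by blast
qed

lemma lepoll_lists_infinite:
  assumes inf: "infinite (UNIV :: 'k set)" and A: "A \<lesssim> (UNIV :: 'k set)"
  shows "lists A \<lesssim> (UNIV :: 'k set)"
proof -
  obtain p :: "'k \<times> 'k \<Rightarrow> 'k" where p: "inj p"
    using lepoll_times_infinite[OF inf lepoll_refl lepoll_refl] by (auto simp: lepoll_def)
  define g :: "'k list \<Rightarrow> 'k" where "g = rec_list undefined (\<lambda>x _ r. p (x, r))"
  have g: "length xs = length ys \<Longrightarrow> g xs = g ys \<Longrightarrow> xs = ys" for xs ys
    by (induction xs ys rule: list_induct2) (auto simp: g_def dest: injD[OF p])
  have "inj (\<lambda>xs. (length xs, g xs))"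
    using g by (auto simp: inj_def)
  then have "(UNIV :: 'k list set) \<lesssim> (UNIV :: nat set) \<times> (UNIV :: 'k set)"
    unfolding lepoll_def by (metis UNIV_Times_UNIV subset_UNIV)
  also have "\<dots> \<lesssim> (UNIV :: 'k set)"
    by (intro lepoll_times_infinite[OF inf] countable_lepoll_infinite[OF inf] lepoll_refl)
  finally show ?thesis
    using lists_lepoll_mono[OF A] lepoll_trans by auto
qed

lemma eval_cong: "(\<And>x. x \<in> set_ipc t \<Longrightarrow> v x = w x) \<Longrightarrow> eval A v t = eval A w t"
  by (induction t) auto

lemma sat_cong: "(\<And>x. x \<in> free_vars p \<Longrightarrow> v x = w x) \<Longrightarrow> sat A v p = sat A w p"
proof (induction p arbitrary: v w)
  case (Eq s t)
  then show ?case by (metis UnCI eval_cong free_vars.simps(1) sat.simps(1))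
next
  case (All x p)
  have "sat A (v(x := a)) p = sat A (w(x := a)) p" for a
    by (rule All.IH) (use All.prems in auto)
  then show ?case by simp
next
  case (Ex x p)
  have "sat A (v(x := a)) p = sat A (w(x := a)) p" for a
    by (rule Ex.IH) (use Ex.prems in auto)
  then show ?case by simp
next
  case (Conj p q)
  have "sat A v p = sat A w p" "sat A v q = sat A w q"
    by (rule Conj.IH; use Conj.prems in simp)+
  then show ?case by simp
next
  case (Disj p q)
  have "sat A v p = sat A w p" "sat A v q = sat A w q"
    by (rule Disj.IH; use Disj.prems in simp)+
  then show ?case by simp
next
  case (Impl p q)
  have "sat A v p = sat A w p" "sat A v q = sat A w q"
    by (rule Impl.IH; use Impl.prems in simp)+
  then show ?case by simp
next
  case (Neg p)
  have "sat A v p = sat A w p"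
    by (rule Neg.IH) (use Neg.prems in simp)
  then show ?case by simp
qed

lemma finite_free_vars: "finite (free_vars p)"
  by (induction p) auto

theorem downward_Loewenheim_Skolem:
  fixes N :: "'c hstruct"
  assumes N: "fo_structure N" and X: "X \<subseteq> carrier N" "X \<lesssim> (UNIV :: 'k set)"
    and inf: "infinite (UNIV :: 'k set)"
  obtains M :: "'k hstruct" and j where
    "embedding j M N" "X \<subseteq> j ` carrier M" "fo_structure M"
    "\<And>p v. range v \<subseteq> carrier M \<Longrightarrow> sat M v p \<longleftrightarrow> sat N (j \<circ> v) p"
proof -
  define asg where "asg vs = (\<lambda>i. if i < length vs then vs ! i else zero N)" for vs :: "'c list"
  define wit where "wit = (\<lambda>(p, x, vs).
    if sat N (asg vs) (Ex x p) then SOME a. a \<in> carrier N \<and> sat N ((asg vs)(x := a)) p else zero N)"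
  define step where "step G = G \<union> wit ` (UNIV \<times> UNIV \<times> lists G)" for G
  define G where "G n = (step ^^ n) X" for n
  define U where "U = (\<Union>n. G n)"
  have N0: "zero N \<in> carrier N"
    using N by (simp add: fo_structure_def closed_under_ops_def)
  have wit: "wit (p, x, vs) \<in> carrier N \<and> (sat N (asg vs) (Ex x p) \<longrightarrow>
      sat N ((asg vs)(x := wit (p, x, vs))) p)" for p x vs
  proof (cases "sat N (asg vs) (Ex x p)")
    case True
    then have "\<exists>a. a \<in> carrier N \<and> sat N ((asg vs)(x := a)) p" by auto
    from someI_ex[OF this] True show ?thesis by (simp add: wit_def)
  next
    case False
    then show ?thesis using N0 by (auto simp: wit_def)
  qed
  have GS: "G (Suc n) = step (G n)" for n by (simp add: G_def)
  have Gsub: "G n \<subseteq> carrier N" for n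
  proof (induction n)
    case 0
    then show ?case using X by (simp add: G_def)
  next
    case (Suc n)
    then show ?case using wit by (auto simp: GS step_def)
  qed
  have "lepoll (G n) (UNIV :: 'k set)" for n
  proof (induction n)
    case 0
    then show ?case using X by (simp add: G_def)
  next
    case (Suc n)
    have 1: "lepoll (wit ` (UNIV \<times> UNIV \<times> lists (G n))) (UNIV :: 'k set)"
      by (rule lepoll_trans[OF image_lepoll]) (intro lepoll_times_infinite[OF inf]
          countable_lepoll_infinite[OF inf] lepoll_lists_infinite[OF inf] Suc)
    obtain g1 g2 where g: "G n \<subseteq> g1 ` (UNIV :: 'k set)"
        "wit ` (UNIV \<times> UNIV \<times> lists (G n)) \<subseteq> g2 ` (UNIV :: 'k set)"
      using Suc 1 unfolding lepoll_iff by blast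
    define g where "g = (\<lambda>(b, x). if b then g1 x else g2 x)"
    have "y \<in> g ` (UNIV \<times> UNIV)" if "y \<in> G (Suc n)" for y
    proof -
      from that g obtain x where "y = g (True, x) \<or> y = g (False, x)"
        unfolding GS step_def g_def by (auto simp only: prod.case if_True if_False) blast+
      then show ?thesis by blast
    qed
    then have "G (Suc n) \<subseteq> g ` ((UNIV :: bool set) \<times> (UNIV :: 'k set))"
      by blast
    from subset_image_lepoll[OF this] show ?case
      by (rule lepoll_trans)
        (intro lepoll_times_infinite[OF inf] countable_lepoll_infinite[OF inf] lepoll_refl)
  qed
  then have "(card_of U, card_of (UNIV :: 'k set)) \<in> ordLeq"
    unfolding U_def
    using countable_lepoll_infinite[OF inf, where 'c = nat]
    by (intro card_of_UNION_ordLeq_infinite[OF inf]) (simp_all only: lepoll_def card_of_ordLeq simp_thms ball_simps)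
  then obtain i :: "'c \<Rightarrow> 'k" where i: "inj_on i U"
    unfolding card_of_ordLeq[symmetric] by blast
  have mono: "G m \<subseteq> G n" if "m \<le> n" for m n
    using that by (induction rule: dec_induct) (auto simp: GS step_def)
  have U: "wit (p, x, vs) \<in> U" if "set vs \<subseteq> U" for p x vs
  proof -
    have "\<exists>n. set vs \<subseteq> G n"
      using that
    proof (induction vs)
      case (Cons a vs)
      then obtain m n where "a \<in> G m" "set vs \<subseteq> G n" by (auto simp: U_def)
      then have "set (a # vs) \<subseteq> G (max m n)"
        using mono[of m "max m n"] mono[of n "max m n"] by auto
      then show ?case by blast
    qed auto
    then obtain n where "vs \<in> lists (G n)" by auto
    then have "wit (p, x, vs) \<in> G (Suc n)" by (auto simp: GS step_def)
    then show ?thesis by (auto simp: U_def)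
  qed
  have Usub: "U \<subseteq> carrier N" using Gsub by (auto simp: U_def)
  have TV: "\<exists>a\<in>U. sat N (v(x := a)) p"
    if v: "range v \<subseteq> U" and ex: "sat N v (Ex x p)" for v x p
  proof -
    obtain k where k: "free_vars p \<subseteq> {..<k}"
      using finite_free_vars[of p] finite_nat_iff_bounded by blast
    define vs where "vs = map v [0..<k]"
    have eq: "sat N (v(x := a)) p = sat N ((asg vs)(x := a)) p" for a
      by (rule sat_cong) (use k in \<open>auto simp: asg_def vs_def\<close>)
    have "wit (p, x, vs) \<in> U" by (rule U) (use v in \<open>auto simp: vs_def\<close>)
    moreover have "sat N (asg vs) (Ex x p)" using ex by (simp add: eq)
    ultimately show ?thesis using wit eq by blast
  qed
  have val: "eval N v t \<in> U" if v: "range v \<subseteq> U" and t: "k \<notin> set_ipc t" for v t and k :: nat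
  proof -
    have in_N: "eval N v t \<in> carrier N"
      using N v Usub by (induction t) (auto simp: fo_structure_def closed_under_ops_def)
    have c: "eval N (v(k := a)) t = eval N v t" for a
      by (rule eval_cong) (use t in auto)
    have "sat N v (Ex k (Eq (Var k) t))"
      using in_N by (simp add: c)
    from TV[OF v this] show ?thesis by (auto simp: c)
  qed
  have "G (Suc 0) \<subseteq> U" unfolding U_def by blast
  moreover have "G (Suc 0) \<noteq> {}" by (auto simp: GS step_def)
  ultimately obtain u where u: "u \<in> U" by blast
  have Ucl: "closed_under_ops N U"
  proof -
    have "zero N \<in> U" using val[of "\<lambda>_. u" 0 Bot] u by auto
    moreover have "one N \<in> U" using val[of "\<lambda>_. u" 0 Top] u by auto
    moreover have "join N x y \<in> U \<and> meet N x y \<in> U \<and> imp N x y \<in> U" if "x \<in> U" "y \<in> U" for x y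
    proof -
      define v where "v n = (if n = 0 then x else y)" for n :: nat
      have v: "range v \<subseteq> U" using that by (auto simp: v_def)
      show ?thesis
        using val[OF v, of 2 "Or (Var 0) (Var 1)"] val[OF v, of 2 "And (Var 0) (Var 1)"]
          val[OF v, of 2 "To (Var 0) (Var 1)"] by (simp add: v_def)
    qed
    ultimately show ?thesis by (simp add: closed_under_ops_def)
  qed
  define j where "j = the_inv_into U i"
  have ji: "j (i x) = x" if "x \<in> U" for x
    using the_inv_into_f_f[OF i that] by (simp add: j_def)
  define M where "M = \<lparr>carrier = i ` U, zero = i (zero N), one = i (one N),
    join = (\<lambda>x y. i (join N (j x) (j y))), meet = (\<lambda>x y. i (meet N (j x) (j y))),
    imp = (\<lambda>x y. i (imp N (j x) (j y)))\<rparr>"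
  have jM: "j ` carrier M = U" using ji by (force simp: M_def image_iff)
  have emb: "embedding j M N"
    unfolding embedding_def
    using Ucl Usub ji by (auto simp: M_def closed_under_ops_def inj_on_def)
  have fM: "fo_structure M"
    using Ucl ji by (auto simp: fo_structure_def closed_under_ops_def M_def)
  have evM: "eval M v t \<in> carrier M \<and> j (eval M v t) = eval N (j \<circ> v) t"
    if "range v \<subseteq> carrier M" for v and t :: "nat ipc"
    using that emb fM
    by (induction t) (auto simp: embedding_def fo_structure_def closed_under_ops_def)
  have satM: "sat M v p \<longleftrightarrow> sat N (j \<circ> v) p" if "range v \<subseteq> carrier M" for p v
    using that
  proof (induction p arbitrary: v)
    case (Eq s t)
    have "inj_on j (carrier M)" using emb by (simp add: embedding_def)
    then show ?case using evM[OF Eq] by (metis inj_onD sat.simps(1))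
  next
    case (Ex x p)
    have r: "range (v(x := a)) \<subseteq> carrier M" if "a \<in> carrier M" for a
      using that Ex.prems by auto
    have jv: "range (j \<circ> v) \<subseteq> U"
      unfolding jM[symmetric] using Ex.prems by auto
    have IH: "sat M (v(x := a)) p \<longleftrightarrow> sat N ((j \<circ> v)(x := j a)) p" if "a \<in> carrier M" for a
      unfolding fun_upd_comp[symmetric] by (rule Ex.IH) (rule r[OF that])
    have "sat M v (Ex x p) \<longleftrightarrow> (\<exists>a\<in>carrier M. sat N ((j \<circ> v)(x := j a)) p)"
      using IH by simp
    also have "\<dots> \<longleftrightarrow> (\<exists>a\<in>U. sat N ((j \<circ> v)(x := a)) p)"
      using jM by blast
    also have "\<dots> \<longleftrightarrow> sat N (j \<circ> v) (Ex x p)"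
      using TV[OF jv, of x p] Usub by auto
    finally show ?case .
  next
    case (All x p)
    have r: "range (v(x := a)) \<subseteq> carrier M" if "a \<in> carrier M" for a
      using that All.prems by auto
    have jv: "range (j \<circ> v) \<subseteq> U"
      unfolding jM[symmetric] using All.prems by auto
    have IH: "sat M (v(x := a)) p \<longleftrightarrow> sat N ((j \<circ> v)(x := j a)) p" if "a \<in> carrier M" for a
      unfolding fun_upd_comp[symmetric] by (rule All.IH) (rule r[OF that])
    have "sat M v (All x p) \<longleftrightarrow> (\<forall>a\<in>carrier M. sat N ((j \<circ> v)(x := j a)) p)"
      using IH by simp
    also have "\<dots> \<longleftrightarrow> (\<forall>a\<in>U. sat N ((j \<circ> v)(x := a)) p)"
      using jM by blast
    also have "\<dots> \<longleftrightarrow> sat N (j \<circ> v) (All x p)"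
      using TV[OF jv, of x "Neg p"] Usub by auto
    finally show ?case .
  qed auto
  have "X \<subseteq> j ` carrier M"
    unfolding jM U_def using G_def[of 0] by auto
  with emb fM satM show ?thesis using that by blast
qed

lemma models_elementary:
  assumes "models N T" "fo_structure M" "embedding j M N"
    and "\<And>p v. range v \<subseteq> carrier M \<Longrightarrow> sat M v p \<longleftrightarrow> sat N (j \<circ> v) p"
  shows "models M T"
  unfolding models_def
proof (intro conjI ballI allI impI)
  fix p and v :: "nat \<Rightarrow> _" assume p: "p \<in> T" and v: "range v \<subseteq> carrier M"
  have "range (j \<circ> v) \<subseteq> carrier N"
    using v assms(3) unfolding embedding_def by auto
  then have "sat N (j \<circ> v) p"
    using assms(1) p unfolding models_def by blast
  then show "sat M v p"
    using assms(4)[OF v] by blast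
qed (rule assms(2))

text \<open>An extension of an algebra on \<open>'a\<close>, on whatever type, can be cut down to \<open>'a + nat\<close>.\<close>

lemma elementary_subextension:
  fixes H :: "'a hstruct" and K :: "'c hstruct"
  assumes H: "fo_structure H" and K: "models K T" and e: "embedding e H K"
  obtains M :: "('a + nat) hstruct" and f where
    "models M T" "embedding f H M"
    "\<And>p v. range v \<subseteq> carrier H \<Longrightarrow> sat M (f \<circ> v) p \<longleftrightarrow> sat K (e \<circ> v) p"
proof -
  have inf: "infinite (UNIV :: ('a + nat) set)"
    by simp
  have "e ` carrier H \<lesssim> (UNIV :: 'a set)"
    by (meson image_lepoll lepoll_trans subset_UNIV subset_imp_lepoll)
  also have "\<dots> \<lesssim> (UNIV :: ('a + nat) set)"
    unfolding lepoll_def by (metis inj_Inl subset_UNIV)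
  finally have le: "e ` carrier H \<lesssim> (UNIV :: ('a + nat) set)" .
  have sub: "e ` carrier H \<subseteq> carrier K" and K': "fo_structure K"
    using e K by (auto simp: embedding_def models_def)
  obtain M :: "('a + nat) hstruct" and j where M: "embedding j M K" "e ` carrier H \<subseteq> j ` carrier M"
      "fo_structure M" "\<And>p v. range v \<subseteq> carrier M \<Longrightarrow> sat M v p \<longleftrightarrow> sat K (j \<circ> v) p"
    using downward_Loewenheim_Skolem[OF K' sub le inf] by metis
  define f where "f x = inv_into (carrier M) j (e x)" for x
  have f: "f x \<in> carrier M" "j (f x) = e x" if "x \<in> carrier H" for x
    using M(2) that by (auto simp: f_def inv_into_into f_inv_into_f)
  have inj: "inj_on j (carrier M)" using M(1) by (simp add: embedding_def)
  have "embedding f H M"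
    unfolding embedding_def
  proof (intro conjI ballI)
    show "f ` carrier H \<subseteq> carrier M" using f by auto
    show "inj_on f (carrier H)"
    proof (rule inj_onI)
      fix x y assume "x \<in> carrier H" "y \<in> carrier H" "f x = f y"
      then show "x = y"
        using f(2) e inj_onD[of e "carrier H" x y] by (simp add: embedding_def) (metis f(2))
    qed
  qed (rule inj_onD[OF inj]; use f H M(1,3) e in
      \<open>simp add: embedding_def fo_structure_def closed_under_ops_def\<close>)+
  moreover have "sat M (f \<circ> v) p \<longleftrightarrow> sat K (e \<circ> v) p" if "range v \<subseteq> carrier H" for p v
  proof -
    have "j \<circ> (f \<circ> v) = e \<circ> v" using f(2) that by (simp add: fun_eq_iff range_subsetD)
    moreover have "range (f \<circ> v) \<subseteq> carrier M" using f that by auto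
    ultimately show ?thesis using M(4) by metis
  qed
  moreover have "models M T" using models_elementary[OF K M(3,1,4)] .
  ultimately show ?thesis using that by blast
qed

theorem ex_closed_any_type:
  fixes H :: "'a hstruct" and K :: "'c hstruct"
  assumes "ex_closed H" "heyting_algebra K" "embedding e H K"
    and "existential p" "range v \<subseteq> carrier H" "sat K (e \<circ> v) p"
  shows "sat H v p"
proof -
  have H: "fo_structure H"
    using assms(1) by (simp add: ex_closed_def heyting_algebra_def)
  have "models K heyting_axioms" using assms(2) by (simp add: models_heyting_axioms)
  from elementary_subextension[OF H this assms(3)]
  obtain M :: "('a + nat) hstruct" and f where "models M heyting_axioms" "embedding f H M"
      "\<And>p v. range v \<subseteq> carrier H \<Longrightarrow> sat M (f \<circ> v) p \<longleftrightarrow> sat K (e \<circ> v) p"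
    by metis
  then show ?thesis
    using assms unfolding ex_closed_def models_heyting_axioms by blast
qed

theorem model_completion_any_type:
  fixes M :: "'a hstruct" and N1 :: "'c hstruct" and N2 :: "'d hstruct"
  assumes mc: "model_completion TYPE('a) T S" and M: "models M T"
    and N1: "models N1 S" "embedding e1 M N1" and N2: "models N2 S" "embedding e2 M N2"
    and v: "range v \<subseteq> carrier M"
  shows "sat N1 (e1 \<circ> v) p \<longleftrightarrow> sat N2 (e2 \<circ> v) p"
proof -
  have M': "fo_structure M" using M by (simp add: models_def)
  obtain L1 :: "('a + nat) hstruct" and f1 where 1: "models L1 S" "embedding f1 M L1"
      "\<And>p v. range v \<subseteq> carrier M \<Longrightarrow> sat L1 (f1 \<circ> v) p \<longleftrightarrow> sat N1 (e1 \<circ> v) p"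
    using elementary_subextension[OF M' N1] by metis
  obtain L2 :: "('a + nat) hstruct" and f2 where 2: "models L2 S" "embedding f2 M L2"
      "\<And>p v. range v \<subseteq> carrier M \<Longrightarrow> sat L2 (f2 \<circ> v) p \<longleftrightarrow> sat N2 (e2 \<circ> v) p"
    using elementary_subextension[OF M' N2] by metis
  have "sat L1 (f1 \<circ> v) p \<longleftrightarrow> sat L2 (f2 \<circ> v) p"
    using mc M 1(1,2) 2(1,2) v unfolding model_completion_def by blast
  then show ?thesis using 1(3) 2(3) v by blast
qed

theorem ipc_equiv_any_type:
  fixes A :: "'c hstruct"
  assumes "ipc_equiv s t" "heyting_algebra A" "range v \<subseteq> carrier A"
  shows "eval A v s = eval A v t"
proof -
  have A: "fo_structure A" "models A heyting_axioms"
    using assms(2) by (simp_all add: heyting_algebra_def models_heyting_axioms)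
  have le: "range v \<lesssim> (UNIV :: nat set)" by (rule image_lepoll)
  obtain M :: "nat hstruct" and j where M: "embedding j M A" "range v \<subseteq> j ` carrier M"
      "fo_structure M" "\<And>p v. range v \<subseteq> carrier M \<Longrightarrow> sat M v p \<longleftrightarrow> sat A (j \<circ> v) p"
    using downward_Loewenheim_Skolem[OF A(1) assms(3) le infinite_UNIV_nat] by metis
  define w where "w x = inv_into (carrier M) j (v x)" for x
  have w: "range w \<subseteq> carrier M" "j \<circ> w = v"
    using M(2) by (auto simp: w_def fun_eq_iff intro!: inv_into_into f_inv_into_f)
  have "heyting_algebra M"
    using models_elementary[OF A(2) M(3,1,4)] by (simp add: models_heyting_axioms)
  then have "sat M w (Eq s t)"
    using assms(1) w(1) by (simp add: ipc_equiv_def)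
  then show ?thesis using M(4)[OF w(1), of "Eq s t"] w(2) by simp
qed

end

theory Submission
  imports Defs
begin

text \<open>
  An algebra \<open>A\<close> embeds into the up-sets of its poset of prime filters, and any surjective p-morphism
  onto that poset yields an extension of \<open>A\<close>; no topology is needed. Extensions of this kind give
  Density and Splitting for an existentially closed \<open>A\<close>. They also give an amalgamation theorem: if
  tuples of \<open>A\<close> and \<open>B\<close> satisfy the same formulas of sufficiently large degree, then the type of
  degree \<open>d\<close> of any further element of \<open>B\<close> is realised in an extension of \<open>A\<close>. Hence existentially
  closed algebras have the QE property, and a back-and-forth argument decides first-order formulas.

  Conversely, Density and Splitting allow every finite tree to be unfolded inside the spectrum, so that
  every finite non-trivial algebra embeds into a non-trivial \<open>H\<close> with these properties. By filtration, any
  system solvable in an extension of \<open>H\<close> is solvable in a finite algebra, hence in \<open>H\<close> over a tuple with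
  the same formulas of bounded degree, and QE moves the solution to the given parameters.

  Filtration also shows that \<open>H0\<close>, which contains every finite extension of its finite subalgebras,
  is existentially closed. Every non-trivial algebra embeds into an ultrapower of \<open>Ht\<close>,
  because its finite parts embed into \<open>Ht\<close>.
\<close>


text \<open>Every move up in the game between two spectra costs one degree, while an extension must
  answer moves along chains of any length. A point of the amalgam therefore carries a type of degree
  \<open>d\<close> rather than a point of \<open>B\<close>: along a chain the type can grow strictly
  at most as often as there are representatives of the formulas of degree \<open>d\<close> in
  \<open>l + 1\<close> variables, and only growth has to be paid for. With c representatives, two
  degrees for each growth and two to start give the bound 2 c + 2.

  The embedding of a finite algebra obtained from Density and Splitting does not fix given elements
  of \<open>H\<close>, which is why QE must intervene; inside \<open>H0\<close> the construction
  does fix them.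

  The indices agree because a bound on the index is a first-order sentence: when the back-and-forth
  argument starts at the constants, it makes all non-trivial existentially closed algebras
  elementarily equivalent.\<close>

section \<open>Order and lattice laws of Heyting algebras\<close>

lemma heyting_algebraI:
  assumes "fo_structure A"
    and "\<And>x. x \<in> carrier A \<Longrightarrow> meet A x (one A) = x"
    and "\<And>x. x \<in> carrier A \<Longrightarrow> join A x (zero A) = x"
    and "\<And>x y. x \<in> carrier A \<Longrightarrow> y \<in> carrier A \<Longrightarrow> join A x y = join A y x"
    and "\<And>x y. x \<in> carrier A \<Longrightarrow> y \<in> carrier A \<Longrightarrow> meet A x y = meet A y x"
    and "\<And>x y. x \<in> carrier A \<Longrightarrow> y \<in> carrier A \<Longrightarrow> join A x (meet A x y) = x"
    and "\<And>x y. x \<in> carrier A \<Longrightarrow> y \<in> carrier A \<Longrightarrow> meet A x (join A x y) = x"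
    and "\<And>x y z. x \<in> carrier A \<Longrightarrow> y \<in> carrier A \<Longrightarrow> z \<in> carrier A \<Longrightarrow>
      join A (join A x y) z = join A x (join A y z)"
    and "\<And>x y z. x \<in> carrier A \<Longrightarrow> y \<in> carrier A \<Longrightarrow> z \<in> carrier A \<Longrightarrow>
      meet A (meet A x y) z = meet A x (meet A y z)"
    and "\<And>x y z. x \<in> carrier A \<Longrightarrow> y \<in> carrier A \<Longrightarrow> z \<in> carrier A \<Longrightarrow>
      le A (meet A x y) z \<longleftrightarrow> le A x (imp A y z)"
  shows "heyting_algebra A"
  unfolding heyting_algebra_def by (intro conjI ballI assms)

locale heyting =
  fixes A :: "'a hstruct"
  assumes heyting: "heyting_algebra A"
begin

lemma zero_closed [simp]: "zero A \<in> carrier A"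
  and one_closed [simp]: "one A \<in> carrier A"
  and join_closed [simp]: "x \<in> carrier A \<Longrightarrow> y \<in> carrier A \<Longrightarrow> join A x y \<in> carrier A"
  and meet_closed [simp]: "x \<in> carrier A \<Longrightarrow> y \<in> carrier A \<Longrightarrow> meet A x y \<in> carrier A"
  and imp_closed [simp]: "x \<in> carrier A \<Longrightarrow> y \<in> carrier A \<Longrightarrow> imp A x y \<in> carrier A"
  using heyting by (auto simp: heyting_algebra_def fo_structure_def closed_under_ops_def)

lemma meet_one: "x \<in> carrier A \<Longrightarrow> meet A x (one A) = x"
  and join_zero: "x \<in> carrier A \<Longrightarrow> join A x (zero A) = x"
  using heyting by (auto simp: heyting_algebra_def)

lemma
  assumes "x \<in> carrier A" "y \<in> carrier A"
  shows join_commute: "join A x y = join A y x"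
    and meet_commute: "meet A x y = meet A y x"
    and join_absorb: "join A x (meet A x y) = x"
    and meet_absorb: "meet A x (join A x y) = x"
  using heyting assms unfolding heyting_algebra_def by blast+

lemma
  assumes "x \<in> carrier A" "y \<in> carrier A" "z \<in> carrier A"
  shows join_assoc: "join A (join A x y) z = join A x (join A y z)"
    and meet_assoc: "meet A (meet A x y) z = meet A x (meet A y z)"
    and le_imp_iff: "le A x (imp A y z) \<longleftrightarrow> le A (meet A x y) z"
  using heyting assms unfolding heyting_algebra_def by blast+

lemma le_refl: "x \<in> carrier A \<Longrightarrow> le A x x"
  unfolding le_def by (metis join_absorb meet_absorb meet_closed)

lemma le_antisym:
  "x \<in> carrier A \<Longrightarrow> y \<in> carrier A \<Longrightarrow> le A x y \<Longrightarrow> le A y x \<Longrightarrow> x = y"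
  unfolding le_def by (metis meet_commute)

lemma le_trans:
  assumes "x \<in> carrier A" "y \<in> carrier A" "z \<in> carrier A" "le A x y" "le A y z"
  shows "le A x z"
  using assms unfolding le_def by (metis meet_assoc)

lemma le_iff_join: "x \<in> carrier A \<Longrightarrow> y \<in> carrier A \<Longrightarrow> le A x y \<longleftrightarrow> join A x y = y"
  unfolding le_def by (metis join_absorb join_commute meet_absorb meet_commute)

lemma meet_le1: "x \<in> carrier A \<Longrightarrow> y \<in> carrier A \<Longrightarrow> le A (meet A x y) x"
  unfolding le_iff_join[OF meet_closed] by (metis join_absorb join_commute meet_closed)

lemma meet_le2: "x \<in> carrier A \<Longrightarrow> y \<in> carrier A \<Longrightarrow> le A (meet A x y) y"
  by (metis meet_commute meet_le1)

lemma join_ge1: "x \<in> carrier A \<Longrightarrow> y \<in> carrier A \<Longrightarrow> le A x (join A x y)"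
  by (simp add: le_def meet_absorb)

lemma join_ge2: "x \<in> carrier A \<Longrightarrow> y \<in> carrier A \<Longrightarrow> le A y (join A x y)"
  by (metis join_commute join_ge1)

lemma le_meet:
  assumes "x \<in> carrier A" "y \<in> carrier A" "z \<in> carrier A" "le A x y" "le A x z"
  shows "le A x (meet A y z)"
  using assms unfolding le_def by (metis meet_assoc)

lemma meet_mono:
  assumes "x \<in> carrier A" "y \<in> carrier A" "x' \<in> carrier A" "y' \<in> carrier A" "le A x x'" "le A y y'"
  shows "le A (meet A x y) (meet A x' y')"
proof (rule le_meet)
  show "le A (meet A x y) x'" by (rule le_trans[of _ x]) (use assms meet_le1 in simp_all)
  show "le A (meet A x y) y'" by (rule le_trans[of _ y]) (use assms meet_le2 in simp_all)
qed (use assms in simp_all)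

lemma join_le:
  assumes "x \<in> carrier A" "y \<in> carrier A" "z \<in> carrier A" "le A x z" "le A y z"
  shows "le A (join A x y) z"
  using assms by (simp add: le_iff_join join_assoc)

lemma zero_le: "x \<in> carrier A \<Longrightarrow> le A (zero A) x"
  by (metis join_commute join_zero le_iff_join zero_closed)

lemma le_one: "x \<in> carrier A \<Longrightarrow> le A x (one A)"
  by (simp add: le_def meet_one)

lemma eval_closed [simp]: "range v \<subseteq> carrier A \<Longrightarrow> eval A v t \<in> carrier A"
  by (induction t) auto

end

lemma heytingI: "heyting_algebra A \<Longrightarrow> heyting A"
  by (simp add: heyting_def)


section \<open>Prime filters\<close>

definition hfilter :: "'a hstruct \<Rightarrow> 'a set \<Rightarrow> bool" where
  "hfilter A F \<longleftrightarrow> F \<subseteq> carrier A \<and> one A \<in> F \<and> (\<forall>x\<in>F. \<forall>y\<in>F. meet A x y \<in> F) \<and>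
     (\<forall>x\<in>F. \<forall>y\<in>carrier A. le A x y \<longrightarrow> y \<in> F)"

text \<open>The points of the dual space of \<open>A\<close>, ordered by inclusion; an element
  \<open>a\<close> stands for the clopen up-set of the points containing it. Prime filters are
  proper, so the trivial algebra has none.\<close>

definition prime_filters :: "'a hstruct \<Rightarrow> 'a set set" where
  "prime_filters A = {F. hfilter A F \<and> zero A \<notin> F \<and>
     (\<forall>x\<in>carrier A. \<forall>y\<in>carrier A. join A x y \<in> F \<longrightarrow> x \<in> F \<or> y \<in> F)}"

context heyting
begin

text \<open>\<open>G\<close> is the filter generated by \<open>F\<close> and \<open>x\<close>. It
  contains \<open>y\<close> exactly when \<open>imp A x y\<close> lies in \<open>F\<close>, which is
  why it serves both the maximality argument and the clause for implication.\<close>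

lemma hfilter_adjoin:
  assumes F: "hfilter A F" and x: "x \<in> carrier A"
  defines "G \<equiv> {z \<in> carrier A. \<exists>m\<in>F. le A (meet A m x) z}"
  shows "hfilter A G" "F \<subseteq> G" "x \<in> G"
proof -
  have Fc: "m \<in> carrier A" if "m \<in> F" for m using F that by (auto simp: hfilter_def)
  have one: "one A \<in> F" and meet: "\<And>m n. m \<in> F \<Longrightarrow> n \<in> F \<Longrightarrow> meet A m n \<in> F"
    using F by (auto simp: hfilter_def)
  have "meet A y z \<in> G" if y: "y \<in> G" and z: "z \<in> G" for y z
  proof -
    obtain m n where m: "m \<in> F" "le A (meet A m x) y" and n: "n \<in> F" "le A (meet A n x) z"
      using y z by (auto simp: G_def)
    have c: "y \<in> carrier A" "z \<in> carrier A" "m \<in> carrier A" "n \<in> carrier A"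
      using y z Fc m n by (auto simp: G_def)
    let ?k = "meet A m n"
    have "le A (meet A ?k x) (meet A m x)" "le A (meet A ?k x) (meet A n x)"
      using c x by (simp_all add: meet_mono meet_le1 meet_le2 le_refl)
    then have "le A (meet A ?k x) y" "le A (meet A ?k x) z"
      using le_trans[OF _ _ _ _ m(2)] le_trans[OF _ _ _ _ n(2)] c x by simp_all
    then have "le A (meet A ?k x) (meet A y z)"
      using c x by (simp add: le_meet)
    moreover have "?k \<in> F" using meet m n by simp
    ultimately show ?thesis using c by (auto simp: G_def)
  qed
  moreover have "one A \<in> G"
    using one x by (auto simp: G_def intro!: bexI[of _ "one A"] le_one)
  moreover have "z \<in> G" if yz: "y \<in> G" "z \<in> carrier A" "le A y z" for y z
  proof -
    obtain m where m: "m \<in> F" "le A (meet A m x) y" using yz by (auto simp: G_def)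
    have "le A (meet A m x) z"
      by (rule le_trans[OF _ _ _ m(2)]) (use yz x Fc m in \<open>auto simp: G_def\<close>)
    then show ?thesis using m yz by (auto simp: G_def)
  qed
  ultimately show "hfilter A G" by (auto simp: hfilter_def G_def)
  show "F \<subseteq> G" using x Fc meet_le1 by (auto simp: G_def)
  show "x \<in> G" using x meet_le2[OF one_closed x] one by (auto simp: G_def)
qed

text \<open>Zorn's lemma gives a filter maximal among those that contain \<open>F\<close> and avoid
  \<open>a\<close>; maximality makes it prime.\<close>

theorem prime_filter_theorem:
  assumes F: "hfilter A F" and a: "a \<in> carrier A" "a \<notin> F"
  obtains G where "G \<in> prime_filters A" "F \<subseteq> G" "a \<notin> G"
proof -
  define Z where "Z = {G. hfilter A G \<and> F \<subseteq> G \<and> a \<notin> G}"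
  have "\<Union>C \<in> Z" if "C \<noteq> {}" "subset.chain Z C" for C
  proof -
    note C = that
    have CZ: "C \<subseteq> Z" and ch: "\<And>x y. x \<in> C \<Longrightarrow> y \<in> C \<Longrightarrow> x \<subseteq> y \<or> y \<subseteq> x"
      using C(2) unfolding subset.chain_def by blast+
    have "meet A x y \<in> \<Union>C" if xy: "x \<in> \<Union>C" "y \<in> \<Union>C" for x y
    proof -
      obtain X Y where XY: "X \<in> C" "Y \<in> C" "x \<in> X" "y \<in> Y" using xy by blast
      then obtain V where "V \<in> C" "x \<in> V" "y \<in> V" using ch[of X Y] by blast
      then show ?thesis using CZ unfolding Z_def hfilter_def by blast
    qed
    moreover have "one A \<in> \<Union>C" "F \<subseteq> \<Union>C" "a \<notin> \<Union>C" "\<Union>C \<subseteq> carrier A"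
      using C(1) CZ unfolding Z_def hfilter_def by blast+
    moreover have "\<forall>x\<in>\<Union>C. \<forall>y\<in>carrier A. le A x y \<longrightarrow> y \<in> \<Union>C"
      using CZ unfolding Z_def hfilter_def by blast
    ultimately show ?thesis by (auto simp: Z_def hfilter_def)
  qed
  moreover have "Z \<noteq> {}" using F a by (auto simp: Z_def)
  ultimately obtain M where M: "M \<in> Z" and max: "\<And>X. X \<in> Z \<Longrightarrow> M \<subseteq> X \<Longrightarrow> X = M"
    using subset_Zorn_nonempty[of Z] by metis
  have MF: "hfilter A M" and aM: "a \<notin> M" and FM: "F \<subseteq> M" using M by (auto simp: Z_def)
  \<comment> \<open>By maximality, adjoining \<open>x\<close> captures \<open>a\<close>.\<close>
  have wit: "\<exists>m\<in>M. le A (meet A m x) a" if x: "x \<in> carrier A" "x \<notin> M" for x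
  proof (rule ccontr)
    assume "\<not> ?thesis"
    then have "{z \<in> carrier A. \<exists>m\<in>M. le A (meet A m x) z} \<in> Z"
      using hfilter_adjoin[OF MF x(1)] FM unfolding Z_def by blast
    then show False using max hfilter_adjoin[OF MF x(1)] x(2) by blast
  qed
  have "x \<in> M \<or> y \<in> M" if xy: "x \<in> carrier A" "y \<in> carrier A" "join A x y \<in> M" for x y
  proof (rule ccontr)
    assume "\<not> ?thesis"
    then obtain m n where mn: "m \<in> M" "n \<in> M" "le A (meet A m x) a" "le A (meet A n y) a"
      using wit xy by metis
    have c: "m \<in> carrier A" "n \<in> carrier A" using mn MF by (auto simp: hfilter_def)
    let ?k = "meet A m n"
    have "le A (meet A x ?k) (meet A m x)" "le A (meet A y ?k) (meet A n y)"
      unfolding meet_commute[OF xy(1) c(1)[THEN meet_closed, OF c(2)]]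
        meet_commute[OF xy(2) c(1)[THEN meet_closed, OF c(2)]]
      using c xy by (simp_all add: meet_mono meet_le1 meet_le2 le_refl)
    then have "le A (meet A x ?k) a" "le A (meet A y ?k) a"
      using le_trans[OF _ _ _ _ mn(3)] le_trans[OF _ _ _ _ mn(4)] c xy a by simp_all
    \<comment> \<open>Distributivity enters through residuation: \<open>x\<close> and
      \<open>y\<close> lie below k -> a, hence so does their join.\<close>
    then have "le A (join A x y) (imp A ?k a)"
      using c xy a by (intro join_le) (simp_all add: le_imp_iff)
    then have "le A (meet A (join A x y) ?k) a"
      using c xy a by (simp add: le_imp_iff)
    moreover have "meet A (join A x y) ?k \<in> M"
      using xy mn MF by (auto simp: hfilter_def)
    ultimately show False using aM a MF by (auto simp: hfilter_def)
  qed
  moreover have "zero A \<notin> M" using aM a MF zero_le by (auto simp: hfilter_def)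
  ultimately have "M \<in> prime_filters A" using MF by (auto simp: prime_filters_def)
  then show ?thesis using that FM aM by blast
qed

section \<open>Compound elements and equations in terms of points\<close>

lemma prime_filter_subset: "F \<in> prime_filters A \<Longrightarrow> F \<subseteq> carrier A"
  and one_in_prime [simp]: "F \<in> prime_filters A \<Longrightarrow> one A \<in> F"
  and zero_notin_prime [simp]: "F \<in> prime_filters A \<Longrightarrow> zero A \<notin> F"
  by (auto simp: prime_filters_def hfilter_def)

lemma prime_filter_le:
  "F \<in> prime_filters A \<Longrightarrow> x \<in> F \<Longrightarrow> y \<in> carrier A \<Longrightarrow> le A x y \<Longrightarrow> y \<in> F"
  unfolding prime_filters_def hfilter_def by blast

lemma meet_in_prime [simp]:
  assumes "F \<in> prime_filters A" "x \<in> carrier A" "y \<in> carrier A"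
  shows "meet A x y \<in> F \<longleftrightarrow> x \<in> F \<and> y \<in> F"
proof
  show "meet A x y \<in> F \<Longrightarrow> x \<in> F \<and> y \<in> F"
    using prime_filter_le[OF assms(1) _ _ meet_le1] prime_filter_le[OF assms(1) _ _ meet_le2] assms
    by blast
qed (use assms in \<open>unfold prime_filters_def hfilter_def, blast\<close>)

lemma join_in_prime [simp]:
  assumes "F \<in> prime_filters A" "x \<in> carrier A" "y \<in> carrier A"
  shows "join A x y \<in> F \<longleftrightarrow> x \<in> F \<or> y \<in> F"
proof
  show "x \<in> F \<or> y \<in> F \<Longrightarrow> join A x y \<in> F"
    using prime_filter_le[OF assms(1) _ join_closed join_ge1]
      prime_filter_le[OF assms(1) _ join_closed join_ge2] assms by blast
qed (use assms in \<open>unfold prime_filters_def, blast\<close>)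

text \<open>If \<open>y\<close> is not in the filter generated by \<open>F\<close> and
  \<open>x\<close>, a prime extension of that filter avoids \<open>y\<close> and refutes the
  right-hand side.\<close>

lemma imp_in_prime:
  assumes F: "F \<in> prime_filters A" and x: "x \<in> carrier A" and y: "y \<in> carrier A"
  shows "imp A x y \<in> F \<longleftrightarrow> (\<forall>G\<in>prime_filters A. F \<subseteq> G \<longrightarrow> x \<in> G \<longrightarrow> y \<in> G)"
proof
  assume i: "imp A x y \<in> F"
  show "\<forall>G\<in>prime_filters A. F \<subseteq> G \<longrightarrow> x \<in> G \<longrightarrow> y \<in> G"
  proof (intro ballI impI)
    fix G assume G: "G \<in> prime_filters A" "F \<subseteq> G" "x \<in> G"
    have "meet A (imp A x y) x \<in> G" using G i x y by auto
    moreover have "le A (meet A (imp A x y) x) y"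
      using x y by (metis imp_closed le_imp_iff le_refl)
    ultimately show "y \<in> G" using G(1) y prime_filter_le by blast
  qed
next
  assume *: "\<forall>G\<in>prime_filters A. F \<subseteq> G \<longrightarrow> x \<in> G \<longrightarrow> y \<in> G"
  have FF: "hfilter A F" using F unfolding prime_filters_def by blast
  let ?G = "{z \<in> carrier A. \<exists>m\<in>F. le A (meet A m x) z}"
  have "y \<in> ?G"
  proof (rule ccontr)
    assume "y \<notin> ?G"
    from prime_filter_theorem[OF hfilter_adjoin(1)[OF FF x] y this]
    obtain G where "G \<in> prime_filters A" "?G \<subseteq> G" "y \<notin> G" .
    then show False using * hfilter_adjoin(2,3)[OF FF x] by blast
  qed
  then obtain m where m: "m \<in> F" "le A (meet A m x) y" by blast
  then have "le A m (imp A x y)"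
    using x y prime_filter_subset[OF F] le_imp_iff by blast
  then show "imp A x y \<in> F" using prime_filter_le[OF F m(1)] x y imp_closed by blast
qed

text \<open>The principal filter of \<open>x\<close> is separated from \<open>y\<close>. With this
  representation equations can be checked point by point.\<close>

lemma le_iff_prime:
  assumes x: "x \<in> carrier A" and y: "y \<in> carrier A"
  shows "le A x y \<longleftrightarrow> (\<forall>F\<in>prime_filters A. x \<in> F \<longrightarrow> y \<in> F)"
proof
  show "le A x y \<Longrightarrow> \<forall>F\<in>prime_filters A. x \<in> F \<longrightarrow> y \<in> F"
    using prime_filter_le y by blast
  assume *: "\<forall>F\<in>prime_filters A. x \<in> F \<longrightarrow> y \<in> F"
  let ?F = "{z \<in> carrier A. le A x z}"
  have "hfilter A ?F"
    using x by (auto simp: hfilter_def le_one intro: le_meet le_trans)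
  moreover have "x \<in> ?F" using x le_refl by simp
  ultimately show "le A x y" using prime_filter_theorem[of ?F y] * y by blast
qed

lemma eq_iff_prime:
  "x \<in> carrier A \<Longrightarrow> y \<in> carrier A \<Longrightarrow> x = y \<longleftrightarrow> (\<forall>F\<in>prime_filters A. x \<in> F \<longleftrightarrow> y \<in> F)"
  by (metis le_antisym le_iff_prime)

lemma eq_one_iff_prime: "x \<in> carrier A \<Longrightarrow> x = one A \<longleftrightarrow> (\<forall>F\<in>prime_filters A. x \<in> F)"
  by (simp add: eq_iff_prime)

lemma eq_zero_iff_prime: "x \<in> carrier A \<Longrightarrow> x = zero A \<longleftrightarrow> (\<forall>F\<in>prime_filters A. x \<notin> F)"
  by (simp add: eq_iff_prime)

lemma trivial_carrier:
  assumes "\<not> nontrivial A" "x \<in> carrier A"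
  shows "x = one A"
  using assms by (metis le_antisym le_one nontrivial_def one_closed zero_le)

end


section \<open>Algebras of up-sets\<close>

text \<open>The algebra of an intuitionistic Kripke frame. The frames used below are sets of
  labelled points, families of sets under inclusion, and a discrete set.\<close>

definition upalg :: "'w set \<Rightarrow> ('w \<Rightarrow> 'w \<Rightarrow> bool) \<Rightarrow> 'w set hstruct" where
  "upalg W r = \<lparr>carrier = {X. X \<subseteq> W \<and> (\<forall>x\<in>X. \<forall>y\<in>W. r x y \<longrightarrow> y \<in> X)},
     zero = {}, one = W, join = (\<union>), meet = (\<inter>),
     imp = (\<lambda>X Y. {x \<in> W. \<forall>y\<in>W. r x y \<longrightarrow> y \<in> X \<longrightarrow> y \<in> Y})\<rparr>"

lemma upalg_simps [simp]:
  "carrier (upalg W r) = {X. X \<subseteq> W \<and> (\<forall>x\<in>X. \<forall>y\<in>W. r x y \<longrightarrow> y \<in> X)}"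
  "zero (upalg W r) = {}" "one (upalg W r) = W"
  "join (upalg W r) X Y = X \<union> Y" "meet (upalg W r) X Y = X \<inter> Y"
  "imp (upalg W r) X Y = {x \<in> W. \<forall>y\<in>W. r x y \<longrightarrow> y \<in> X \<longrightarrow> y \<in> Y}"
  by (auto simp: upalg_def)

lemma heyting_upalg:
  assumes refl: "\<And>x. x \<in> W \<Longrightarrow> r x x"
    and trans: "\<And>x y z. x \<in> W \<Longrightarrow> y \<in> W \<Longrightarrow> z \<in> W \<Longrightarrow> r x y \<Longrightarrow> r y z \<Longrightarrow> r x z"
  shows "heyting_algebra (upalg W r)"
proof -
  let ?U = "upalg W r"
  have adj: "le ?U (meet ?U X Y) Z \<longleftrightarrow> le ?U X (imp ?U Y Z)"
    if X: "X \<in> carrier ?U" for X Y Z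
  proof -
    have "le ?U (meet ?U X Y) Z \<longleftrightarrow> X \<inter> Y \<subseteq> Z" by (auto simp: le_def)
    also have "\<dots> \<longleftrightarrow> X \<subseteq> imp ?U Y Z"
    proof
      show "X \<inter> Y \<subseteq> Z \<Longrightarrow> X \<subseteq> imp ?U Y Z" using X by auto
      show "X \<subseteq> imp ?U Y Z \<Longrightarrow> X \<inter> Y \<subseteq> Z" using X refl by (simp add: subset_iff) blast
    qed
    also have "\<dots> \<longleftrightarrow> le ?U X (imp ?U Y Z)" unfolding le_def upalg_simps(5) by blast
    finally show ?thesis .
  qed
  have imp: "imp ?U X Y \<in> carrier ?U" for X Y
  proof -
    have "z \<in> Y" if "x \<in> W" "\<forall>y\<in>W. r x y \<longrightarrow> y \<in> X \<longrightarrow> y \<in> Y" "y \<in> W" "r x y" "z \<in> W" "r y z" "z \<in> X"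
      for x y z
      using that trans[of x y z] by blast
    then show ?thesis unfolding upalg_simps by blast
  qed
  have "join ?U X Y \<in> carrier ?U" "meet ?U X Y \<in> carrier ?U"
    if "X \<in> carrier ?U" "Y \<in> carrier ?U" for X Y
    using that unfolding upalg_simps by blast+
  moreover have "zero ?U \<in> carrier ?U" "one ?U \<in> carrier ?U" by auto
  ultimately have "fo_structure ?U"
    unfolding fo_structure_def closed_under_ops_def using imp by blast
  then show ?thesis
  proof (rule heyting_algebraI)
    fix x assume "x \<in> carrier ?U"
    then show "meet ?U x (one ?U) = x" "join ?U x (zero ?U) = x" by auto
  next
    fix x y z assume "x \<in> carrier ?U"
    then show "le ?U (meet ?U x y) z \<longleftrightarrow> le ?U x (imp ?U y z)" by (rule adj)
  qed (unfold upalg_simps(4,5), blast+)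
qed

text \<open>The hypotheses say that \<open>f\<close> is a surjective p-morphism onto the prime spectrum.\<close>

lemma (in heyting) embedding_upalg:
  assumes f: "\<And>z. z \<in> V \<Longrightarrow> f z \<in> prime_filters A"
    and surj: "\<And>F. F \<in> prime_filters A \<Longrightarrow> \<exists>z\<in>V. f z = F"
    and mono: "\<And>y z. y \<in> V \<Longrightarrow> z \<in> V \<Longrightarrow> s y z \<Longrightarrow> f y \<subseteq> f z"
    and bk: "\<And>y F. y \<in> V \<Longrightarrow> F \<in> prime_filters A \<Longrightarrow> f y \<subseteq> F \<Longrightarrow> \<exists>z\<in>V. s y z \<and> f z = F"
  shows "embedding (\<lambda>a. {z \<in> V. a \<in> f z}) A (upalg V s)"
  unfolding embedding_def
proof (intro conjI ballI)
  show "inj_on (\<lambda>a. {z \<in> V. a \<in> f z}) (carrier A)"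
  proof (rule inj_onI)
    fix a b assume "a \<in> carrier A" "b \<in> carrier A" "{z \<in> V. a \<in> f z} = {z \<in> V. b \<in> f z}"
    then show "a = b" using surj by (subst eq_iff_prime) blast+
  qed
next
  fix a b assume ab: "a \<in> carrier A" "b \<in> carrier A"
  show "{z \<in> V. imp A a b \<in> f z} = imp (upalg V s) {z \<in> V. a \<in> f z} {z \<in> V. b \<in> f z}"
  proof -
    have "imp A a b \<in> f y \<longleftrightarrow> (\<forall>z\<in>V. s y z \<longrightarrow> a \<in> f z \<longrightarrow> b \<in> f z)" if y: "y \<in> V" for y
    proof
      assume "imp A a b \<in> f y"
      then show "\<forall>z\<in>V. s y z \<longrightarrow> a \<in> f z \<longrightarrow> b \<in> f z"
        unfolding imp_in_prime[OF f[OF y] ab] using mono[OF y] f by blast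
    next
      assume *: "\<forall>z\<in>V. s y z \<longrightarrow> a \<in> f z \<longrightarrow> b \<in> f z"
      show "imp A a b \<in> f y"
        unfolding imp_in_prime[OF f[OF y] ab] using * bk[OF y] by blast
    qed
    then show ?thesis by auto
  qed
  show "{z \<in> V. join A a b \<in> f z} = join (upalg V s) {z \<in> V. a \<in> f z} {z \<in> V. b \<in> f z}"
    "{z \<in> V. meet A a b \<in> f z} = meet (upalg V s) {z \<in> V. a \<in> f z} {z \<in> V. b \<in> f z}"
    using ab by (auto simp: f)
next
  show "(\<lambda>a. {z \<in> V. a \<in> f z}) ` carrier A \<subseteq> carrier (upalg V s)"
    using mono by auto
qed (use f in auto)


section \<open>Formulas up to equivalence\<close>

lemma eval_map_ipc: "eval A v (map_ipc r t) = eval A (v \<circ> r) t"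
  by (induction t) auto

lemma degree_map_ipc [simp]: "degree (map_ipc r t) = degree t"
  by (induction t) auto

lemma ipc_formulas_simps [simp]:
  "Var x \<in> ipc_formulas l n \<longleftrightarrow> x < l" "Bot \<in> ipc_formulas l n" "Top \<in> ipc_formulas l n"
  "Or s t \<in> ipc_formulas l n \<longleftrightarrow> s \<in> ipc_formulas l n \<and> t \<in> ipc_formulas l n"
  "And s t \<in> ipc_formulas l n \<longleftrightarrow> s \<in> ipc_formulas l n \<and> t \<in> ipc_formulas l n"
  "To s t \<in> ipc_formulas l (Suc n) \<longleftrightarrow> s \<in> ipc_formulas l n \<and> t \<in> ipc_formulas l n"
  "To s t \<notin> ipc_formulas l 0"
  by (auto simp: ipc_formulas_def)

lemma ipc_formulas_mono: "l \<le> l' \<Longrightarrow> n \<le> n' \<Longrightarrow> ipc_formulas l n \<subseteq> ipc_formulas l' n'"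
  by (force simp: ipc_formulas_def)

lemma ipc_formulas_ToD:
  "To s t \<in> ipc_formulas l n \<Longrightarrow> s \<in> ipc_formulas l n \<and> t \<in> ipc_formulas l n"
  by (auto simp: ipc_formulas_def)

lemma eval_cong_formulas:
  "t \<in> ipc_formulas l n \<Longrightarrow> (\<And>i. i < l \<Longrightarrow> v i = w i) \<Longrightarrow> eval A v t = eval A w t"
  by (rule eval_cong) (auto simp: ipc_formulas_def)

lemma eval_embedding:
  assumes "heyting_algebra A" "embedding e A B" "range v \<subseteq> carrier A"
  shows "eval B (e \<circ> v) t = e (eval A v t)"
proof -
  interpret heyting A by (rule heytingI[OF assms(1)])
  show ?thesis
    using assms(2) eval_closed[OF assms(3)] by (induction t) (simp_all add: embedding_def)
qed

section \<open>Finitely many formulas of each degree\<close>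

inductive_set lattice_closure :: "nat ipc set \<Rightarrow> nat ipc set" for G where
  "g \<in> G \<Longrightarrow> g \<in> lattice_closure G"
| "Bot \<in> lattice_closure G"
| "Top \<in> lattice_closure G"
| "s \<in> lattice_closure G \<Longrightarrow> t \<in> lattice_closure G \<Longrightarrow> Or s t \<in> lattice_closure G"
| "s \<in> lattice_closure G \<Longrightarrow> t \<in> lattice_closure G \<Longrightarrow> And s t \<in> lattice_closure G"

text \<open>The classical truth value in which variables and implications are both treated as
  atoms.\<close>

primrec truth :: "nat ipc set \<Rightarrow> nat ipc \<Rightarrow> bool" where
  "truth S (Var x) \<longleftrightarrow> Var x \<in> S"
| "truth S Bot \<longleftrightarrow> False"
| "truth S Top \<longleftrightarrow> True"
| "truth S (Or s t) \<longleftrightarrow> truth S s \<or> truth S t"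
| "truth S (And s t) \<longleftrightarrow> truth S s \<and> truth S t"
| "truth S (To s t) \<longleftrightarrow> To s t \<in> S"

text \<open>
  Membership of a lattice combination of \<open>G\<close> in a prime filter is a truth function of the
  members of \<open>G\<close>, and there are finitely many truth functions.
\<close>

lemma lattice_closure_finite:
  assumes fin: "finite G" and G: "\<And>g. g \<in> G \<Longrightarrow> (\<exists>x. g = Var x) \<or> (\<exists>s t. g = To s t)"
  obtains R where "finite R" "R \<subseteq> lattice_closure G"
    "\<And>s. s \<in> lattice_closure G \<Longrightarrow> \<exists>t\<in>R. ipc_equiv s t"
proof -
  \<comment> \<open>The truth table of \<open>s\<close> over the atoms in \<open>G\<close>.\<close>
  define \<kappa> where "\<kappa> s = {S \<in> Pow G. truth S s}" for s
  have equiv: "ipc_equiv s t"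
    if st: "s \<in> lattice_closure G" "t \<in> lattice_closure G" "\<kappa> s = \<kappa> t" for s t
    unfolding ipc_equiv_def
  proof (intro allI impI)
    fix A :: "nat hstruct" and v :: "nat \<Rightarrow> nat" assume Av: "heyting_algebra A \<and> range v \<subseteq> carrier A"
    interpret heyting A using Av heytingI by blast
    have v: "range v \<subseteq> carrier A" using Av by blast
    have tr: "eval A v u \<in> F \<longleftrightarrow> truth {g \<in> G. eval A v g \<in> F} u"
      if F: "F \<in> prime_filters A" and u: "u \<in> lattice_closure G" for F u
      using u
    proof induction
      case (1 g)
      then show ?case using G[OF 1] by auto
    qed (use F eval_closed[OF v] in simp_all)
    show "eval A v s = eval A v t"
      unfolding eq_iff_prime[OF eval_closed[OF v] eval_closed[OF v]]
    proof
      fix F assume F: "F \<in> prime_filters A"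
      let ?S = "{g \<in> G. eval A v g \<in> F}"
      have "?S \<in> \<kappa> s \<longleftrightarrow> ?S \<in> \<kappa> t" using st by simp
      then show "eval A v s \<in> F \<longleftrightarrow> eval A v t \<in> F"
        using tr[OF F] st by (simp add: \<kappa>_def)
    qed
  qed
  define c where "c K = (SOME s. s \<in> lattice_closure G \<and> \<kappa> s = K)" for K
  have c: "c (\<kappa> s) \<in> lattice_closure G \<and> \<kappa> (c (\<kappa> s)) = \<kappa> s" if "s \<in> lattice_closure G" for s
    unfolding c_def by (rule someI[of _ s]) (use that in simp)
  show thesis
  proof
    have "\<kappa> ` lattice_closure G \<subseteq> Pow (Pow G)" by (auto simp: \<kappa>_def)
    then show "finite (c ` \<kappa> ` lattice_closure G)"
      using fin by (meson finite_Pow_iff finite_imageI finite_subset)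
    show "c ` \<kappa> ` lattice_closure G \<subseteq> lattice_closure G" using c by auto
    show "\<exists>t\<in>c ` \<kappa> ` lattice_closure G. ipc_equiv s t" if "s \<in> lattice_closure G" for s
      using equiv[OF that, of "c (\<kappa> s)"] c[OF that] that by auto
  qed
qed

lemma lattice_closure_formulas:
  assumes "G \<subseteq> ipc_formulas l n"
  shows "lattice_closure G \<subseteq> ipc_formulas l n"
proof
  fix t assume "t \<in> lattice_closure G"
  then show "t \<in> ipc_formulas l n" by induction (use assms in auto)
qed

lemma ipc_equiv_refl [simp]: "ipc_equiv t t"
  by (simp add: ipc_equiv_def)

lemma ipc_equiv_trans: "ipc_equiv s t \<Longrightarrow> ipc_equiv t u \<Longrightarrow> ipc_equiv s u"
  by (simp add: ipc_equiv_def)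

lemma ipc_equiv_cong:
  assumes "ipc_equiv s s'" "ipc_equiv t t'"
  shows "ipc_equiv (Or s t) (Or s' t')" "ipc_equiv (And s t) (And s' t')"
    "ipc_equiv (To s t) (To s' t')"
  using assms by (simp_all add: ipc_equiv_def)

text \<open>Up to equivalence, a formula of degree at most n + 1 is a lattice combination of
  variables and of implications between the finitely many representatives for degree n.\<close>

lemma finite_reps:
  "\<exists>R. finite R \<and> R \<subseteq> ipc_formulas l n \<and> (\<forall>s\<in>ipc_formulas l n. \<exists>t\<in>R. ipc_equiv s t)"
proof (induction n)
  case 0
  define G :: "nat ipc set" where "G = Var ` {..<l}"
  obtain R where R: "finite R" "R \<subseteq> lattice_closure G"
    "\<And>s. s \<in> lattice_closure G \<Longrightarrow> \<exists>t\<in>R. ipc_equiv s t"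
    by (rule lattice_closure_finite[of G]) (auto simp: G_def)
  have "s \<in> lattice_closure G" if "s \<in> ipc_formulas l 0" for s
    using that by (induction s) (auto simp: G_def intro: lattice_closure.intros)
  moreover have "lattice_closure G \<subseteq> ipc_formulas l 0"
    by (rule lattice_closure_formulas) (auto simp: G_def)
  ultimately show ?case using R by blast
next
  case (Suc n)
  then obtain Q where Q: "finite Q" "Q \<subseteq> ipc_formulas l n"
    "\<And>s. s \<in> ipc_formulas l n \<Longrightarrow> \<exists>t\<in>Q. ipc_equiv s t" by blast
  define G :: "nat ipc set" where "G = Var ` {..<l} \<union> (\<lambda>(s, t). To s t) ` (Q \<times> Q)"
  obtain R where R: "finite R" "R \<subseteq> lattice_closure G"
    "\<And>s. s \<in> lattice_closure G \<Longrightarrow> \<exists>t\<in>R. ipc_equiv s t"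
    by (rule lattice_closure_finite[of G]) (use Q in \<open>auto simp: G_def\<close>)
  have "\<exists>t\<in>lattice_closure G. ipc_equiv s t" if "s \<in> ipc_formulas l (Suc n)" for s
    using that
  proof (induction s)
    case (Var x)
    then show ?case by (intro bexI[of _ "Var x"] lattice_closure.intros(1)) (auto simp: G_def)
  next
    case Bot
    show ?case by (intro bexI[of _ Bot] lattice_closure.intros) auto
  next
    case Top
    show ?case by (intro bexI[of _ Top] lattice_closure.intros) auto
  next
    case (Or s1 s2)
    then obtain t1 t2 where "t1 \<in> lattice_closure G" "ipc_equiv s1 t1"
      "t2 \<in> lattice_closure G" "ipc_equiv s2 t2" by auto
    then show ?case by (intro bexI[of _ "Or t1 t2"] lattice_closure.intros(4) ipc_equiv_cong)
  next
    case (And s1 s2)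
    then obtain t1 t2 where "t1 \<in> lattice_closure G" "ipc_equiv s1 t1"
      "t2 \<in> lattice_closure G" "ipc_equiv s2 t2" by auto
    then show ?case by (intro bexI[of _ "And t1 t2"] lattice_closure.intros(5) ipc_equiv_cong)
  next
    case (To s1 s2)
    then obtain t1 t2 where "t1 \<in> Q" "ipc_equiv s1 t1" "t2 \<in> Q" "ipc_equiv s2 t2"
      using Q(3)[of s1] Q(3)[of s2] by auto
    then show ?case
      by (intro bexI[of _ "To t1 t2"] lattice_closure.intros(1) ipc_equiv_cong)
        (auto simp: G_def)
  qed
  moreover have "lattice_closure G \<subseteq> ipc_formulas l (Suc n)"
    by (rule lattice_closure_formulas) (use Q in \<open>auto simp: G_def\<close>)
  ultimately show ?case using R by (meson ipc_equiv_trans order_trans)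
qed

lemma ipc_reps:
  "set (ipc_reps l n) \<subseteq> ipc_formulas l n"
  "s \<in> ipc_formulas l n \<Longrightarrow> \<exists>t\<in>set (ipc_reps l n). ipc_equiv s t"
proof -
  have "\<exists>ts. set ts \<subseteq> ipc_formulas l n \<and> (\<forall>s\<in>ipc_formulas l n. \<exists>t\<in>set ts. ipc_equiv s t)"
    using finite_reps[of l n] by (metis finite_list)
  from someI_ex[OF this, folded ipc_reps_def]
  show "set (ipc_reps l n) \<subseteq> ipc_formulas l n"
    "s \<in> ipc_formulas l n \<Longrightarrow> \<exists>t\<in>set (ipc_reps l n). ipc_equiv s t" by blast+
qed

text \<open>Provides the finite sets on which filtration operates.\<close>

lemma finite_eval_formulas:
  assumes "heyting_algebra A" "range v \<subseteq> carrier A"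
  shows "finite (eval A v ` ipc_formulas l n)"
proof (rule finite_subset)
  show "eval A v ` ipc_formulas l n \<subseteq> eval A v ` set (ipc_reps l n)"
    using ipc_reps(2) ipc_equiv_any_type[OF _ assms] by blast
qed simp

definition big_and :: "nat ipc list \<Rightarrow> nat ipc" where
  "big_and ts = foldr And ts Top"

definition big_or :: "nat ipc list \<Rightarrow> nat ipc" where
  "big_or ts = foldr Or ts Bot"

lemma big_formulas:
  "big_and ts \<in> ipc_formulas l n \<longleftrightarrow> set ts \<subseteq> ipc_formulas l n"
  "big_or ts \<in> ipc_formulas l n \<longleftrightarrow> set ts \<subseteq> ipc_formulas l n"
  by (induction ts) (auto simp: big_and_def big_or_def)

lemma (in heyting) big_in_prime:
  assumes "F \<in> prime_filters A" "range v \<subseteq> carrier A"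
  shows "eval A v (big_and ts) \<in> F \<longleftrightarrow> (\<forall>t\<in>set ts. eval A v t \<in> F)"
    "eval A v (big_or ts) \<in> F \<longleftrightarrow> (\<exists>t\<in>set ts. eval A v t \<in> F)"
  using assms by (induction ts) (simp_all add: big_and_def big_or_def)

lemma (in heyting) eval_big_and_eq_one:
  assumes "range v \<subseteq> carrier A"
  shows "eval A v (big_and ts) = one A \<longleftrightarrow> (\<forall>t\<in>set ts. eval A v t = one A)"
  using assms by (simp add: eq_one_iff_prime big_in_prime) blast


section \<open>Types of prime filters\<close>

definition ptype :: "'a hstruct \<Rightarrow> (nat \<Rightarrow> 'a) \<Rightarrow> nat \<Rightarrow> nat \<Rightarrow> 'a set \<Rightarrow> nat ipc set" where
  "ptype A v l n F = {t \<in> ipc_formulas l n. eval A v t \<in> F}"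

text \<open>Equality of \<open>Th\<close> at degree \<open>n\<close>, extended to tuples of two
  different algebras; assignments take the place of lists, and only their values below
  \<open>l\<close> count.\<close>

definition sim :: "nat \<Rightarrow> nat \<Rightarrow> 'a hstruct \<Rightarrow> (nat \<Rightarrow> 'a) \<Rightarrow> 'b hstruct \<Rightarrow> (nat \<Rightarrow> 'b) \<Rightarrow> bool" where
  "sim l n A v B w \<longleftrightarrow>
     (\<forall>t\<in>ipc_formulas l n. eval A v t = one A \<longleftrightarrow> eval B w t = one B)"

text \<open>For a type \<open>T\<close>, a point refutes this formula exactly when some point above
  it has type \<open>T\<close>; looking upwards costs the extra degree.\<close>

definition char_fm :: "nat \<Rightarrow> nat \<Rightarrow> nat ipc set \<Rightarrow> nat ipc" where
  "char_fm l n T = To (big_and (filter (\<lambda>t. t \<in> T) (ipc_reps l n)))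
     (big_or (filter (\<lambda>t. t \<notin> T) (ipc_reps l n)))"

lemma char_fm_formulas: "char_fm l n T \<in> ipc_formulas l (Suc n)"
  using ipc_reps(1)[of l n] by (auto simp: char_fm_def big_formulas)

lemma sim_sym: "sim l n A v B w \<Longrightarrow> sim l n B w A v"
  by (simp add: sim_def)

lemma sim_mono: "sim l n A v B w \<Longrightarrow> l' \<le> l \<Longrightarrow> n' \<le> n \<Longrightarrow> sim l' n' A v B w"
  using ipc_formulas_mono unfolding sim_def by blast

lemma sim_reps:
  assumes A: "heyting_algebra A" "range v \<subseteq> carrier A" and B: "heyting_algebra B" "range w \<subseteq> carrier B"
    and "\<And>t. t \<in> set (ipc_reps l n) \<Longrightarrow> eval A v t = one A \<longleftrightarrow> eval B w t = one B"
  shows "sim l n A v B w"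
  unfolding sim_def
proof
  fix s assume "s \<in> ipc_formulas l n"
  then obtain t where t: "t \<in> set (ipc_reps l n)" "ipc_equiv s t" using ipc_reps(2) by blast
  then show "eval A v s = one A \<longleftrightarrow> eval B w s = one B"
    using ipc_equiv_any_type[OF t(2) A] ipc_equiv_any_type[OF t(2) B] assms(5) by simp
qed

lemma ptype_mono_eq:
  assumes "ptype A v l n F = ptype B w l n G" "m \<le> n"
  shows "ptype A v l m F = ptype B w l m G"
proof -
  have "ptype A v l m F = ptype A v l n F \<inter> ipc_formulas l m"
    "ptype B w l m G = ptype B w l n G \<inter> ipc_formulas l m"
    using ipc_formulas_mono[of l l m n] assms(2) by (auto simp: ptype_def)
  then show ?thesis using assms by simp
qed

text \<open>A refuting point above \<open>F\<close> contains every representative from the type and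
  none outside it; since each formula is equivalent to a representative, it has exactly that
  type.\<close>

lemma (in heyting) char_fm_in_prime:
  assumes B: "heyting_algebra B" "range w \<subseteq> carrier B"
    and F: "F \<in> prime_filters A" and v: "range v \<subseteq> carrier A"
  shows "eval A v (char_fm l n (ptype B w l n k)) \<in> F \<longleftrightarrow>
    \<not> (\<exists>G\<in>prime_filters A. F \<subseteq> G \<and> ptype A v l n G = ptype B w l n k)"
proof -
  let ?R = "set (ipc_reps l n)" and ?T = "ptype B w l n k"
  have eq: "(\<forall>t\<in>?R. t \<in> ?T \<longleftrightarrow> eval A v t \<in> G) \<longleftrightarrow> ptype A v l n G = ?T" for G
  proof
    assume *: "\<forall>t\<in>?R. t \<in> ?T \<longleftrightarrow> eval A v t \<in> G"
    have "s \<in> ptype A v l n G \<longleftrightarrow> s \<in> ?T" if s: "s \<in> ipc_formulas l n" for s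
    proof -
      obtain t where t: "t \<in> ?R" "ipc_equiv s t" using ipc_reps(2) s by blast
      then show ?thesis
        using ipc_equiv_any_type[OF t(2) heyting v] ipc_equiv_any_type[OF t(2) B] s * ipc_reps(1)[of l n]
        unfolding ptype_def by auto
    qed
    then show "ptype A v l n G = ?T" unfolding ptype_def by blast
  next
    assume "ptype A v l n G = ?T"
    then show "\<forall>t\<in>?R. t \<in> ?T \<longleftrightarrow> eval A v t \<in> G"
      using ipc_reps(1)[of l n] unfolding ptype_def by blast
  qed
  have "eval A v (char_fm l n ?T) \<in> F \<longleftrightarrow> (\<forall>G\<in>prime_filters A. F \<subseteq> G \<longrightarrow>
      (\<forall>t\<in>?R. t \<in> ?T \<longrightarrow> eval A v t \<in> G) \<longrightarrow> (\<exists>t\<in>?R. t \<notin> ?T \<and> eval A v t \<in> G))"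
    unfolding char_fm_def using F v
    by (simp add: imp_in_prime[OF F] big_in_prime cong: ball_cong) blast
  also have "\<dots> \<longleftrightarrow> \<not> (\<exists>G\<in>prime_filters A. F \<subseteq> G \<and> (\<forall>t\<in>?R. t \<in> ?T \<longleftrightarrow> eval A v t \<in> G))"
    by blast
  finally show ?thesis unfolding eq .
qed

text \<open>One round of the game between two spectra: that a point of a given type of degree n lies
  above is recorded, through \<open>char_fm\<close>, in the type of degree n + 1.\<close>

lemma back_and_forth:
  assumes A: "heyting_algebra A" "range v \<subseteq> carrier A" and B: "heyting_algebra B" "range w \<subseteq> carrier B"
    and m: "m \<in> prime_filters A" and k: "k \<in> prime_filters B" "k' \<in> prime_filters B" "k \<subseteq> k'"
    and eq: "ptype A v l (Suc n) m = ptype B w l (Suc n) k"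
  obtains m' where "m' \<in> prime_filters A" "m \<subseteq> m'" "ptype A v l n m' = ptype B w l n k'"
proof -
  let ?\<chi> = "char_fm l n (ptype B w l n k')"
  have "eval B w ?\<chi> \<notin> k"
    using heyting.char_fm_in_prime[OF heytingI[OF B(1)] B k(1) B(2), of l n k'] k by blast
  then have "eval A v ?\<chi> \<notin> m"
    using eq char_fm_formulas[of l n "ptype B w l n k'"] unfolding ptype_def by blast
  then show ?thesis
    using heyting.char_fm_in_prime[OF heytingI[OF A(1)] B m A(2), of l n k'] that by blast
qed

text \<open>The opening move of the game: validity of \<open>char_fm\<close> takes the place of its
  membership in a lower point.\<close>

lemma sim_prime_filter:
  assumes A: "heyting_algebra A" "range v \<subseteq> carrier A" and B: "heyting_algebra B" "range w \<subseteq> carrier B"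
    and k: "k \<in> prime_filters B" and s: "sim l (Suc n) A v B w"
  obtains m where "m \<in> prime_filters A" "ptype A v l n m = ptype B w l n k"
proof -
  interpret A: heyting A by (rule heytingI[OF A(1)])
  interpret B: heyting B by (rule heytingI[OF B(1)])
  let ?\<chi> = "char_fm l n (ptype B w l n k)"
  have "eval B w ?\<chi> \<notin> k" using B.char_fm_in_prime[OF B k B(2), of l n k] k by blast
  then have "eval B w ?\<chi> \<noteq> one B" using k by force
  then have "eval A v ?\<chi> \<noteq> one A" using s char_fm_formulas unfolding sim_def by blast
  then obtain m where "m \<in> prime_filters A" "eval A v ?\<chi> \<notin> m"
    using A.eq_one_iff_prime[OF A.eval_closed[OF A(2)]] by blast
  then show ?thesis using A.char_fm_in_prime[OF B _ A(2), of m l n k] that by blast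
qed


section \<open>Amalgamation\<close>

text \<open>Points of \<open>K\<close> pair a type \<open>T\<close> realised in \<open>B\<close>
  with a point \<open>m\<close> of \<open>A\<close> that matches it up to a degree depending on
  \<open>T\<close>. The second component makes \<open>K\<close> an extension of \<open>A\<close>;
  the first gives the truth values of formulas once the new element is the set of pairs whose type
  contains \<open>Var l\<close>.\<close>

theorem amalgamation:
  fixes A :: "'a hstruct" and B :: "'b hstruct"
  assumes A: "heyting_algebra A" "range v \<subseteq> carrier A" and B: "heyting_algebra B" "range w \<subseteq> carrier B"
    and b: "b \<in> carrier B"
    and s: "sim l (2 * card (set (ipc_reps (Suc l) d)) + 2) A v B w"
  obtains K :: "(nat ipc set \<times> 'a set) set hstruct" and e a
  where "heyting_algebra K" "embedding e A K" "a \<in> carrier K"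
    "sim (Suc l) d K ((e \<circ> v)(l := a)) B (w(l := b))"
proof -
  interpret A: heyting A by (rule heytingI[OF A(1)])
  interpret B: heyting B by (rule heytingI[OF B(1)])
  define R where "R = set (ipc_reps (Suc l) d)"
  define u where "u = w(l := b)"
  have u: "range u \<subseteq> carrier B" using B(2) b by (auto simp: u_def)
  have uw: "eval B u t = eval B w t" if "t \<in> ipc_formulas l n" for t n
    using that by (rule eval_cong_formulas) (simp add: u_def)
  define tp where "tp k = ptype B u (Suc l) d k" for k
  \<comment> \<open>The rank of a type: it drops at every strict growth, and 2 * \<delta> T + 1 is
    the degree of agreement reserved for the type \<open>T\<close>.\<close>
  define \<delta> where "\<delta> T = card (R - T)" for T
  have \<delta>_bound: "\<delta> T \<le> card R" for T by (auto simp: \<delta>_def R_def intro: card_mono)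
  have tp_mono: "tp k \<subseteq> tp k'" if "k \<subseteq> k'" for k k'
    using that by (auto simp: tp_def ptype_def)
  have \<delta>_less: "\<delta> (tp k') < \<delta> (tp k)" if kk: "tp k \<subset> tp k'" for k k'
  proof -
    obtain r where r: "r \<in> tp k'" "r \<notin> tp k" using kk by blast
    then have rf: "r \<in> ipc_formulas (Suc l) d" by (simp add: tp_def ptype_def)
    then obtain t where t: "t \<in> R" "ipc_equiv r t" using ipc_reps(2) unfolding R_def by blast
    have "eval B u r = eval B u t" by (rule ipc_equiv_any_type[OF t(2) B(1) u])
    moreover have "t \<in> ipc_formulas (Suc l) d" using t ipc_reps(1) unfolding R_def by blast
    ultimately have "t \<in> tp k'" "t \<notin> tp k" using r rf by (auto simp: tp_def ptype_def)
    then have "R - tp k' \<subset> R - tp k" using t kk by blast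
    then show ?thesis unfolding \<delta>_def by (rule psubset_card_mono[rotated]) (simp add: R_def)
  qed
  define related where "related n k m \<longleftrightarrow> ptype B w l n k = ptype A v l n m" for n k m
  have related_mono: "related n' k m" if "related n k m" "n' \<le> n" for n n' k m
    using that unfolding related_def by (rule ptype_mono_eq)
  \<comment> \<open>The first witness pair makes the projection to \<open>A\<close> a p-morphism, the second one makes the
    type the set of formulas forced at the point. A strict step up in the type frees two rounds
    of the game.\<close>
  define N where "N = {(T, m). m \<in> prime_filters A \<and> (\<exists>k1\<in>prime_filters B. \<exists>k\<in>prime_filters B.
    \<exists>m1\<in>prime_filters A. k1 \<subseteq> k \<and> m1 \<subseteq> m \<and> tp k1 = T \<and> tp k = T \<and>
    related (2 * \<delta> T + 1) k1 m1 \<and> related (2 * \<delta> T) k m)}"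
  define s where "s = (\<lambda>(T :: nat ipc set, m :: 'a set) (T', m'). T \<subseteq> T' \<and> m \<subseteq> m')"
  \<comment> \<open>The same pair serves twice, since agreement at the odd degree implies agreement
    at the even one.\<close>
  have NI: "(tp k, m) \<in> N"
    if "k \<in> prime_filters B" "m \<in> prime_filters A" "related (2 * \<delta> (tp k) + 1) k m" for k m
    using that related_mono[OF that(3), of "2 * \<delta> (tp k)"] unfolding N_def by auto
  let ?K = "upalg N s"
  have K: "heyting_algebra ?K"
    by (rule heyting_upalg) (auto simp: s_def)
  have f: "snd z \<in> prime_filters A" if "z \<in> N" for z using that by (auto simp: N_def)
  define e where "e = (\<lambda>a. {z \<in> N. a \<in> snd z})"
  have emb: "embedding e A ?K"
    unfolding e_def
  proof (rule A.embedding_upalg)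
    fix m assume m: "m \<in> prime_filters A"
    \<comment> \<open>The bound in the hypothesis is 2 * card R + 1, which covers the degree
      reserved at every rank, plus one for the opening move.\<close>
    have "sim l (Suc (2 * card R + 1)) B w A v" using s sim_sym unfolding R_def by fastforce
    from sim_prime_filter[OF B A m this] obtain k where
      k: "k \<in> prime_filters B" "ptype B w l (2 * card R + 1) k = ptype A v l (2 * card R + 1) m" .
    have "related (2 * \<delta> (tp k) + 1) k m"
      by (rule related_mono[of "2 * card R + 1"]) (use k \<delta>_bound[of "tp k"] in \<open>simp_all add: related_def\<close>)
    then have "(tp k, m) \<in> N" using k m NI by blast
    then show "\<exists>z\<in>N. snd z = m" by force
  next
    fix z m2 assume z: "z \<in> N" and m2: "m2 \<in> prime_filters A" "snd z \<subseteq> m2"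
    obtain T m where zT: "z = (T, m)" by fastforce
    obtain k1 k m1 where w: "k1 \<in> prime_filters B" "k \<in> prime_filters B" "m1 \<in> prime_filters A"
      "k1 \<subseteq> k" "m1 \<subseteq> m" "tp k1 = T" "tp k = T"
      "related (2 * \<delta> T + 1) k1 m1" "related (2 * \<delta> T) k m"
      using z unfolding zT N_def by blast
    have "ptype B w l (Suc (2 * \<delta> T)) k1 = ptype A v l (Suc (2 * \<delta> T)) m1"
      using w(8) by (simp add: related_def)
    \<comment> \<open>The answer is sought above \<open>k1\<close>, not above \<open>k\<close>: the
      pair of \<open>k1\<close> and \<open>m1\<close> has one more degree of agreement, and if the
      type does not change it remains the first witness for the new point.\<close>
    then obtain k2 where k2: "k2 \<in> prime_filters B" "k1 \<subseteq> k2" "related (2 * \<delta> T) k2 m2"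
      using back_and_forth[OF B A w(1,3) m2(1)] w(5) m2(2) zT unfolding related_def
      by (metis order_trans snd_conv)
    have sub: "T \<subseteq> tp k2" using tp_mono[OF k2(2)] w(6) by simp
    have "(tp k2, m2) \<in> N"
    proof (cases "tp k2 = T")
      case True
      have "m1 \<subseteq> m2" using w(5) m2(2) zT by auto
      then show ?thesis unfolding True N_def mem_Collect_eq prod.case
        by (intro conjI bexI[of _ k1] bexI[of _ k2] bexI[of _ m1] True w(1,3,6,8) k2 m2(1))
    next
      case False
      then have "\<delta> (tp k2) < \<delta> T" using \<delta>_less[of k1 k2] sub w(6) by blast
      then have "2 * \<delta> (tp k2) + 1 \<le> 2 * \<delta> T" by simp
      then show ?thesis using NI[OF k2(1) m2(1)] related_mono[OF k2(3)] by blast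
    qed
    then show "\<exists>y\<in>N. s z y \<and> snd y = m2"
      by (rule bexI[rotated]) (use sub m2(2) zT in \<open>simp add: s_def\<close>)
  qed (auto simp: s_def N_def)
  define Q where "Q = {z \<in> N. Var l \<in> fst z}"
  have Q: "Q \<in> carrier ?K" by (auto simp: Q_def s_def)
  define x where "x = (e \<circ> v)(l := Q)"
  \<comment> \<open>Truth lemma: a formula is forced at exactly those pairs whose type contains
    it.\<close>
  have truth: "eval ?K x t = {z \<in> N. t \<in> fst z}" if "t \<in> ipc_formulas (Suc l) d" for t
    using that
  proof (induction t)
    case (Var i)
    show ?case
    proof (cases "i = l")
      case True
      then show ?thesis by (simp add: x_def Q_def)
    next
      case False
      then have i: "i < l" using Var by simp
      have "v i \<in> m \<longleftrightarrow> Var i \<in> T" if z: "(T, m) \<in> N" for T m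
      proof -
        obtain k where k: "tp k = T" "related (2 * \<delta> T) k m" using z unfolding N_def by blast
        have "Var i \<in> T \<longleftrightarrow> Var i \<in> ptype B w l (2 * \<delta> T) k"
          using i k(1) by (auto simp: tp_def ptype_def u_def)
        also have "\<dots> \<longleftrightarrow> v i \<in> m" using i k(2) unfolding related_def by (simp add: ptype_def)
        finally show ?thesis by simp
      qed
      then show ?thesis using False by (auto simp: x_def e_def)
    qed
  next
    case (Or s1 s2)
    have "Or s1 s2 \<in> fst z \<longleftrightarrow> s1 \<in> fst z \<or> s2 \<in> fst z" if z: "z \<in> N" for z
    proof -
      obtain k where "k \<in> prime_filters B" "fst z = tp k" using z by (auto simp: N_def)
      then show ?thesis using Or.prems B.eval_closed[OF u] by (auto simp: tp_def ptype_def)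
    qed
    then show ?case using Or by auto
  next
    case (And s1 s2)
    have "And s1 s2 \<in> fst z \<longleftrightarrow> s1 \<in> fst z \<and> s2 \<in> fst z" if z: "z \<in> N" for z
    proof -
      obtain k where "k \<in> prime_filters B" "fst z = tp k" using z by (auto simp: N_def)
      then show ?thesis using And.prems B.eval_closed[OF u] by (auto simp: tp_def ptype_def)
    qed
    then show ?case using And by auto
  next
    case (To s1 s2)
    note fm = ipc_formulas_ToD[OF To.prems]
    have tpTo: "To s1 s2 \<in> tp k \<longleftrightarrow> (\<forall>G\<in>prime_filters B. k \<subseteq> G \<longrightarrow> s1 \<in> tp G \<longrightarrow> s2 \<in> tp G)"
      if "k \<in> prime_filters B" for k
      using B.imp_in_prime[OF that B.eval_closed[OF u] B.eval_closed[OF u], of s1 s2] fm To.prems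
      by (simp add: tp_def ptype_def)
    have "To s1 s2 \<in> fst z \<longleftrightarrow> (\<forall>y\<in>N. s z y \<longrightarrow> s1 \<in> fst y \<longrightarrow> s2 \<in> fst y)" if z: "z \<in> N" for z
    proof
      assume i: "To s1 s2 \<in> fst z"
      show "\<forall>y\<in>N. s z y \<longrightarrow> s1 \<in> fst y \<longrightarrow> s2 \<in> fst y"
      proof (intro ballI impI)
        fix y assume y: "y \<in> N" "s z y" "s1 \<in> fst y"
        obtain k where k: "k \<in> prime_filters B" "fst y = tp k" using y by (auto simp: N_def)
        have "To s1 s2 \<in> tp k" using i y k by (auto simp: s_def split: prod.splits)
        then show "s2 \<in> fst y" using tpTo k y by auto
      qed
    next
      assume *: "\<forall>y\<in>N. s z y \<longrightarrow> s1 \<in> fst y \<longrightarrow> s2 \<in> fst y"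
      show "To s1 s2 \<in> fst z"
      proof (rule ccontr)
        assume no: "To s1 s2 \<notin> fst z"
        obtain T m where zT: "z = (T, m)" by fastforce
        obtain k where k: "m \<in> prime_filters A" "k \<in> prime_filters B" "tp k = T" "related (2 * \<delta> T) k m"
          using z unfolding zT N_def by blast
        obtain k2 where k2: "k2 \<in> prime_filters B" "k \<subseteq> k2" "s1 \<in> tp k2" "s2 \<notin> tp k2"
          using tpTo[OF k(2)] no k(3) zT by auto
        have sub: "T \<subseteq> tp k2" using tp_mono[OF k2(2)] k(3) by simp
        show False
        proof (cases "tp k2 = T")
          case True
          have "s z z" by (simp add: s_def zT)
          then show False using * z True k2 zT by auto
        next
          case False
          then have less: "\<delta> (tp k2) < \<delta> T" using \<delta>_less[of k k2] sub k(3) by blast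
          \<comment> \<open>Strict growth forces \<delta> T > 0, so a degree can be spent, and 2 *
            \<delta> T - 1 still covers the degree reserved for the smaller rank.\<close>
          then obtain n where n: "2 * \<delta> T = Suc n" by (metis less_imp_Suc_add mult_Suc_right add_Suc numeral_2_eq_2)
          have "ptype A v l (Suc n) m = ptype B w l (Suc n) k"
            using k(4) n unfolding related_def by simp
          then obtain m2 where m2: "m2 \<in> prime_filters A" "m \<subseteq> m2" "ptype A v l n m2 = ptype B w l n k2"
            using back_and_forth[OF A B k(1,2) k2(1,2)] by metis
          have "related (2 * \<delta> (tp k2) + 1) k2 m2"
            by (rule related_mono[of n]) (use m2 n less in \<open>simp_all add: related_def\<close>)
          then have "(tp k2, m2) \<in> N" using NI k2 m2 by blast
          then show False using * k2 sub m2 zT by (auto simp: s_def)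
        qed
      qed
    qed
    then show ?case using To fm by auto
  next
    case Bot
    then show ?case by (auto simp: N_def tp_def ptype_def)
  next
    case Top
    then show ?case by (auto simp: N_def tp_def ptype_def)
  qed
  have "sim (Suc l) d ?K x B u"
    unfolding sim_def
  proof
    fix t assume t: "t \<in> ipc_formulas (Suc l) d"
    show "eval ?K x t = one ?K \<longleftrightarrow> eval B u t = one B"
    proof
      assume "eval B u t = one B"
      then have "t \<in> tp k" if "k \<in> prime_filters B" for k
        using t that by (simp add: tp_def ptype_def)
      then have "t \<in> fst z" if "z \<in> N" for z using that by (auto simp: N_def)
      then show "eval ?K x t = one ?K" using truth[OF t] by auto
    next
      assume 1: "eval ?K x t = one ?K"
      show "eval B u t = one B"
        unfolding B.eq_one_iff_prime[OF B.eval_closed[OF u]]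
      proof
        fix k assume k: "k \<in> prime_filters B"
        have "sim l (Suc (2 * card R + 1)) A v B w" using s unfolding R_def by fastforce
        from sim_prime_filter[OF A B k this] obtain m where
          m: "m \<in> prime_filters A" "ptype A v l (2 * card R + 1) m = ptype B w l (2 * card R + 1) k" .
        have "related (2 * \<delta> (tp k) + 1) k m"
          by (rule related_mono[of "2 * card R + 1"]) (use m \<delta>_bound[of "tp k"] in \<open>simp_all add: related_def\<close>)
        then have "(tp k, m) \<in> N" using k m NI by blast
        then have "(tp k, m) \<in> {z \<in> N. t \<in> fst z}"
          unfolding truth[OF t, symmetric] 1 by simp
        then have "t \<in> tp k" by simp
        then show "eval B u t \<in> k" by (simp add: tp_def ptype_def)
      qed
    qed
  qed
  then show ?thesis using that[OF K emb Q] unfolding x_def u_def by blast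
qed


section \<open>Existentially closed algebras\<close>

lemma sat_conjs [simp]: "sat A v (conjs ps) \<longleftrightarrow> (\<forall>p\<in>set ps. sat A v p)"
  by (induction ps) (simp_all add: conjs_def)

lemma quantifier_free_conjs [simp]: "quantifier_free (conjs ps) \<longleftrightarrow> (\<forall>p\<in>set ps. quantifier_free p)"
  by (induction ps) (simp_all add: conjs_def)

lemma existential_Ex: "quantifier_free p \<Longrightarrow> existential (Ex x p)"
  by (intro existential.intros)

lemma ex_closed_heyting: "ex_closed A \<Longrightarrow> heyting_algebra A"
  by (simp add: ex_closed_def)

text \<open>As the representatives are finite in number, having the same type as \<open>b\<close> is
  a single quantifier-free formula. It is satisfied in the amalgam, hence already in
  \<open>A\<close>.\<close>

lemma ex_closed_amalgamation:
  assumes A: "ex_closed A" "range v \<subseteq> carrier A" and B: "heyting_algebra B" "range w \<subseteq> carrier B"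
    and b: "b \<in> carrier B"
    and s: "sim l (2 * card (set (ipc_reps (Suc l) d)) + 2) A v B w"
  shows "\<exists>a\<in>carrier A. sim (Suc l) d A (v(l := a)) B (w(l := b))"
proof -
  have HA: "heyting_algebra A" by (rule ex_closed_heyting[OF A(1)])
  obtain K :: "(nat ipc set \<times> 'a set) set hstruct" and e q
    where K: "heyting_algebra K" "embedding e A K" "q \<in> carrier K"
      "sim (Suc l) d K ((e \<circ> v)(l := q)) B (w(l := b))"
    using amalgamation[OF HA A(2) B b s] .
  define \<psi> where "\<psi> t = (if eval B (w(l := b)) t = one B then Eq t Top else Neg (Eq t Top))" for t
  define ps where "ps = map \<psi> (ipc_reps (Suc l) d)"
  have "eval K ((e \<circ> v)(l := q)) t = one K \<longleftrightarrow> eval B (w(l := b)) t = one B"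
    if "t \<in> set (ipc_reps (Suc l) d)" for t
    using that K(4) ipc_reps(1) unfolding sim_def by blast
  then have "sat K ((e \<circ> v)(l := q)) (conjs ps)"
    by (auto simp: ps_def \<psi>_def)
  then have "sat K (e \<circ> v) (Ex l (conjs ps))"
    using K(3) by auto
  moreover have "existential (Ex l (conjs ps))"
    by (rule existential_Ex) (auto simp: ps_def \<psi>_def)
  ultimately have "sat A v (Ex l (conjs ps))"
    using ex_closed_any_type[OF A(1) K(1,2) _ A(2)] by blast
  then obtain a where a: "a \<in> carrier A" "sat A (v(l := a)) (conjs ps)" by auto
  have "sim (Suc l) d A (v(l := a)) B (w(l := b))"
  proof (rule sim_reps)
    show "eval A (v(l := a)) t = one A \<longleftrightarrow> eval B (w(l := b)) t = one B"
      if "t \<in> set (ipc_reps (Suc l) d)" for t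
    proof -
      have "sat A (v(l := a)) (\<psi> t)" using a(2) that by (simp add: ps_def)
      then show ?thesis by (simp add: \<psi>_def split: if_splits)
    qed
  qed (use HA A B a b in auto)
  then show ?thesis using a by blast
qed

text \<open>Dual reading of the strong order: the part of \<open>c\<close> outside \<open>a\<close>
  is cofinal in the complement of \<open>a\<close>.\<close>

lemma (in heyting) imp_eq_iff_prime:
  assumes "a \<in> carrier A" "c \<in> carrier A"
  shows "imp A c a = a \<longleftrightarrow>
    (\<forall>F\<in>prime_filters A. a \<notin> F \<longrightarrow> (\<exists>G\<in>prime_filters A. F \<subseteq> G \<and> c \<in> G \<and> a \<notin> G))"
  using assms unfolding eq_iff_prime[OF imp_closed[OF assms(2,1)] assms(1)]
  by (auto simp: imp_in_prime)

text \<open>Points of \<open>c\<close> outside \<open>a\<close> are doubled, with the copy labelled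
  True above the one labelled False; points of \<open>a\<close> carry only True, points outside
  \<open>c\<close> only False. The True copies form the required \<open>b\<close>.\<close>

theorem ex_closed_density:
  fixes A :: "'a hstruct"
  assumes A: "ex_closed A"
  shows "density A"
  unfolding density_def
proof (intro ballI impI, elim conjE)
  interpret heyting A by (rule heytingI[OF ex_closed_heyting[OF A]])
  fix a c assume ac: "a \<in> carrier A" "c \<in> carrier A" "strong_gt A c a" "a \<noteq> one A"
  have sep: "\<exists>G\<in>prime_filters A. F \<subseteq> G \<and> c \<in> G \<and> a \<notin> G" if "F \<in> prime_filters A" "a \<notin> F" for F
    using ac that unfolding strong_gt_def imp_eq_iff_prime[OF ac(1,2)] by blast
  have le: "c \<in> F" if "F \<in> prime_filters A" "a \<in> F" for F
    using ac that unfolding strong_gt_def le_iff_prime[OF ac(1,2)] by blast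
  define V where "V = {(F, i :: bool). F \<in> prime_filters A \<and> (a \<in> F \<longrightarrow> i) \<and> (c \<notin> F \<longrightarrow> \<not> i)}"
  define s where "s = (\<lambda>(F :: 'a set, i :: bool) (G, j). F \<subseteq> G \<and> (i \<longrightarrow> j))"
  let ?K = "upalg V s" and ?e = "\<lambda>x. {z \<in> V. x \<in> fst z}"
  have K: "heyting_algebra ?K" by (rule heyting_upalg) (auto simp: s_def)
  have e: "embedding ?e A ?K"
  proof (rule embedding_upalg)
    fix F assume F: "F \<in> prime_filters A"
    then have "(F, a \<in> F) \<in> V" using le by (auto simp: V_def)
    then show "\<exists>z\<in>V. fst z = F" by force
  next
    fix y F assume y: "y \<in> V" and F: "F \<in> prime_filters A" "fst y \<subseteq> F"
    then have "(F, snd y \<or> a \<in> F) \<in> V" using le by (auto simp: V_def)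
    then show "\<exists>z\<in>V. s y z \<and> fst z = F"
      by (rule bexI[rotated]) (use F in \<open>auto simp: s_def split: prod.splits\<close>)
  qed (auto simp: V_def s_def)
  define b where "b = {z \<in> V. snd z}"
  have bK: "b \<in> carrier ?K" by (auto simp: b_def s_def)
  \<comment> \<open>Cofinality yields a point \<open>G\<close> of \<open>c\<close> outside
    \<open>a\<close>, and such a point carries both labels.\<close>
  have up: "\<exists>G. fst z \<subseteq> G \<and> c \<in> G \<and> a \<notin> G \<and> (G, snd z) \<in> V \<and> (G, True) \<in> V"
    if z: "z \<in> V" "a \<notin> fst z" for z
  proof -
    have "fst z \<in> prime_filters A" using z(1) by (auto simp: V_def)
    from sep[OF this z(2)] obtain G where
      G: "G \<in> prime_filters A" "fst z \<subseteq> G" "c \<in> G" "a \<notin> G" by blast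
    then have "(G, snd z) \<in> V" "(G, True) \<in> V" by (simp_all add: V_def)
    then show ?thesis using G by blast
  qed
  have ex: "z \<in> imp ?K X Y \<longleftrightarrow> z \<in> Y"
    if "z \<in> V" "Y \<in> carrier ?K" "z \<notin> Y \<longrightarrow> (\<exists>y\<in>V. s z y \<and> y \<in> X \<and> y \<notin> Y)" for z X Y
    using that by auto
  have 1: "imp ?K (?e c) b = b"
  proof (rule set_eqI)
    fix z show "z \<in> imp ?K (?e c) b \<longleftrightarrow> z \<in> b"
    proof (cases "z \<in> V")
      case True
      show ?thesis
      proof (rule ex[OF True bK], rule impI)
        assume "z \<notin> b"
        then have "\<not> snd z" "a \<notin> fst z" using True by (auto simp: b_def V_def)
        then obtain G where "fst z \<subseteq> G" "c \<in> G" "(G, False) \<in> V" using up[OF True] by auto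
        then show "\<exists>y\<in>V. s z y \<and> y \<in> ?e c \<and> y \<notin> b"
          using \<open>\<not> snd z\<close> by (intro bexI[of _ "(G, False)"]) (auto simp: s_def b_def split: prod.splits)
      qed
    qed (auto simp: b_def)
  qed
  have 2: "imp ?K b (?e a) = ?e a"
  proof (rule set_eqI)
    fix z show "z \<in> imp ?K b (?e a) \<longleftrightarrow> z \<in> ?e a"
    proof (cases "z \<in> V")
      case True
      show ?thesis
      proof (rule ex[OF True])
        show "?e a \<in> carrier ?K" using e ac(1) unfolding embedding_def by blast
        show "z \<notin> ?e a \<longrightarrow> (\<exists>y\<in>V. s z y \<and> y \<in> b \<and> y \<notin> ?e a)"
        proof
          assume "z \<notin> ?e a"
          then obtain G where "fst z \<subseteq> G" "a \<notin> G" "(G, True) \<in> V" using up[OF True] True by auto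
          then show "\<exists>y\<in>V. s z y \<and> y \<in> b \<and> y \<notin> ?e a"
            by (intro bexI[of _ "(G, True)"]) (auto simp: s_def b_def split: prod.splits)
        qed
      qed
    qed auto
  qed
  have 3: "b \<inter> ?e c = b" "?e a \<inter> b = ?e a" by (auto simp: b_def V_def)
  obtain F where F: "F \<in> prime_filters A" "a \<notin> F" using ac eq_one_iff_prime by blast
  then obtain G where "G \<in> prime_filters A" "c \<in> G" "a \<notin> G" using sep by blast
  then have "(G, False) \<in> V" by (auto simp: V_def)
  moreover have "(G, False) \<notin> b" by (simp add: b_def)
  ultimately have 4: "b \<noteq> V" by blast
  let ?v = "\<lambda>i :: nat. if i = 0 then a else c"
  let ?p = "Ex 2 (Conj (Neg (Eq (Var 2) Top)) (Conj (strong_gt_fm (Var 1) (Var 2)) (strong_gt_fm (Var 2) (Var 0))))"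
  have "sat ?K (?e \<circ> ?v) ?p"
    unfolding sat.simps(7)
    by (rule bexI[OF _ bK])
      (use 1 2 3 4 in \<open>simp add: strong_gt_fm_def le_fm_def del: upalg_simps(6)\<close>)
  then have "sat A ?v ?p"
    by (rule ex_closed_any_type[OF A K e, rotated 2])
      (use ac in \<open>auto intro!: existential_Ex simp: strong_gt_fm_def le_fm_def\<close>)
  then show "\<exists>b\<in>carrier A. b \<noteq> one A \<and> strong_gt A c b \<and> strong_gt A b a"
    by (simp add: strong_gt_fm_def le_fm_def strong_gt_def le_def)
qed

text \<open>Points of both \<open>b1\<close> and \<open>b2\<close> outside \<open>a\<close> are
  doubled, with no arrows between the two kinds of copies, so that \<open>a1\<close> and
  \<open>a2\<close> become each other's pseudocomplement relative to \<open>a\<close>.\<close>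

theorem ex_closed_splitting:
  fixes A :: "'a hstruct"
  assumes A: "ex_closed A"
  shows "splitting A"
  unfolding splitting_def
proof (intro ballI impI, elim conjE)
  interpret heyting A by (rule heytingI[OF ex_closed_heyting[OF A]])
  fix a b1 b2 assume ab: "a \<in> carrier A" "b1 \<in> carrier A" "b2 \<in> carrier A"
    "strong_gt A (meet A b1 b2) a" "a \<noteq> one A"
  have sep: "\<exists>G\<in>prime_filters A. F \<subseteq> G \<and> b1 \<in> G \<and> b2 \<in> G \<and> a \<notin> G"
    if "F \<in> prime_filters A" "a \<notin> F" for F
  proof -
    have "\<exists>G\<in>prime_filters A. F \<subseteq> G \<and> meet A b1 b2 \<in> G \<and> a \<notin> G"
      using ab(4) that unfolding strong_gt_def imp_eq_iff_prime[OF ab(1) meet_closed[OF ab(2,3)]] by blast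
    then show ?thesis using ab by auto
  qed
  have le: "b1 \<in> F \<and> b2 \<in> F" if "F \<in> prime_filters A" "a \<in> F" for F
    using ab that unfolding strong_gt_def le_iff_prime[OF ab(1) meet_closed[OF ab(2,3)]] by auto
  \<comment> \<open>A copy labelled 1 belongs to the new element \<open>a1\<close> only, a copy labelled 2 to \<open>a2\<close> only,
    and a copy labelled 3 to both.\<close>
  define lab where "lab F i \<longleftrightarrow> (if a \<in> F then i = 3 else if b1 \<in> F \<and> b2 \<in> F then i = 1 \<or> i = 2
    else if b1 \<in> F then i = 1 else if b2 \<in> F then i = 2 else i = 0)" for F and i :: nat
  define V where "V = {(F, i). F \<in> prime_filters A \<and> lab F i}"
  \<comment> \<open>Label 0 marks the points outside \<open>b1\<close> and \<open>b2\<close>. An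
    arrow changes a label only from 0 or into 3, so above a point of \<open>a1\<close> whatever lies
    in \<open>a2\<close> lies in \<open>a\<close>, and conversely.\<close>
  define s where "s = (\<lambda>(F :: 'a set, i :: nat) (G, j). F \<subseteq> G \<and> (i = 0 \<or> j = 3 \<or> i = j))"
  let ?K = "upalg V s" and ?e = "\<lambda>x. {z \<in> V. x \<in> fst z}"
  have K: "heyting_algebra ?K" by (rule heyting_upalg) (auto simp: s_def)
  have e: "embedding ?e A ?K"
  proof (rule embedding_upalg)
    fix F assume F: "F \<in> prime_filters A"
    have "\<exists>i. lab F i" unfolding lab_def by auto
    then show "\<exists>z\<in>V. fst z = F" using F by (force simp: V_def)
  next
    fix y F assume y: "y \<in> V" and F: "F \<in> prime_filters A" "fst y \<subseteq> F"
    \<comment> \<open>Back condition: outside \<open>a\<close> a non-zero label can be kept, because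
      \<open>b1\<close> and \<open>b2\<close> are up-sets.\<close>
    have "\<exists>j. lab F j \<and> (snd y = 0 \<or> j = 3 \<or> snd y = j)"
    proof (cases "a \<in> F \<or> snd y = 0")
      case True
      then show ?thesis unfolding lab_def by auto
    next
      case False
      have "lab (fst y) (snd y)" "a \<notin> fst y" using y F False by (auto simp: V_def)
      moreover have "b1 \<in> F" if "b1 \<in> fst y" using that F by blast
      moreover have "b2 \<in> F" if "b2 \<in> fst y" using that F by blast
      ultimately have "lab F (snd y)" using False unfolding lab_def by (simp split: if_splits)
      then show ?thesis by blast
    qed
    then obtain j where j: "lab F j" "snd y = 0 \<or> j = 3 \<or> snd y = j" by blast
    then have "(F, j) \<in> V" using F by (simp add: V_def)
    then show "\<exists>z\<in>V. s y z \<and> fst z = F"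
      by (rule bexI[rotated]) (use F j in \<open>auto simp: s_def split: prod.splits\<close>)
  qed (auto simp: V_def s_def)
  define a1 where "a1 = {z \<in> V. snd z = 1 \<or> snd z = 3}"
  define a2 where "a2 = {z \<in> V. snd z = 2 \<or> snd z = 3}"
  have aK: "a1 \<in> carrier ?K" "a2 \<in> carrier ?K" by (auto simp: a1_def a2_def s_def)
  have up: "\<exists>G. (G, 1) \<in> V \<and> (G, 2) \<in> V \<and> fst z \<subseteq> G \<and> a \<notin> G" if "z \<in> V" "snd z \<noteq> 3" for z
  proof -
    have "fst z \<in> prime_filters A" "a \<notin> fst z" using that by (auto simp: V_def lab_def)
    from sep[OF this] obtain G where
      G: "G \<in> prime_filters A" "fst z \<subseteq> G" "b1 \<in> G" "b2 \<in> G" "a \<notin> G" by blast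
    then have "(G, 1) \<in> V" "(G, 2) \<in> V" by (simp_all add: V_def lab_def)
    then show ?thesis using G by blast
  qed
  have ea: "z \<in> ?e a \<longleftrightarrow> z \<in> V \<and> snd z = 3" for z by (auto simp: V_def lab_def split: if_splits)
  have lab: "snd z = 0 \<or> snd z = 1 \<or> snd z = 2 \<or> snd z = 3" if "z \<in> V" for z
  proof -
    have "lab (fst z) (snd z)" using that unfolding V_def by (simp add: case_prod_beta)
    then show ?thesis
      unfolding lab_def by (cases "a \<in> fst z"; cases "b1 \<in> fst z"; cases "b2 \<in> fst z")
        (simp_all, blast)
  qed
  have sD: "snd z = 0 \<or> snd y = 3 \<or> snd z = snd y" if "s z y" for z y
    using that unfolding s_def by (simp add: case_prod_beta)
  have 1: "imp ?K a2 (?e a) = a1"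
  proof (rule set_eqI)
    fix z show "z \<in> imp ?K a2 (?e a) \<longleftrightarrow> z \<in> a1"
    proof
      assume "z \<in> imp ?K a2 (?e a)"
      then have z: "z \<in> V" "\<And>y. y \<in> V \<Longrightarrow> s z y \<Longrightarrow> y \<in> a2 \<Longrightarrow> y \<in> ?e a" by simp_all
      show "z \<in> a1"
      proof (rule ccontr)
        assume no: "z \<notin> a1"
        then have z': "snd z = 0 \<or> snd z = 2" using z(1) lab[OF z(1)] unfolding a1_def by blast
        then obtain G where G: "(G, 2) \<in> V" "fst z \<subseteq> G" "a \<notin> G" using up[OF z(1)] by auto
        moreover have "s z (G, 2)" using z' G by (auto simp: s_def split: prod.splits)
        moreover have "(G, 2) \<in> a2" using G by (simp add: a2_def)
        ultimately show False using z(2)[of "(G, 2)"] by simp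
      qed
    next
      assume z: "z \<in> a1"
      have "y \<in> ?e a" if y: "y \<in> V" "s z y" "y \<in> a2" for y
        unfolding ea using sD[OF y(2)] y z by (auto simp: a1_def a2_def)
      moreover have "z \<in> V" using z by (simp add: a1_def)
      ultimately show "z \<in> imp ?K a2 (?e a)" by simp
    qed
  qed
  have 2: "imp ?K a1 (?e a) = a2"
  proof (rule set_eqI)
    fix z show "z \<in> imp ?K a1 (?e a) \<longleftrightarrow> z \<in> a2"
    proof
      assume "z \<in> imp ?K a1 (?e a)"
      then have z: "z \<in> V" "\<And>y. y \<in> V \<Longrightarrow> s z y \<Longrightarrow> y \<in> a1 \<Longrightarrow> y \<in> ?e a" by simp_all
      show "z \<in> a2"
      proof (rule ccontr)
        assume no: "z \<notin> a2"
        then have z': "snd z = 0 \<or> snd z = 1" using z(1) lab[OF z(1)] unfolding a2_def by blast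
        then obtain G where G: "(G, 1) \<in> V" "fst z \<subseteq> G" "a \<notin> G" using up[OF z(1)] by auto
        moreover have "s z (G, 1)" using z' G by (auto simp: s_def split: prod.splits)
        moreover have "(G, 1) \<in> a1" using G by (simp add: a1_def)
        ultimately show False using z(2)[of "(G, 1)"] by simp
      qed
    next
      assume z: "z \<in> a2"
      have "y \<in> ?e a" if y: "y \<in> V" "s z y" "y \<in> a1" for y
        unfolding ea using sD[OF y(2)] y z by (auto simp: a2_def a1_def)
      moreover have "z \<in> V" using z by (simp add: a2_def)
      ultimately show "z \<in> imp ?K a1 (?e a)" by simp
    qed
  qed
  have lb: "(snd z = 1 \<or> snd z = 3 \<longrightarrow> b1 \<in> fst z) \<and> (snd z = 2 \<or> snd z = 3 \<longrightarrow> b2 \<in> fst z) \<and>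
      (b1 \<in> fst z \<or> b2 \<in> fst z \<longrightarrow> snd z \<noteq> 0)" if "z \<in> V" for z
  proof -
    have l: "lab (fst z) (snd z)" and p: "fst z \<in> prime_filters A"
      using that unfolding V_def by (simp_all add: case_prod_beta)
    have "a \<in> fst z \<longrightarrow> b1 \<in> fst z \<and> b2 \<in> fst z" using le[OF p] by blast
    with l show ?thesis
      unfolding lab_def by (cases "a \<in> fst z"; cases "b1 \<in> fst z"; cases "b2 \<in> fst z") auto
  qed
  have 3: "a1 \<inter> ?e b1 = a1" "a2 \<inter> ?e b2 = a2" "a1 \<union> a2 = ?e b1 \<union> ?e b2"
    using lb lab unfolding a1_def a2_def by blast+
  obtain F where F: "F \<in> prime_filters A" "a \<notin> F" using ab eq_one_iff_prime by blast
  then obtain G where "G \<in> prime_filters A" "b1 \<in> G" "b2 \<in> G" "a \<notin> G" using sep by blast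
  then have "(G, 1) \<in> V" "(G, 2) \<in> V" by (auto simp: V_def lab_def)
  moreover have "(G, 1) \<notin> a2" "(G, 2) \<notin> a1" by (simp_all add: a1_def a2_def)
  ultimately have 4: "a1 \<noteq> V" "a2 \<noteq> V" by blast+
  let ?v = "\<lambda>i :: nat. if i = 0 then a else if i = 1 then b1 else b2"
  let ?q = "conjs [Neg (Eq (Var 3) Top), Neg (Eq (Var 4) Top), Eq (To (Var 4) (Var 0)) (Var 3),
    le_fm (Var 3) (Var 1), Eq (To (Var 3) (Var 0)) (Var 4), le_fm (Var 4) (Var 2),
    Eq (Or (Var 3) (Var 4)) (Or (Var 1) (Var 2))]"
  let ?p = "Ex 3 (Ex 4 ?q)"
  have "sat ?K (?e \<circ> ?v) ?p"
    unfolding sat.simps(7)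
    by (rule bexI[OF bexI[OF _ aK(2)] aK(1)])
      (use 1 2 3 4 in \<open>simp add: le_fm_def del: upalg_simps(6)\<close>)
  then have "sat A ?v ?p"
    by (rule ex_closed_any_type[OF A K e, rotated 2])
      (use ab in \<open>auto intro!: existential.intros simp: le_fm_def\<close>)
  then show "\<exists>a1\<in>carrier A. \<exists>a2\<in>carrier A. a1 \<noteq> one A \<and> a2 \<noteq> one A \<and> imp A a2 a = a1 \<and>
      le A a1 b1 \<and> imp A a1 a = a2 \<and> le A a2 b2 \<and> join A a1 a2 = join A b1 b2"
    by (simp add: le_fm_def le_def)
qed


section \<open>Finite algebras inside algebras with Density and Splitting\<close>

context heyting
begin

lemma not_in_prime:
  assumes "F \<in> prime_filters A" "u \<in> carrier A"
  shows "imp A u (zero A) \<in> F \<longleftrightarrow> (\<forall>G\<in>prime_filters A. F \<subseteq> G \<longrightarrow> u \<notin> G)"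
  using imp_in_prime[OF assms zero_closed] zero_notin_prime by blast

text \<open>Density and Splitting are applied only to \<open>a = \<not> u\<close> and \<open>c = b1 = b2 = u \<or> \<not> u\<close>.\<close>

lemma strong_gt_em:
  assumes u: "u \<in> carrier A"
  shows "strong_gt A (join A u (imp A u (zero A))) (imp A u (zero A))"
proof -
  let ?n = "imp A u (zero A)"
  have n: "?n \<in> carrier A" using u by simp
  have "\<exists>G\<in>prime_filters A. F \<subseteq> G \<and> join A u ?n \<in> G \<and> ?n \<notin> G"
    if F: "F \<in> prime_filters A" "?n \<notin> F" for F
  proof -
    obtain G where G: "G \<in> prime_filters A" "F \<subseteq> G" "u \<in> G" using F not_in_prime[OF F(1) u] by blast
    moreover have "?n \<notin> G" using G not_in_prime[OF G(1) u] by blast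
    ultimately show ?thesis using join_in_prime[OF G(1) u n] by blast
  qed
  then have "imp A (join A u ?n) ?n = ?n"
    using imp_eq_iff_prime[OF n join_closed[OF u n]] by blast
  then show ?thesis using join_ge2[OF u n] by (simp add: strong_gt_def)
qed

lemma not_neq_one:
  assumes "u \<in> carrier A" "u \<noteq> zero A"
  shows "imp A u (zero A) \<noteq> one A"
proof -
  obtain F where "F \<in> prime_filters A" "u \<in> F" using assms eq_zero_iff_prime by blast
  then have "imp A u (zero A) \<notin> F" using not_in_prime assms by blast
  then show ?thesis using one_in_prime \<open>F \<in> prime_filters A\<close> by metis
qed

section \<open>Cutting and splitting a clopen set\<close>

text \<open>\<open>b\<close> is cofinal in \<open>u\<close>, while u minus \<open>b\<close> is
  nonempty and visible from every point outside \<open>u\<close> that sees \<open>u\<close>. In the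
  unfolding of a poset, u minus \<open>b\<close> goes to a root and \<open>b\<close> to what lies
  strictly above it.\<close>

lemma density_below:
  assumes D: "density A" and u: "u \<in> carrier A" "u \<noteq> zero A"
  obtains b where "b \<in> carrier A"
    "\<And>F. F \<in> prime_filters A \<Longrightarrow> b \<in> F \<Longrightarrow> u \<in> F"
    "\<exists>F\<in>prime_filters A. u \<in> F \<and> b \<notin> F"
    "\<And>F. F \<in> prime_filters A \<Longrightarrow> u \<in> F \<Longrightarrow> \<exists>G\<in>prime_filters A. F \<subseteq> G \<and> b \<in> G"
    "\<And>F. F \<in> prime_filters A \<Longrightarrow> u \<notin> F \<Longrightarrow> \<exists>G\<in>prime_filters A. F \<subseteq> G \<and> u \<in> G \<Longrightarrow>
       \<exists>G\<in>prime_filters A. F \<subseteq> G \<and> u \<in> G \<and> b \<notin> G"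
proof -
  define n where "n = imp A u (zero A)"
  define c where "c = join A u n"
  have nc: "n \<in> carrier A" "c \<in> carrier A" using u by (simp_all add: n_def c_def)
  have nF: "n \<in> F \<longleftrightarrow> (\<forall>G\<in>prime_filters A. F \<subseteq> G \<longrightarrow> u \<notin> G)" if "F \<in> prime_filters A" for F
    unfolding n_def by (rule not_in_prime[OF that u(1)])
  have cF: "c \<in> F \<longleftrightarrow> u \<in> F \<or> n \<in> F" if "F \<in> prime_filters A" for F
    unfolding c_def by (rule join_in_prime[OF that u(1) nc(1)])
  have "strong_gt A c n \<and> n \<noteq> one A"
    unfolding c_def n_def using strong_gt_em[OF u(1)] not_neq_one[OF u] by blast
  then obtain b where b: "b \<in> carrier A" "b \<noteq> one A" "strong_gt A c b" "strong_gt A b n"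
    using D nc unfolding density_def by blast
  have bc: "\<exists>G\<in>prime_filters A. F \<subseteq> G \<and> c \<in> G \<and> b \<notin> G" if "F \<in> prime_filters A" "b \<notin> F" for F
    using b(3) that imp_eq_iff_prime[OF b(1) nc(2)] unfolding strong_gt_def by blast
  have nb: "\<exists>G\<in>prime_filters A. F \<subseteq> G \<and> b \<in> G \<and> n \<notin> G" if "F \<in> prime_filters A" "n \<notin> F" for F
    using b(4) that imp_eq_iff_prime[OF nc(1) b(1)] unfolding strong_gt_def by blast
  have leb: "b \<in> F \<Longrightarrow> c \<in> F" "n \<in> F \<Longrightarrow> b \<in> F" if "F \<in> prime_filters A" for F
    using b(3,4) that le_iff_prime[OF b(1) nc(2)] le_iff_prime[OF nc(1) b(1)]
    unfolding strong_gt_def by blast+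
  have m: "meet A b u \<in> F \<longleftrightarrow> b \<in> F \<and> u \<in> F" if "F \<in> prime_filters A" for F
    using that b(1) u(1) by simp
  show ?thesis
  proof
    \<comment> \<open>The element given by Density lies above the negation of \<open>u\<close>; only
      its part inside \<open>u\<close> is wanted.\<close>
    show "meet A b u \<in> carrier A" using b(1) u(1) by simp
    show "u \<in> F" if "F \<in> prime_filters A" "meet A b u \<in> F" for F using that m by blast
    obtain F where F: "F \<in> prime_filters A" "b \<notin> F" using b(2) eq_one_iff_prime[OF b(1)] by blast
    then obtain G where G: "G \<in> prime_filters A" "c \<in> G" "b \<notin> G" using bc[OF F] by blast
    then show "\<exists>F\<in>prime_filters A. u \<in> F \<and> meet A b u \<notin> F"
      using m[OF G(1)] cF[OF G(1)] leb[OF G(1)] by blast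
    show "\<exists>G\<in>prime_filters A. F \<subseteq> G \<and> meet A b u \<in> G" if F: "F \<in> prime_filters A" "u \<in> F" for F
    proof -
      have "n \<notin> F" using nF[OF F(1)] F by blast
      then obtain G where G: "G \<in> prime_filters A" "F \<subseteq> G" "b \<in> G" using nb[OF F(1)] by blast
      then show ?thesis using m[OF G(1)] F(2) by blast
    qed
    show "\<exists>G\<in>prime_filters A. F \<subseteq> G \<and> u \<in> G \<and> meet A b u \<notin> G"
      if F: "F \<in> prime_filters A" "u \<notin> F" "\<exists>G\<in>prime_filters A. F \<subseteq> G \<and> u \<in> G" for F
    proof -
      have "n \<notin> F" using nF[OF F(1)] F by blast
      then have "b \<notin> F" using leb(1)[OF F(1)] cF[OF F(1)] F(2) by blast
      then obtain G where G: "G \<in> prime_filters A" "F \<subseteq> G" "c \<in> G" "b \<notin> G"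
        using bc[OF F(1)] by blast
      then show ?thesis using cF[OF G(1)] leb(2)[OF G(1)] m[OF G(1)] by blast
    qed
  qed
qed

text \<open>Splitting at the negation of \<open>u\<close> yields \<open>a1\<close> and
  \<open>a2\<close> whose meet lies below that negation, so their parts inside \<open>u\<close> are
  disjoint. A point outside one of the two sees the part of the other inside
  \<open>u\<close>.\<close>

lemma splitting_below:
  assumes S: "splitting A" and u: "u \<in> carrier A" "u \<noteq> zero A"
  obtains u1 u2 where "u1 \<in> carrier A" "u2 \<in> carrier A" "u1 \<noteq> zero A" "u2 \<noteq> zero A"
    "\<And>F. F \<in> prime_filters A \<Longrightarrow> u \<in> F \<longleftrightarrow> u1 \<in> F \<or> u2 \<in> F"
    "\<And>F. F \<in> prime_filters A \<Longrightarrow> \<not> (u1 \<in> F \<and> u2 \<in> F)"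
    "\<And>F. F \<in> prime_filters A \<Longrightarrow> u \<notin> F \<Longrightarrow> \<exists>G\<in>prime_filters A. F \<subseteq> G \<and> u \<in> G \<Longrightarrow>
       (\<exists>G\<in>prime_filters A. F \<subseteq> G \<and> u1 \<in> G) \<and> (\<exists>G\<in>prime_filters A. F \<subseteq> G \<and> u2 \<in> G)"
proof -
  define n where "n = imp A u (zero A)"
  define c where "c = join A u n"
  have nc: "n \<in> carrier A" "c \<in> carrier A" using u by (simp_all add: n_def c_def)
  have nF: "n \<in> F \<longleftrightarrow> (\<forall>G\<in>prime_filters A. F \<subseteq> G \<longrightarrow> u \<notin> G)" if "F \<in> prime_filters A" for F
    unfolding n_def by (rule not_in_prime[OF that u(1)])
  have cF: "c \<in> F \<longleftrightarrow> u \<in> F \<or> n \<in> F" if "F \<in> prime_filters A" for F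
    unfolding c_def by (rule join_in_prime[OF that u(1) nc(1)])
  have "meet A c c = c" using le_refl[OF nc(2)] by (simp add: le_def)
  moreover have "strong_gt A c n \<and> n \<noteq> one A"
    unfolding c_def n_def using strong_gt_em[OF u(1)] not_neq_one[OF u] by blast
  ultimately obtain a1 a2 where a: "a1 \<in> carrier A" "a2 \<in> carrier A" "a1 \<noteq> one A" "a2 \<noteq> one A"
    "imp A a2 n = a1" "le A a1 c" "imp A a1 n = a2" "le A a2 c" "join A a1 a2 = join A c c"
    using S nc unfolding splitting_def by metis
  have a1F: "a1 \<in> F \<longleftrightarrow> (\<forall>G\<in>prime_filters A. F \<subseteq> G \<longrightarrow> a2 \<in> G \<longrightarrow> n \<in> G)"
    and a2F: "a2 \<in> F \<longleftrightarrow> (\<forall>G\<in>prime_filters A. F \<subseteq> G \<longrightarrow> a1 \<in> G \<longrightarrow> n \<in> G)"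
    if "F \<in> prime_filters A" for F
    using imp_in_prime[OF that a(2) nc(1)] imp_in_prime[OF that a(1) nc(1)] unfolding a(5,7) by blast+
  have ac: "a1 \<in> F \<Longrightarrow> c \<in> F" "a2 \<in> F \<Longrightarrow> c \<in> F" if "F \<in> prime_filters A" for F
    using a(6,8) that le_iff_prime[OF a(1) nc(2)] le_iff_prime[OF a(2) nc(2)] by blast+
  have aa: "c \<in> F \<Longrightarrow> a1 \<in> F \<or> a2 \<in> F" if "F \<in> prime_filters A" for F
    using join_in_prime[OF that a(1,2)] join_in_prime[OF that nc(2,2)] unfolding a(9) by blast
  have m: "meet A a1 u \<in> F \<longleftrightarrow> a1 \<in> F \<and> u \<in> F" "meet A a2 u \<in> F \<longleftrightarrow> a2 \<in> F \<and> u \<in> F"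
    if "F \<in> prime_filters A" for F
    using that a(1,2) u(1) by simp_all
  have s1: "\<exists>G\<in>prime_filters A. F \<subseteq> G \<and> meet A a2 u \<in> G" if F: "F \<in> prime_filters A" "a1 \<notin> F" for F
  proof -
    obtain G where G: "G \<in> prime_filters A" "F \<subseteq> G" "a2 \<in> G" "n \<notin> G" using F(2) a1F[OF F(1)] by blast
    then have "u \<in> G" using ac(2)[OF G(1)] cF[OF G(1)] by blast
    then show ?thesis using G m(2)[OF G(1)] by blast
  qed
  have s2: "\<exists>G\<in>prime_filters A. F \<subseteq> G \<and> meet A a1 u \<in> G" if F: "F \<in> prime_filters A" "a2 \<notin> F" for F
  proof -
    obtain G where G: "G \<in> prime_filters A" "F \<subseteq> G" "a1 \<in> G" "n \<notin> G" using F(2) a2F[OF F(1)] by blast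
    then have "u \<in> G" using ac(1)[OF G(1)] cF[OF G(1)] by blast
    then show ?thesis using G m(1)[OF G(1)] by blast
  qed
  show ?thesis
  proof
    show c1: "meet A a1 u \<in> carrier A" and c2: "meet A a2 u \<in> carrier A" using a(1,2) u(1) by simp_all
    obtain F where F: "F \<in> prime_filters A" "a2 \<notin> F" using a(4) eq_one_iff_prime[OF a(2)] by blast
    show "meet A a1 u \<noteq> zero A" using s2[OF F] eq_zero_iff_prime[OF c1] by blast
    obtain F where F: "F \<in> prime_filters A" "a1 \<notin> F" using a(3) eq_one_iff_prime[OF a(1)] by blast
    show "meet A a2 u \<noteq> zero A" using s1[OF F] eq_zero_iff_prime[OF c2] by blast
    show "u \<in> F \<longleftrightarrow> meet A a1 u \<in> F \<or> meet A a2 u \<in> F" if F: "F \<in> prime_filters A" for F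
      using m[OF F] aa[OF F] cF[OF F] by blast
    show "\<not> (meet A a1 u \<in> F \<and> meet A a2 u \<in> F)" if F: "F \<in> prime_filters A" for F
    proof
      assume "meet A a1 u \<in> F \<and> meet A a2 u \<in> F"
      then have "n \<in> F" "u \<in> F" using m[OF F] a1F[OF F] F by blast+
      then show False using nF[OF F] F by blast
    qed
    show "(\<exists>G\<in>prime_filters A. F \<subseteq> G \<and> meet A a1 u \<in> G) \<and> (\<exists>G\<in>prime_filters A. F \<subseteq> G \<and> meet A a2 u \<in> G)"
      if F: "F \<in> prime_filters A" "u \<notin> F" "\<exists>G\<in>prime_filters A. F \<subseteq> G \<and> u \<in> G" for F
    proof -
      have "n \<notin> F" using nF[OF F(1)] F by blast
      then have "a1 \<notin> F" "a2 \<notin> F" using ac[OF F(1)] cF[OF F(1)] F(2) by blast+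
      then show ?thesis using s1[OF F(1)] s2[OF F(1)] by blast
    qed
  qed
qed

text \<open>The pieces are disjoint up-sets, so no order relation crosses between them and maps on
  the pieces can be glued. The last clause keeps every piece visible from below
  \<open>u\<close>.\<close>

definition partitions :: "'a \<Rightarrow> 'i set \<Rightarrow> ('i \<Rightarrow> 'a) \<Rightarrow> bool" where
  "partitions u S g \<longleftrightarrow> (\<forall>y\<in>S. g y \<in> carrier A \<and> g y \<noteq> zero A) \<and>
     (\<forall>F\<in>prime_filters A. u \<in> F \<longleftrightarrow> (\<exists>y\<in>S. g y \<in> F)) \<and>
     (\<forall>F\<in>prime_filters A. \<forall>y\<in>S. \<forall>z\<in>S. g y \<in> F \<longrightarrow> g z \<in> F \<longrightarrow> y = z) \<and>
     (\<forall>F\<in>prime_filters A. u \<notin> F \<longrightarrow> (\<exists>G\<in>prime_filters A. F \<subseteq> G \<and> u \<in> G) \<longrightarrow>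
       (\<forall>y\<in>S. \<exists>G\<in>prime_filters A. F \<subseteq> G \<and> g y \<in> G))"

lemma partitionsD:
  assumes "partitions u S g"
  shows "\<forall>y\<in>S. g y \<in> carrier A \<and> g y \<noteq> zero A"
    "\<forall>F\<in>prime_filters A. u \<in> F \<longleftrightarrow> (\<exists>y\<in>S. g y \<in> F)"
    "\<forall>F\<in>prime_filters A. \<forall>y\<in>S. \<forall>z\<in>S. g y \<in> F \<longrightarrow> g z \<in> F \<longrightarrow> y = z"
    "\<forall>F\<in>prime_filters A. u \<notin> F \<longrightarrow> (\<exists>G\<in>prime_filters A. F \<subseteq> G \<and> u \<in> G) \<longrightarrow>
       (\<forall>y\<in>S. \<exists>G\<in>prime_filters A. F \<subseteq> G \<and> g y \<in> G)"
  using assms unfolding partitions_def by - (elim conjE, assumption)+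

text \<open>One half goes to the new index and the other is divided by induction; a point that sees
  \<open>u\<close> from outside sees both halves, which preserves the last clause of
  \<open>partitions\<close>.\<close>

lemma splitting_family:
  assumes S: "splitting A" and I: "finite I" "I \<noteq> {}" and u: "u \<in> carrier A" "u \<noteq> zero A"
  shows "\<exists>g. partitions u I g"
  using I u
proof (induction I arbitrary: u rule: finite_ne_induct)
  case (singleton x)
  then show ?case by (intro exI[of _ "\<lambda>_. u"]) (simp add: partitions_def)
next
  case (insert x I)
  obtain u1 u2 where u12: "u1 \<in> carrier A" "u2 \<in> carrier A" "u1 \<noteq> zero A" "u2 \<noteq> zero A"
    "\<And>F. F \<in> prime_filters A \<Longrightarrow> u \<in> F \<longleftrightarrow> u1 \<in> F \<or> u2 \<in> F"
    "\<And>F. F \<in> prime_filters A \<Longrightarrow> \<not> (u1 \<in> F \<and> u2 \<in> F)"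
    "\<And>F. F \<in> prime_filters A \<Longrightarrow> u \<notin> F \<Longrightarrow> \<exists>G\<in>prime_filters A. F \<subseteq> G \<and> u \<in> G \<Longrightarrow>
       (\<exists>G\<in>prime_filters A. F \<subseteq> G \<and> u1 \<in> G) \<and> (\<exists>G\<in>prime_filters A. F \<subseteq> G \<and> u2 \<in> G)"
    using splitting_below[OF S insert.prems] by blast
  obtain g where g: "partitions u2 I g" using insert.IH[OF u12(2,4)] by blast
  note pd = partitionsD[OF g]
  have g1: "g y \<in> carrier A" "g y \<noteq> zero A" if "y \<in> I" for y using pd(1) that by simp_all
  have g2: "u2 \<in> F \<longleftrightarrow> (\<exists>y\<in>I. g y \<in> F)" if "F \<in> prime_filters A" for F
    using pd(2) that by simp
  have g3: "y = z" if "F \<in> prime_filters A" "y \<in> I" "z \<in> I" "g y \<in> F" "g z \<in> F" for F y z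
    using pd(3)[rule_format, OF that] .
  have g4: "\<exists>G\<in>prime_filters A. F \<subseteq> G \<and> g y \<in> G"
    if "F \<in> prime_filters A" "u2 \<notin> F" "\<exists>G\<in>prime_filters A. F \<subseteq> G \<and> u2 \<in> G" "y \<in> I" for F y
    using pd(4)[rule_format, OF that(1,2) that(3) that(4)] .
  let ?g = "g(x := u1)"
  have eq: "?g x = u1" "\<And>y. y \<in> I \<Longrightarrow> ?g y = g y" using insert.hyps(3) by auto
  have ex: "(\<exists>y\<in>insert x I. ?g y \<in> F) \<longleftrightarrow> u1 \<in> F \<or> (\<exists>y\<in>I. g y \<in> F)" for F
    using eq by (metis insert_iff)
  have "partitions u (insert x I) ?g"
    unfolding partitions_def
  proof (intro conjI ballI impI)
    fix F assume F: "F \<in> prime_filters A"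
    show "u \<in> F \<longleftrightarrow> (\<exists>y\<in>insert x I. ?g y \<in> F)" unfolding ex using u12(5)[OF F] g2[OF F] by blast
    fix y assume y: "y \<in> insert x I"
    show "\<exists>G\<in>prime_filters A. F \<subseteq> G \<and> ?g y \<in> G"
      if h: "u \<notin> F" "\<exists>G\<in>prime_filters A. F \<subseteq> G \<and> u \<in> G"
    proof (cases "y = x")
      case True
      then show ?thesis using u12(7)[OF F h] by simp
    next
      case False
      then have yI: "y \<in> I" using y by blast
      show ?thesis
        unfolding eq(2)[OF yI] using g4[OF F _ _ yI] u12(5,7)[OF F] h by blast
    qed
    fix z assume z: "z \<in> insert x I" and yz: "?g y \<in> F" "?g z \<in> F"
    show "y = z"
    proof (rule ccontr)
      assume ne: "y \<noteq> z"
      show False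
      proof (cases "y \<in> I \<and> z \<in> I")
        case True
        then show False using g3[OF F] yz eq ne by metis
      next
        case False
        then have "u1 \<in> F \<and> (\<exists>y\<in>I. g y \<in> F)" using y z yz eq ne by (metis insertE)
        then show False using u12(6)[OF F] g2[OF F] by blast
      qed
    qed
  next
    fix y assume "y \<in> insert x I"
    then show "?g y \<in> carrier A" "?g y \<noteq> zero A" using g1 u12(1,3) eq by (metis insertE)+
  qed
  then show ?case by blast
qed

lemma finite_join:
  assumes "finite S" "\<And>y. y \<in> S \<Longrightarrow> g y \<in> carrier A"
  shows "\<exists>d\<in>carrier A. \<forall>F\<in>prime_filters A. d \<in> F \<longleftrightarrow> (\<exists>y\<in>S. g y \<in> F)"
  using assms
proof (induction S)
  case empty
  show ?case by (rule bexI[of _ "zero A"]) simp_all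
next
  case (insert x S)
  have "\<exists>d\<in>carrier A. \<forall>F\<in>prime_filters A. d \<in> F \<longleftrightarrow> (\<exists>y\<in>S. g y \<in> F)"
    by (rule insert.IH) (use insert.prems in simp)
  then obtain d where d: "d \<in> carrier A" "\<forall>F\<in>prime_filters A. d \<in> F \<longleftrightarrow> (\<exists>y\<in>S. g y \<in> F)"
    by blast
  have gx: "g x \<in> carrier A" using insert.prems by blast
  show ?case
    by (rule bexI[of _ "join A (g x) d"]) (use d gx in simp_all)
qed

text \<open>
  A p-morphism from the clopen set of \<open>u\<close> onto the points of \<open>P\<close> above \<open>x\<close>, with definable
  preimages. The last condition makes it possible to glue it below further points.
\<close>

definition tree_map :: "'c set set \<Rightarrow> 'c set \<Rightarrow> 'a \<Rightarrow> ('a set \<Rightarrow> 'c set) \<Rightarrow> bool" where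
  "tree_map P x u f \<longleftrightarrow>
     (\<forall>F\<in>prime_filters A. u \<in> F \<longrightarrow> f F \<in> P \<and> x \<subseteq> f F) \<and>
     (\<forall>F\<in>prime_filters A. \<forall>G\<in>prime_filters A. u \<in> F \<longrightarrow> F \<subseteq> G \<longrightarrow> f F \<subseteq> f G) \<and>
     (\<forall>F\<in>prime_filters A. \<forall>z\<in>P. u \<in> F \<longrightarrow> f F \<subseteq> z \<longrightarrow> (\<exists>G\<in>prime_filters A. F \<subseteq> G \<and> f G = z)) \<and>
     (\<forall>y\<in>P. \<exists>c\<in>carrier A. \<forall>F\<in>prime_filters A. c \<in> F \<longleftrightarrow> u \<in> F \<and> y \<subseteq> f F) \<and>
     (\<exists>F\<in>prime_filters A. u \<in> F \<and> f F = x) \<and>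
     (\<forall>F\<in>prime_filters A. u \<notin> F \<longrightarrow> (\<exists>G\<in>prime_filters A. F \<subseteq> G \<and> u \<in> G) \<longrightarrow>
       (\<exists>G\<in>prime_filters A. F \<subseteq> G \<and> u \<in> G \<and> f G = x))"

lemma tree_mapD:
  assumes "tree_map P x u f"
  shows "\<And>F. F \<in> prime_filters A \<Longrightarrow> u \<in> F \<Longrightarrow> f F \<in> P"
    "\<And>F. F \<in> prime_filters A \<Longrightarrow> u \<in> F \<Longrightarrow> x \<subseteq> f F"
    "\<And>F G. F \<in> prime_filters A \<Longrightarrow> G \<in> prime_filters A \<Longrightarrow> u \<in> F \<Longrightarrow> F \<subseteq> G \<Longrightarrow> f F \<subseteq> f G"
    "\<And>F z. F \<in> prime_filters A \<Longrightarrow> z \<in> P \<Longrightarrow> u \<in> F \<Longrightarrow> f F \<subseteq> z \<Longrightarrow>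
      \<exists>G\<in>prime_filters A. F \<subseteq> G \<and> f G = z"
    "\<And>y. y \<in> P \<Longrightarrow> \<exists>c\<in>carrier A. \<forall>F\<in>prime_filters A. c \<in> F \<longleftrightarrow> u \<in> F \<and> y \<subseteq> f F"
    "\<exists>F\<in>prime_filters A. u \<in> F \<and> f F = x"
    "\<And>F. F \<in> prime_filters A \<Longrightarrow> u \<notin> F \<Longrightarrow> \<exists>G\<in>prime_filters A. F \<subseteq> G \<and> u \<in> G \<Longrightarrow>
       \<exists>G\<in>prime_filters A. F \<subseteq> G \<and> u \<in> G \<and> f G = x"
proof -
  note t = assms[unfolded tree_map_def]
  note t1 = t[THEN conjunct1] and t2 = t[THEN conjunct2, THEN conjunct1]
    and t3 = t[THEN conjunct2, THEN conjunct2, THEN conjunct1]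
    and t4 = t[THEN conjunct2, THEN conjunct2, THEN conjunct2, THEN conjunct1]
    and t5 = t[THEN conjunct2, THEN conjunct2, THEN conjunct2, THEN conjunct2, THEN conjunct1]
    and t6 = t[THEN conjunct2, THEN conjunct2, THEN conjunct2, THEN conjunct2, THEN conjunct2]
  show "\<And>F. F \<in> prime_filters A \<Longrightarrow> u \<in> F \<Longrightarrow> f F \<in> P"
    "\<And>F. F \<in> prime_filters A \<Longrightarrow> u \<in> F \<Longrightarrow> x \<subseteq> f F"
    using t1 by blast+
  show "\<And>F G. F \<in> prime_filters A \<Longrightarrow> G \<in> prime_filters A \<Longrightarrow> u \<in> F \<Longrightarrow> F \<subseteq> G \<Longrightarrow> f F \<subseteq> f G"
    by (rule t2[rule_format])
  show "\<And>F z. F \<in> prime_filters A \<Longrightarrow> z \<in> P \<Longrightarrow> u \<in> F \<Longrightarrow> f F \<subseteq> z \<Longrightarrow>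
      \<exists>G\<in>prime_filters A. F \<subseteq> G \<and> f G = z"
    by (rule t3[rule_format])
  show "\<And>y. y \<in> P \<Longrightarrow> \<exists>c\<in>carrier A. \<forall>F\<in>prime_filters A. c \<in> F \<longleftrightarrow> u \<in> F \<and> y \<subseteq> f F"
    by (rule t4[THEN bspec])
  show "\<exists>F\<in>prime_filters A. u \<in> F \<and> f F = x" by (rule t5)
  show "\<And>F. F \<in> prime_filters A \<Longrightarrow> u \<notin> F \<Longrightarrow> \<exists>G\<in>prime_filters A. F \<subseteq> G \<and> u \<in> G \<Longrightarrow>
       \<exists>G\<in>prime_filters A. F \<subseteq> G \<and> u \<in> G \<and> f G = x"
    using t6 by simp
qed

section \<open>Unfolding a finite poset in the spectrum\<close>

text \<open>Disjointness makes the chosen index the only one; \<open>x\<close> serves as the value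
  outside \<open>u\<close>.\<close>

lemma glue:
  assumes "partitions u S g"
  obtains f where "\<And>F y. F \<in> prime_filters A \<Longrightarrow> y \<in> S \<Longrightarrow> g y \<in> F \<Longrightarrow> f F = h y F"
    "\<And>F. F \<in> prime_filters A \<Longrightarrow> u \<notin> F \<Longrightarrow> f F = x"
proof -
  define f where "f F = (if u \<in> F then h (SOME y. y \<in> S \<and> g y \<in> F) F else x)" for F
  show ?thesis
  proof
    fix F y assume F: "F \<in> prime_filters A" and y: "y \<in> S" "g y \<in> F"
    have "(SOME y. y \<in> S \<and> g y \<in> F) = y"
    proof (rule some_equality)
      show "z = y" if "z \<in> S \<and> g z \<in> F" for z
        using partitionsD(3)[OF assms, rule_format, OF F] that y by blast
    qed (use y in simp)
    moreover have "u \<in> F" using partitionsD(2)[OF assms, rule_format, OF F] y by blast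
    ultimately show "f F = h y F" by (simp add: f_def)
  qed (simp add: f_def)
qed

text \<open>On each piece the preimage is clopen by the map given there, and finitely many pieces
  can be joined.\<close>

lemma glue_definable:
  assumes g: "partitions u S g" and S: "finite S" and h: "\<And>z. z \<in> S \<Longrightarrow> tree_map P z (g z) (h z)"
    and f: "\<And>F y. F \<in> prime_filters A \<Longrightarrow> y \<in> S \<Longrightarrow> g y \<in> F \<Longrightarrow> f F = h y F" and y: "y \<in> P"
  shows "\<exists>c\<in>carrier A. \<forall>F\<in>prime_filters A. c \<in> F \<longleftrightarrow> u \<in> F \<and> y \<subseteq> f F"
proof -
  have "\<forall>z\<in>S. \<exists>c. c \<in> carrier A \<and> (\<forall>F\<in>prime_filters A. c \<in> F \<longleftrightarrow> g z \<in> F \<and> y \<subseteq> h z F)"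
    using tree_mapD(5)[OF h y] by blast
  then obtain c where c: "\<And>z. z \<in> S \<Longrightarrow> c z \<in> carrier A"
    "\<And>z F. z \<in> S \<Longrightarrow> F \<in> prime_filters A \<Longrightarrow> c z \<in> F \<longleftrightarrow> g z \<in> F \<and> y \<subseteq> h z F"
    by metis
  obtain d where d: "d \<in> carrier A" "\<forall>F\<in>prime_filters A. d \<in> F \<longleftrightarrow> (\<exists>z\<in>S. c z \<in> F)"
    using finite_join[where S = S and g = c, OF S c(1)] by blast
  have "d \<in> F \<longleftrightarrow> u \<in> F \<and> y \<subseteq> f F" if F: "F \<in> prime_filters A" for F
  proof -
    have "u \<in> F \<longleftrightarrow> (\<exists>z\<in>S. g z \<in> F)" using partitionsD(2)[OF g, rule_format, OF F] .
    moreover have "c z \<in> F \<longleftrightarrow> g z \<in> F \<and> y \<subseteq> f F" if "z \<in> S" for z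
      using c(2)[OF that F] f[OF F that] by auto
    ultimately show ?thesis using d(2)[rule_format, OF F] by blast
  qed
  then show ?thesis using d(1) by blast
qed

text \<open>Everything above a point of a piece stays in that piece, so the glued map inherits the
  p-morphism conditions from its parts.\<close>

lemma glue_back:
  assumes g: "partitions u S g" and h: "\<And>z. z \<in> S \<Longrightarrow> tree_map P z (g z) (h z)"
    and f: "\<And>F y. F \<in> prime_filters A \<Longrightarrow> y \<in> S \<Longrightarrow> g y \<in> F \<Longrightarrow> f F = h y F"
    and F: "F \<in> prime_filters A" "u \<in> F"
  shows "f F \<in> P" "\<exists>y\<in>S. y \<subseteq> f F"
    "\<And>G. G \<in> prime_filters A \<Longrightarrow> F \<subseteq> G \<Longrightarrow> f F \<subseteq> f G"
    "\<And>z. z \<in> P \<Longrightarrow> f F \<subseteq> z \<Longrightarrow> \<exists>G\<in>prime_filters A. F \<subseteq> G \<and> f G = z"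
proof -
  obtain y where y: "y \<in> S" "g y \<in> F" using partitionsD(2)[OF g, rule_format, OF F(1)] F(2) by blast
  have fG: "f G = h y G" if "G \<in> prime_filters A" "F \<subseteq> G" for G using f[OF that(1) y(1)] y that by blast
  note fF = fG[OF F(1) subset_refl]
  show "f F \<in> P" "\<exists>y\<in>S. y \<subseteq> f F"
    unfolding fF using tree_mapD(1,2)[OF h[OF y(1)] F(1) y(2)] y by blast+
  show "f F \<subseteq> f G" if G: "G \<in> prime_filters A" "F \<subseteq> G" for G
    unfolding fF fG[OF G] using tree_mapD(3)[OF h[OF y(1)] F(1) G(1) y(2) G(2)] .
  show "\<exists>G\<in>prime_filters A. F \<subseteq> G \<and> f G = z" if z: "z \<in> P" "f F \<subseteq> z" for z
  proof -
    obtain G where "G \<in> prime_filters A" "F \<subseteq> G" "h y G = z"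
      using tree_mapD(4)[OF h[OF y(1)] F(1) z(1) y(2)] z(2) unfolding fF by blast
    then show ?thesis using fG by blast
  qed
qed

text \<open>Induction on the number of points of \<open>P\<close> strictly above \<open>x\<close>. A
  constant map serves a maximal \<open>x\<close>; otherwise u minus \<open>b\<close> is sent to
  \<open>x\<close>, and each point strictly above \<open>x\<close>, not just each cover, receives
  its own piece of \<open>b\<close>. This unfolds an arbitrary finite poset into a tree.\<close>

lemma tree_map_exists:
  assumes D: "density A" and S: "splitting A" and P: "finite P"
    and x: "x \<in> P" and u: "u \<in> carrier A" "u \<noteq> zero A"
  shows "\<exists>f. tree_map P x u f"
  using x u
proof (induction "card {y \<in> P. x \<subset> y}" arbitrary: x u rule: less_induct)
  case less
  note x = less.prems(1) and u = less.prems(2,3)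
  define I where "I = {y \<in> P. x \<subset> y}"
  have finI: "finite I" using P by (simp add: I_def)
  obtain F0 where F0: "F0 \<in> prime_filters A" "u \<in> F0" using u(2) eq_zero_iff_prime[OF u(1)] by blast
  show ?case
  proof (cases "I = {}")
    case True
    have max: "z = x" if "z \<in> P" "x \<subseteq> z" for z using True that by (auto simp: I_def)
    have "\<exists>c\<in>carrier A. \<forall>F\<in>prime_filters A. c \<in> F \<longleftrightarrow> u \<in> F \<and> y \<subseteq> x" for y
    proof (cases "y \<subseteq> x")
      case True
      then show ?thesis using u by blast
    next
      case False
      then show ?thesis using zero_closed zero_notin_prime by blast
    qed
    then have "tree_map P x u (\<lambda>_. x)"
      unfolding tree_map_def using x F0 max by blast
    then show ?thesis by blast
  next
    case False
    obtain b where b: "b \<in> carrier A"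
      "\<And>F. F \<in> prime_filters A \<Longrightarrow> b \<in> F \<Longrightarrow> u \<in> F"
      "\<exists>F\<in>prime_filters A. u \<in> F \<and> b \<notin> F"
      "\<And>F. F \<in> prime_filters A \<Longrightarrow> u \<in> F \<Longrightarrow> \<exists>G\<in>prime_filters A. F \<subseteq> G \<and> b \<in> G"
      "\<And>F. F \<in> prime_filters A \<Longrightarrow> u \<notin> F \<Longrightarrow> \<exists>G\<in>prime_filters A. F \<subseteq> G \<and> u \<in> G \<Longrightarrow>
         \<exists>G\<in>prime_filters A. F \<subseteq> G \<and> u \<in> G \<and> b \<notin> G"
      using density_below[OF D u] by blast
    have "b \<noteq> zero A" using b(4)[OF F0] zero_notin_prime by blast
    then obtain g where g: "partitions b I g" using splitting_family[OF S finI False b(1)] by blast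
    have "\<exists>f. tree_map P y (g y) f" if y: "y \<in> I" for y
    proof (rule less.hyps)
      have "{z \<in> P. y \<subset> z} \<subset> {z \<in> P. x \<subset> z}" using y by (auto simp: I_def)
      then show "card {z \<in> P. y \<subset> z} < card {z \<in> P. x \<subset> z}"
        using P by (intro psubset_card_mono) auto
    qed (use y partitionsD(1)[OF g] in \<open>simp_all add: I_def\<close>)
    then obtain h where h: "\<And>y. y \<in> I \<Longrightarrow> tree_map P y (g y) (h y)" by metis
    obtain f where f: "\<And>F y. F \<in> prime_filters A \<Longrightarrow> y \<in> I \<Longrightarrow> g y \<in> F \<Longrightarrow> f F = h y F"
      "\<And>F. F \<in> prime_filters A \<Longrightarrow> b \<notin> F \<Longrightarrow> f F = x"
      using glue[OF g, where h = h and x = x] by blast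
    have 1: "f F \<in> P \<and> x \<subseteq> f F" if F: "F \<in> prime_filters A" for F
    proof (cases "b \<in> F")
      case True
      then show ?thesis using glue_back(1,2)[OF g h f(1) F True] unfolding I_def by blast
    next
      case False
      then show ?thesis using f(2)[OF F] x by blast
    qed
    have 2: "f F \<subseteq> f G" if "F \<in> prime_filters A" "G \<in> prime_filters A" "F \<subseteq> G" for F G
    proof (cases "b \<in> F")
      case True
      then show ?thesis using glue_back(3)[OF g h f(1) that(1) True that(2,3)] by blast
    next
      case False
      then show ?thesis using f(2) 1 that by blast
    qed
    have 3: "\<exists>G\<in>prime_filters A. F \<subseteq> G \<and> f G = z"
      if F: "F \<in> prime_filters A" "u \<in> F" and z: "z \<in> P" "f F \<subseteq> z" for F z
    proof (cases "b \<in> F")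
      case True
      then show ?thesis using glue_back(4)[OF g h f(1) F(1) True z] by blast
    next
      case bF: False
      show ?thesis
      proof (cases "z = x")
        case True
        then show ?thesis using F f(2)[OF F(1) bF] by blast
      next
        case False
        \<comment> \<open>From outside \<open>b\<close> every piece is visible, because
          \<open>b\<close> is cofinal in \<open>u\<close>; the last condition on the map of the
          piece for \<open>z\<close> then gives a point with value exactly \<open>z\<close>.\<close>
        then have zI: "z \<in> I" using z f(2)[OF F(1) bF] by (auto simp: I_def)
        then have "\<exists>G\<in>prime_filters A. F \<subseteq> G \<and> g z \<in> G"
          using partitionsD(4)[OF g, rule_format, OF F(1) bF] b(4)[OF F] by blast
        moreover have "g z \<notin> F" using partitionsD(2)[OF g, rule_format, OF F(1)] bF zI by blast
        ultimately obtain G where "G \<in> prime_filters A" "F \<subseteq> G" "g z \<in> G" "h z G = z"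
          using tree_mapD(7)[OF h[OF zI] F(1)] by blast
        then show ?thesis using f(1)[OF _ zI] by blast
      qed
    qed
    \<comment> \<open>Off \<open>b\<close> the value is \<open>x\<close>, so within \<open>u\<close>
      the preimage is either everything or contained in \<open>b\<close>.\<close>
    have 4: "\<exists>c\<in>carrier A. \<forall>F\<in>prime_filters A. c \<in> F \<longleftrightarrow> u \<in> F \<and> y \<subseteq> f F" if y: "y \<in> P" for y
    proof (cases "y \<subseteq> x")
      case True
      then have "\<forall>F\<in>prime_filters A. u \<in> F \<longleftrightarrow> u \<in> F \<and> y \<subseteq> f F" using 1 by blast
      then show ?thesis using u by blast
    next
      case False
      obtain c where c: "c \<in> carrier A" "\<forall>F\<in>prime_filters A. c \<in> F \<longleftrightarrow> b \<in> F \<and> y \<subseteq> f F"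
        using glue_definable[OF g finI h f(1) y] by blast
      have "b \<in> F \<and> y \<subseteq> f F \<longleftrightarrow> u \<in> F \<and> y \<subseteq> f F" if F: "F \<in> prime_filters A" for F
        using f(2)[OF F] b(2)[OF F] False by blast
      then have "\<forall>F\<in>prime_filters A. c \<in> F \<longleftrightarrow> u \<in> F \<and> y \<subseteq> f F" using c(2) by simp
      then show ?thesis using c(1) by (rule bexI)
    qed
    have 5: "\<exists>F\<in>prime_filters A. u \<in> F \<and> f F = x" using b(3) f(2) by blast
    have 6: "\<exists>G\<in>prime_filters A. F \<subseteq> G \<and> u \<in> G \<and> f G = x"
      if "F \<in> prime_filters A" "u \<notin> F" "\<exists>G\<in>prime_filters A. F \<subseteq> G \<and> u \<in> G" for F
      using b(5)[OF that] f(2) by blast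
    have "tree_map P x u f"
      unfolding tree_map_def by (intro conjI ballI impI; (rule 2 3 4 5 6; assumption)?) (simp_all add: 1)
    then show ?thesis by blast
  qed
qed

text \<open>\<open>P\<close> may lack a least point, so the whole spectrum is divided into one piece
  for each point of \<open>P\<close>; each piece attains its own point, whence surjectivity.
  Non-triviality makes the spectrum nonempty.\<close>

theorem p_morphism_onto_finite:
  assumes D: "density A" and S: "splitting A" and N: "nontrivial A" and P: "finite P" "P \<noteq> {}"
  obtains f where "\<And>F. F \<in> prime_filters A \<Longrightarrow> f F \<in> P"
    "\<And>F G. F \<in> prime_filters A \<Longrightarrow> G \<in> prime_filters A \<Longrightarrow> F \<subseteq> G \<Longrightarrow> f F \<subseteq> f G"
    "\<And>F z. F \<in> prime_filters A \<Longrightarrow> z \<in> P \<Longrightarrow> f F \<subseteq> z \<Longrightarrow> \<exists>G\<in>prime_filters A. F \<subseteq> G \<and> f G = z"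
    "\<And>y. y \<in> P \<Longrightarrow> \<exists>c\<in>carrier A. \<forall>F\<in>prime_filters A. c \<in> F \<longleftrightarrow> y \<subseteq> f F"
    "\<And>x. x \<in> P \<Longrightarrow> \<exists>F\<in>prime_filters A. f F = x"
proof -
  obtain g where g: "partitions (one A) P g"
    using splitting_family[OF S P one_closed] N unfolding nontrivial_def by metis
  have "\<exists>f. tree_map P y (g y) f" if "y \<in> P" for y
    using tree_map_exists[OF D S P(1) that] partitionsD(1)[OF g] that by simp
  then obtain h where h: "\<And>y. y \<in> P \<Longrightarrow> tree_map P y (g y) (h y)" by metis
  obtain f where f: "\<And>F y. F \<in> prime_filters A \<Longrightarrow> y \<in> P \<Longrightarrow> g y \<in> F \<Longrightarrow> f F = h y F"
    using that by (rule glue[OF g, where h = h and x = undefined])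
  show ?thesis
  proof
    show "f F \<in> P" if "F \<in> prime_filters A" for F
      using glue_back(1)[OF g h f that one_in_prime[OF that]] by blast
    show "f F \<subseteq> f G" if "F \<in> prime_filters A" "G \<in> prime_filters A" "F \<subseteq> G" for F G
      using glue_back(3)[OF g h f that(1) one_in_prime[OF that(1)] that(2,3)] by blast
    show "\<exists>G\<in>prime_filters A. F \<subseteq> G \<and> f G = z" if "F \<in> prime_filters A" "z \<in> P" "f F \<subseteq> z" for F z
      using glue_back(4)[OF g h f that(1) one_in_prime[OF that(1)] that(2,3)] by blast
    show "\<exists>c\<in>carrier A. \<forall>F\<in>prime_filters A. c \<in> F \<longleftrightarrow> y \<subseteq> f F" if "y \<in> P" for y
      using glue_definable[OF g P(1) h f that] one_in_prime by simp
    show "\<exists>F\<in>prime_filters A. f F = x" if "x \<in> P" for x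
      using tree_mapD(6)[OF h[OF that]] f[OF _ that] by metis
  qed
qed

end


section \<open>Partial embeddings\<close>

definition partial_embedding :: "('a \<Rightarrow> 'b) \<Rightarrow> 'a hstruct \<Rightarrow> 'a set \<Rightarrow> 'b hstruct \<Rightarrow> bool" where
  "partial_embedding \<rho> K E H \<longleftrightarrow> \<rho> ` E \<subseteq> carrier H \<and> inj_on \<rho> E \<and>
     \<rho> (zero K) = zero H \<and> \<rho> (one K) = one H \<and>
     (\<forall>x\<in>E. \<forall>y\<in>E. (join K x y \<in> E \<longrightarrow> \<rho> (join K x y) = join H (\<rho> x) (\<rho> y)) \<and>
        (meet K x y \<in> E \<longrightarrow> \<rho> (meet K x y) = meet H (\<rho> x) (\<rho> y)) \<and>
        (imp K x y \<in> E \<longrightarrow> \<rho> (imp K x y) = imp H (\<rho> x) (\<rho> y)))"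

lemma partial_embedding_comp:
  assumes p: "partial_embedding \<rho> K E L" and e: "embedding e L H"
  shows "partial_embedding (e \<circ> \<rho>) K E H"
proof -
  have L: "\<rho> x \<in> carrier L" if "x \<in> E" for x using p that unfolding partial_embedding_def by blast
  have "inj_on e (\<rho> ` E)" using p e unfolding partial_embedding_def embedding_def
    by (meson inj_on_subset)
  then show ?thesis
    using p e L unfolding partial_embedding_def embedding_def
    by (simp add: comp_inj_on image_subset_iff)
qed

text \<open>Subformulas of a formula in \<open>ipc_formulas l n\<close> stay in that set, so all
  intermediate values lie in \<open>E\<close>.\<close>

lemma partial_embedding_eval:
  assumes p: "partial_embedding \<rho> K E H" and E: "eval K u ` ipc_formulas l n \<subseteq> E"
    and w: "\<And>i. i < l \<Longrightarrow> w i = \<rho> (u i)" and t: "t \<in> ipc_formulas l n"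
  shows "eval H w t = \<rho> (eval K u t)"
  using t
proof (induction t)
  case (Or s t)
  then have "eval K u (Or s t) \<in> E" "eval K u s \<in> E" "eval K u t \<in> E" using E by (auto simp del: eval.simps)
  then show ?case using Or p unfolding partial_embedding_def by simp
next
  case (And s t)
  then have "eval K u (And s t) \<in> E" "eval K u s \<in> E" "eval K u t \<in> E" using E by (auto simp del: eval.simps)
  then show ?case using And p unfolding partial_embedding_def by simp
next
  case (To s t)
  note ipc_formulas_ToD[OF To.prems]
  moreover from this have "eval K u (To s t) \<in> E" "eval K u s \<in> E" "eval K u t \<in> E"
    using E To.prems by (auto simp del: eval.simps)
  ultimately show ?case using To.IH p unfolding partial_embedding_def by simp
qed (use w p in \<open>simp_all add: partial_embedding_def\<close>)

definition traces :: "'a hstruct \<Rightarrow> 'a set \<Rightarrow> 'a set set" where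
  "traces K E = (\<lambda>F. E \<inter> F) ` prime_filters K"

lemma finite_traces: "finite E \<Longrightarrow> finite (traces K E)"
  by (rule finite_subset[of _ "Pow E"]) (auto simp: traces_def)

lemma heyting_upalg_subset: "heyting_algebra (upalg P (\<subseteq>))"
  by (rule heyting_upalg) auto

text \<open>Traces can be included in each other without the filters being so. An implication that
  belongs to \<open>E\<close> is nevertheless carried along the inclusion of traces, which gives the
  forward half; for the converse, inclusion of filters implies inclusion of traces.\<close>

theorem filtration:
  assumes K: "heyting_algebra K" and E: "E \<subseteq> carrier K" "zero K \<in> E" "one K \<in> E"
  shows "partial_embedding (\<lambda>c. {T \<in> traces K E. c \<in> T}) K E (upalg (traces K E) (\<subseteq>))"
proof -
  interpret heyting K by (rule heytingI[OF K])
  let ?P = "traces K E" and ?h = "\<lambda>c. {T \<in> traces K E. c \<in> T}"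
  have inj: "inj_on ?h E"
  proof (rule inj_onI)
    fix c d assume cd: "c \<in> E" "d \<in> E" "?h c = ?h d"
    have "c \<in> F \<longleftrightarrow> d \<in> F" if F: "F \<in> prime_filters K" for F
    proof -
      have "E \<inter> F \<in> ?P" using F by (simp add: traces_def)
      moreover have "E \<inter> F \<in> ?h c \<longleftrightarrow> E \<inter> F \<in> ?h d" using cd(3) by simp
      ultimately show ?thesis using cd(1,2) by simp
    qed
    moreover have "c \<in> carrier K" "d \<in> carrier K" using cd E(1) by blast+
    ultimately show "c = d" using eq_iff_prime[of c d] by blast
  qed
  have imp: "?h (imp K c d) = imp (upalg ?P (\<subseteq>)) (?h c) (?h d)"
    if cd: "c \<in> E" "d \<in> E" "imp K c d \<in> E" for c d
  proof -
    have c: "c \<in> carrier K" "d \<in> carrier K" using cd E by auto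
    have "imp K c d \<in> E \<inter> F \<longleftrightarrow> (\<forall>T\<in>?P. E \<inter> F \<subseteq> T \<longrightarrow> c \<in> T \<longrightarrow> d \<in> T)"
      if F: "F \<in> prime_filters K" for F
    proof
      assume i: "imp K c d \<in> E \<inter> F"
      show "\<forall>T\<in>?P. E \<inter> F \<subseteq> T \<longrightarrow> c \<in> T \<longrightarrow> d \<in> T"
      proof (intro ballI impI)
        fix T assume T: "T \<in> ?P" "E \<inter> F \<subseteq> T" "c \<in> T"
        obtain G where G: "G \<in> prime_filters K" "T = E \<inter> G" using T(1) by (auto simp: traces_def)
        have "imp K c d \<in> G" "c \<in> G" using i T G by blast+
        then have "d \<in> G" using imp_in_prime[OF G(1) c] G(1) by blast
        then show "d \<in> T" using G cd by blast
      qed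
    next
      assume *: "\<forall>T\<in>?P. E \<inter> F \<subseteq> T \<longrightarrow> c \<in> T \<longrightarrow> d \<in> T"
      have "d \<in> G" if G: "G \<in> prime_filters K" "F \<subseteq> G" "c \<in> G" for G
      proof -
        have "E \<inter> G \<in> ?P" using G(1) by (simp add: traces_def)
        then have "c \<in> E \<inter> G \<longrightarrow> d \<in> E \<inter> G" using bspec[OF *, of "E \<inter> G"] G(2) by blast
        then show ?thesis using G(3) cd(1) by blast
      qed
      then show "imp K c d \<in> E \<inter> F" using imp_in_prime[OF F c] cd(3) by blast
    qed
    then show ?thesis by (auto simp: traces_def)
  qed
  have jm: "?h (join K c d) = ?h c \<union> ?h d" if cd: "c \<in> E" "d \<in> E" "join K c d \<in> E" for c d
  proof -
    have c: "c \<in> carrier K" "d \<in> carrier K" using cd E by auto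
    have "join K c d \<in> E \<inter> F \<longleftrightarrow> c \<in> E \<inter> F \<or> d \<in> E \<inter> F" if "F \<in> prime_filters K" for F
      using join_in_prime[OF that c] cd by blast
    then show ?thesis by (auto simp: traces_def)
  qed
  have mt: "?h (meet K c d) = ?h c \<inter> ?h d" if cd: "c \<in> E" "d \<in> E" "meet K c d \<in> E" for c d
  proof -
    have c: "c \<in> carrier K" "d \<in> carrier K" using cd E by auto
    have "meet K c d \<in> E \<inter> F \<longleftrightarrow> c \<in> E \<inter> F \<and> d \<in> E \<inter> F" if "F \<in> prime_filters K" for F
      using meet_in_prime[OF that c] cd by blast
    then show ?thesis by (auto simp: traces_def)
  qed
  have z: "?h (zero K) = {}" and o: "?h (one K) = ?P" using E by (auto simp: traces_def)
  have up: "?h c \<in> carrier (upalg ?P (\<subseteq>))" for c by auto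
  show ?thesis
    unfolding partial_embedding_def
    using inj imp jm mt z o up by (simp del: upalg_simps(1,6) add: image_subset_iff)
qed

text \<open>Taking preimages along the p-morphism onto \<open>P\<close> is the embedding; the
  preimage of an up-set is a finite union of the definable preimages of the principal up-sets of its
  members.\<close>

theorem finite_upalg_embeds:
  fixes P :: "'c set set"
  assumes H: "heyting_algebra H" "density H" "splitting H" "nontrivial H" and P: "finite P" "P \<noteq> {}"
  obtains e where "embedding e (upalg P (\<subseteq>)) H"
proof -
  interpret heyting H by (rule heytingI[OF H(1)])
  let ?U = "upalg P (\<subseteq>)"
  obtain f where f: "\<And>F. F \<in> prime_filters H \<Longrightarrow> f F \<in> P"
    "\<And>F G. F \<in> prime_filters H \<Longrightarrow> G \<in> prime_filters H \<Longrightarrow> F \<subseteq> G \<Longrightarrow> f F \<subseteq> f G"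
    "\<And>F z. F \<in> prime_filters H \<Longrightarrow> z \<in> P \<Longrightarrow> f F \<subseteq> z \<Longrightarrow> \<exists>G\<in>prime_filters H. F \<subseteq> G \<and> f G = z"
    "\<And>y. y \<in> P \<Longrightarrow> \<exists>c\<in>carrier H. \<forall>F\<in>prime_filters H. c \<in> F \<longleftrightarrow> y \<subseteq> f F"
    "\<And>x. x \<in> P \<Longrightarrow> \<exists>F\<in>prime_filters H. f F = x"
    using p_morphism_onto_finite[OF H(2-4) P] by blast
  have "\<forall>y\<in>P. \<exists>c. c \<in> carrier H \<and> (\<forall>F\<in>prime_filters H. c \<in> F \<longleftrightarrow> y \<subseteq> f F)" using f(4) by blast
  from bchoice[OF this] obtain c where
    c: "\<forall>y\<in>P. c y \<in> carrier H \<and> (\<forall>F\<in>prime_filters H. c y \<in> F \<longleftrightarrow> y \<subseteq> f F)" by blast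
  have "\<exists>d. d \<in> carrier H \<and> (\<forall>F\<in>prime_filters H. d \<in> F \<longleftrightarrow> f F \<in> X)" if X: "X \<in> carrier ?U" for X
  proof -
    have XP: "X \<subseteq> P" and up: "\<And>x y. x \<in> X \<Longrightarrow> y \<in> P \<Longrightarrow> x \<subseteq> y \<Longrightarrow> y \<in> X" using X by auto
    have fin: "finite X" using XP P(1) by (rule finite_subset)
    have cX: "\<And>y. y \<in> X \<Longrightarrow> c y \<in> carrier H" using c XP by blast
    obtain d where d: "d \<in> carrier H" "\<forall>F\<in>prime_filters H. d \<in> F \<longleftrightarrow> (\<exists>y\<in>X. c y \<in> F)"
      using finite_join[where S = X and g = c, OF fin cX] by blast
    have "d \<in> F \<longleftrightarrow> f F \<in> X" if F: "F \<in> prime_filters H" for F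
    proof -
      have "d \<in> F \<longleftrightarrow> (\<exists>y\<in>X. y \<subseteq> f F)" using d(2)[rule_format, OF F] c XP F by blast
      also have "\<dots> \<longleftrightarrow> f F \<in> X" using up f(1)[OF F] by blast
      finally show ?thesis .
    qed
    then show ?thesis using d(1) by blast
  qed
  then have "\<forall>X\<in>carrier ?U. \<exists>d. d \<in> carrier H \<and> (\<forall>F\<in>prime_filters H. d \<in> F \<longleftrightarrow> f F \<in> X)" by (intro ballI)
  from bchoice[OF this] obtain e where
    e0: "\<forall>X\<in>carrier ?U. e X \<in> carrier H \<and> (\<forall>F\<in>prime_filters H. e X \<in> F \<longleftrightarrow> f F \<in> X)" by blast
  have ec: "e X \<in> carrier H" if "X \<in> carrier ?U" for X using bspec[OF e0 that] by blast
  have eF: "e X \<in> F \<longleftrightarrow> f F \<in> X" if "X \<in> carrier ?U" "F \<in> prime_filters H" for X F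
    using bspec[OF e0 that(1)] that(2) by blast
  interpret U: heyting ?U by (rule heytingI[OF heyting_upalg_subset])
  have "embedding e ?U H"
    unfolding embedding_def
  proof (intro conjI ballI)
    show "e ` carrier ?U \<subseteq> carrier H" using ec by blast
    show "inj_on e (carrier ?U)"
    proof (rule inj_onI)
      fix X Y assume XY: "X \<in> carrier ?U" "Y \<in> carrier ?U" "e X = e Y"
      have "x \<in> X \<longleftrightarrow> x \<in> Y" if x: "x \<in> P" for x
      proof -
        obtain F where F: "F \<in> prime_filters H" "f F = x" using f(5)[OF x] by blast
        then show ?thesis using eF[OF XY(1) F(1)] eF[OF XY(2) F(1)] XY(3) by simp
      qed
      moreover have "X \<subseteq> P" "Y \<subseteq> P" using XY by auto
      ultimately show "X = Y" by blast
    qed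
    show "e (zero ?U) = zero H"
      unfolding eq_zero_iff_prime[OF ec[OF U.zero_closed]] using eF[OF U.zero_closed] by simp
    show "e (one ?U) = one H"
      unfolding eq_one_iff_prime[OF ec[OF U.one_closed]] using eF[OF U.one_closed] f(1) by simp
    fix X Y assume XY: "X \<in> carrier ?U" "Y \<in> carrier ?U"
    note eXY = eF[OF XY(1)] eF[OF XY(2)] ec[OF XY(1)] ec[OF XY(2)]
    show "e (join ?U X Y) = join H (e X) (e Y)"
      by (subst eq_iff_prime) (use eF[OF U.join_closed[OF XY]] ec[OF U.join_closed[OF XY]] eXY in simp_all)
    show "e (meet ?U X Y) = meet H (e X) (e Y)"
      by (subst eq_iff_prime) (use eF[OF U.meet_closed[OF XY]] ec[OF U.meet_closed[OF XY]] eXY in simp_all)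
    show "e (imp ?U X Y) = imp H (e X) (e Y)"
    proof (subst eq_iff_prime[OF ec[OF U.imp_closed[OF XY]] imp_closed[OF eXY(3,4)]], rule ballI)
      fix F assume F: "F \<in> prime_filters H"
      have "e (imp ?U X Y) \<in> F \<longleftrightarrow> (\<forall>z\<in>P. f F \<subseteq> z \<longrightarrow> z \<in> X \<longrightarrow> z \<in> Y)"
        unfolding eF[OF U.imp_closed[OF XY] F] using f(1)[OF F] by simp
      also have "\<dots> \<longleftrightarrow> (\<forall>G\<in>prime_filters H. F \<subseteq> G \<longrightarrow> f G \<in> X \<longrightarrow> f G \<in> Y)"
      proof
        assume *: "\<forall>z\<in>P. f F \<subseteq> z \<longrightarrow> z \<in> X \<longrightarrow> z \<in> Y"
        show "\<forall>G\<in>prime_filters H. F \<subseteq> G \<longrightarrow> f G \<in> X \<longrightarrow> f G \<in> Y"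
        proof (intro ballI impI)
          fix G assume G: "G \<in> prime_filters H" "F \<subseteq> G" "f G \<in> X"
          show "f G \<in> Y" using * f(1)[OF G(1)] f(2)[OF F G(1,2)] G(3) by blast
        qed
      next
        assume *: "\<forall>G\<in>prime_filters H. F \<subseteq> G \<longrightarrow> f G \<in> X \<longrightarrow> f G \<in> Y"
        show "\<forall>z\<in>P. f F \<subseteq> z \<longrightarrow> z \<in> X \<longrightarrow> z \<in> Y"
        proof (intro ballI impI)
          fix z assume z: "z \<in> P" "f F \<subseteq> z" "z \<in> X"
          obtain G where "G \<in> prime_filters H" "F \<subseteq> G" "f G = z" using f(3)[OF F z(1,2)] by blast
          then show "z \<in> Y" using * z(3) by blast
        qed
      qed
      also have "\<dots> \<longleftrightarrow> imp H (e X) (e Y) \<in> F"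
        unfolding imp_in_prime[OF F eXY(3,4)] by (simp add: eXY(1,2) cong: ball_cong)
      finally show "e (imp ?U X Y) \<in> F \<longleftrightarrow> imp H (e X) (e Y) \<in> F" .
    qed
  qed
  then show ?thesis by (rule that)
qed

text \<open>The traces on \<open>E\<close> form a finite nonempty poset, whose algebra of up-sets
  embeds into \<open>H\<close>. Trivial algebras have an empty spectrum and are treated apart; there
  \<open>E\<close> has one element.\<close>

corollary partial_embedding_exists:
  assumes H: "heyting_algebra H" "density H" "splitting H"
    and K: "heyting_algebra K" "nontrivial K \<longleftrightarrow> nontrivial H"
    and E: "finite E" "E \<subseteq> carrier K" "zero K \<in> E" "one K \<in> E"
  obtains \<rho> where "partial_embedding \<rho> K E H"
proof (cases "nontrivial H")
  case True
  interpret K: heyting K by (rule heytingI[OF K(1)])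
  have "zero K \<noteq> one K" using K(2) True by (simp add: nontrivial_def)
  then have "prime_filters K \<noteq> {}" using K.eq_one_iff_prime[OF K.zero_closed] by blast
  then have "traces K E \<noteq> {}" by (simp add: traces_def)
  then obtain e where "embedding e (upalg (traces K E) (\<subseteq>)) H"
    using finite_upalg_embeds[OF H True finite_traces[OF E(1)]] by blast
  from partial_embedding_comp[OF filtration[OF K(1) E(2-4)] this] show ?thesis by (rule that)
next
  case False
  interpret K: heyting K by (rule heytingI[OF K(1)])
  interpret H: heyting H by (rule heytingI[OF H(1)])
  have KE: "x = one K" if "x \<in> E" for x using K.trivial_carrier[of x] K(2) False E(2) that by blast
  have HE: "x = one H" if "x \<in> carrier H" for x using H.trivial_carrier[OF False that] .
  have "partial_embedding (\<lambda>_. one H) K E H"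
    unfolding partial_embedding_def
  proof (intro conjI ballI impI)
    show "(\<lambda>_. one H) ` E \<subseteq> carrier H" by auto
    show "inj_on (\<lambda>_. one H) E" by (rule inj_onI) (use KE in metis)
  qed (use HE[symmetric] in simp_all)
  then show ?thesis by (rule that)
qed


section \<open>Back and forth\<close>

text \<open>Bound variables are counted too: the induction on formulas keeps one bound
  \<open>l\<close> for all variables, so that the slot \<open>l\<close> is free for a new
  element.\<close>

primrec fm_vars :: "fm \<Rightarrow> nat set" where
  "fm_vars (Eq s t) = set_ipc s \<union> set_ipc t"
| "fm_vars (Neg p) = fm_vars p"
| "fm_vars (Conj p q) = fm_vars p \<union> fm_vars q"
| "fm_vars (Disj p q) = fm_vars p \<union> fm_vars q"
| "fm_vars (Impl p q) = fm_vars p \<union> fm_vars q"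
| "fm_vars (All x p) = insert x (fm_vars p)"
| "fm_vars (Ex x p) = insert x (fm_vars p)"

primrec fm_degree :: "fm \<Rightarrow> nat" where
  "fm_degree (Eq s t) = max (degree s) (degree t)"
| "fm_degree (Neg p) = fm_degree p"
| "fm_degree (Conj p q) = max (fm_degree p) (fm_degree q)"
| "fm_degree (Disj p q) = max (fm_degree p) (fm_degree q)"
| "fm_degree (Impl p q) = max (fm_degree p) (fm_degree q)"
| "fm_degree (All x p) = fm_degree p"
| "fm_degree (Ex x p) = fm_degree p"

lemma finite_fm_vars: "finite (fm_vars p)"
  by (induction p) auto

lemma fm_vars_bound: obtains l where "fm_vars p \<subseteq> {..<l}"
  using finite_fm_vars[of p] finite_nat_iff_bounded by blast

text \<open>The degree \<open>n\<close> depends on \<open>l\<close> and \<open>d\<close> but not on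
  the tuples; this uniformity allows iteration through quantifiers.\<close>

definition forth :: "'a hstruct \<Rightarrow> 'b hstruct \<Rightarrow> bool" where
  "forth A B \<longleftrightarrow> (\<forall>l d. \<exists>n. \<forall>v w. range v \<subseteq> carrier A \<longrightarrow> range w \<subseteq> carrier B \<longrightarrow>
     sim l n A v B w \<longrightarrow>
     (\<forall>b\<in>carrier B. \<exists>a\<in>carrier A. sim (Suc l) d A (v(l := a)) B (w(l := b))))"

lemma ex_closed_forth:
  assumes "ex_closed A" "heyting_algebra B"
  shows "forth A B"
  unfolding forth_def using ex_closed_amalgamation[OF assms(1) _ assms(2)] by meson

text \<open>A quantifier overwrites the variable \<open>x\<close>, whereas an answer in the game is
  stored in the fresh slot \<open>l\<close>; renaming moves it to \<open>x\<close>.\<close>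

lemma sim_rename:
  assumes s: "sim (Suc l) d A (v(l := a)) B (w(l := b))" and x: "x < l"
  shows "sim l d A (v(x := a)) B (w(x := b))"
  unfolding sim_def
proof
  fix t assume t: "t \<in> ipc_formulas l d"
  define r where "r i = (if i = x then l else i)" for i :: nat
  have "map_ipc r t \<in> ipc_formulas (Suc l) d"
    using t x by (auto simp: ipc_formulas_def ipc.set_map r_def)
  then have "eval A (v(l := a)) (map_ipc r t) = one A \<longleftrightarrow> eval B (w(l := b)) (map_ipc r t) = one B"
    using s unfolding sim_def by blast
  moreover have "eval A (v(l := a)) (map_ipc r t) = eval A (v(x := a)) t"
    unfolding eval_map_ipc by (rule eval_cong_formulas[OF t]) (auto simp: r_def)
  moreover have "eval B (w(l := b)) (map_ipc r t) = eval B (w(x := b)) t"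
    unfolding eval_map_ipc by (rule eval_cong_formulas[OF t]) (auto simp: r_def)
  ultimately show "eval A (v(x := a)) t = one A \<longleftrightarrow> eval B (w(x := b)) t = one B" by simp
qed

context heyting
begin

lemma imp_eq_one: "x \<in> carrier A \<Longrightarrow> y \<in> carrier A \<Longrightarrow> imp A x y = one A \<longleftrightarrow> le A x y"
  by (metis imp_closed le_antisym le_imp_iff le_one meet_commute meet_one one_closed le_refl)

lemma eq_iff_imp_one:
  assumes "x \<in> carrier A" "y \<in> carrier A"
  shows "x = y \<longleftrightarrow> meet A (imp A x y) (imp A y x) = one A"
proof -
  have "meet A (imp A x y) (imp A y x) = one A \<longleftrightarrow> imp A x y = one A \<and> imp A y x = one A"
    using assms by (simp add: eq_one_iff_prime) blast
  then show ?thesis using assms imp_eq_one le_antisym le_refl by metis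
qed

end

definition agree :: "'a hstruct \<Rightarrow> 'b hstruct \<Rightarrow> nat \<Rightarrow> nat \<Rightarrow> fm \<Rightarrow> bool" where
  "agree A B l n p \<longleftrightarrow> (\<forall>v w. range v \<subseteq> carrier A \<longrightarrow> range w \<subseteq> carrier B \<longrightarrow>
     sim l n A v B w \<longrightarrow> (sat A v p \<longleftrightarrow> sat B w p))"

lemma agreeD:
  "agree A B l n p \<Longrightarrow> range v \<subseteq> carrier A \<Longrightarrow> range w \<subseteq> carrier B \<Longrightarrow> sim l n A v B w \<Longrightarrow>
    sat A v p \<longleftrightarrow> sat B w p"
  by (simp add: agree_def)

lemma agree_mono: "agree A B l m p \<Longrightarrow> m \<le> n \<Longrightarrow> agree A B l n p"
  unfolding agree_def using sim_mono[OF _ order_refl] by metis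

text \<open>Challenges from both sides are answered with equal truth values, which settles both
  quantifiers at once.\<close>

lemma forth_quantifier:
  assumes AB: "forth A B" and BA: "forth B A" and x: "x < l"
    and m: "agree A B l m p"
  shows "\<exists>n. \<forall>v w. range v \<subseteq> carrier A \<longrightarrow> range w \<subseteq> carrier B \<longrightarrow> sim l n A v B w \<longrightarrow>
    (\<forall>b\<in>carrier B. \<exists>a\<in>carrier A. sat A (v(x := a)) p \<longleftrightarrow> sat B (w(x := b)) p) \<and>
    (\<forall>a\<in>carrier A. \<exists>b\<in>carrier B. sat A (v(x := a)) p \<longleftrightarrow> sat B (w(x := b)) p)"
proof -
  obtain n1 where n1: "\<forall>v w. range v \<subseteq> carrier A \<longrightarrow> range w \<subseteq> carrier B \<longrightarrow> sim l n1 A v B w \<longrightarrow>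
    (\<forall>b\<in>carrier B. \<exists>a\<in>carrier A. sim (Suc l) m A (v(l := a)) B (w(l := b)))"
    using AB[unfolded forth_def, THEN spec[of _ l], THEN spec[of _ m]] by (rule exE)
  obtain n2 where n2: "\<forall>v w. range v \<subseteq> carrier B \<longrightarrow> range w \<subseteq> carrier A \<longrightarrow> sim l n2 B v A w \<longrightarrow>
    (\<forall>b\<in>carrier A. \<exists>a\<in>carrier B. sim (Suc l) m B (v(l := a)) A (w(l := b)))"
    using BA[unfolded forth_def, THEN spec[of _ l], THEN spec[of _ m]] by (rule exE)
  show ?thesis
  proof (intro exI[of _ "max n1 n2"] allI impI conjI ballI)
    fix v w assume v: "range v \<subseteq> carrier A" "range w \<subseteq> carrier B" and s: "sim l (max n1 n2) A v B w"
    have s1: "sim l n1 A v B w" and s2: "sim l n2 B w A v"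
      using sim_mono[OF s] sim_sym by (metis max.cobounded1 max.cobounded2 order_refl)+
    have fin: "sat A (v(x := a)) p \<longleftrightarrow> sat B (w(x := b)) p"
      if "a \<in> carrier A" "b \<in> carrier B" "sim (Suc l) m A (v(l := a)) B (w(l := b))" for a b
      by (rule agreeD[OF m]) (use v that sim_rename[OF that(3) x] in auto)
    show "\<exists>a\<in>carrier A. sat A (v(x := a)) p \<longleftrightarrow> sat B (w(x := b)) p" if b: "b \<in> carrier B" for b
      using n1[rule_format, OF v s1 b] fin[OF _ b] by blast
    show "\<exists>b\<in>carrier B. sat A (v(x := a)) p \<longleftrightarrow> sat B (w(x := b)) p" if a: "a \<in> carrier A" for a
      using n2[rule_format, OF v(2,1) s2 a] fin[OF a] sim_sym by blast
  qed
qed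

theorem sat_back_and_forth:
  assumes A: "heyting_algebra A" and B: "heyting_algebra B" and AB: "forth A B" and BA: "forth B A"
    and p: "fm_vars p \<subseteq> {..<l}"
  shows "\<exists>n. agree A B l n p"
  using p
proof (induction p)
  case (Eq s t)
  interpret A: heyting A by (rule heytingI[OF A])
  interpret B: heyting B by (rule heytingI[OF B])
  let ?n = "max (degree s) (degree t)"
  \<comment> \<open>The equation turns into a biconditional with value \<open>one\<close>, at the
    price of one degree.\<close>
  have st: "And (To s t) (To t s) \<in> ipc_formulas l (Suc ?n)"
    using Eq by (simp add: ipc_formulas_def)
  have "sat A v (Eq s t) \<longleftrightarrow> sat B w (Eq s t)"
    if v: "range v \<subseteq> carrier A" "range w \<subseteq> carrier B" and s: "sim l (Suc ?n) A v B w" for v w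
  proof -
    have "eval A v (And (To s t) (To t s)) = one A \<longleftrightarrow> eval B w (And (To s t) (To t s)) = one B"
      using s st unfolding sim_def by blast
    then show ?thesis
      using A.eq_iff_imp_one[OF A.eval_closed[OF v(1)] A.eval_closed[OF v(1)], of s t]
        B.eq_iff_imp_one[OF B.eval_closed[OF v(2)] B.eval_closed[OF v(2)], of s t] by simp
  qed
  then show ?case unfolding agree_def by blast
next
  case (Neg p)
  then show ?case by (simp add: agree_def)
next
  case (Conj p q)
  then obtain m n where "agree A B l m p" "agree A B l n q" by auto
  then have "agree A B l (max m n) p" "agree A B l (max m n) q" by (auto intro: agree_mono)
  then have "agree A B l (max m n) (Conj p q)" by (simp add: agree_def)
  then show ?case by blast
next
  case (Disj p q)
  then obtain m n where "agree A B l m p" "agree A B l n q" by auto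
  then have "agree A B l (max m n) p" "agree A B l (max m n) q" by (auto intro: agree_mono)
  then have "agree A B l (max m n) (Disj p q)" by (simp add: agree_def)
  then show ?case by blast
next
  case (Impl p q)
  then obtain m n where "agree A B l m p" "agree A B l n q" by auto
  then have "agree A B l (max m n) p" "agree A B l (max m n) q" by (auto intro: agree_mono)
  then have "agree A B l (max m n) (Impl p q)" by (simp add: agree_def)
  then show ?case by blast
next
  case (All x p)
  then obtain m where m: "agree A B l m p" by auto
  have x: "x < l" using All.prems by simp
  from forth_quantifier[OF AB BA x m] obtain n where n: "\<forall>v w. range v \<subseteq> carrier A \<longrightarrow>
    range w \<subseteq> carrier B \<longrightarrow> sim l n A v B w \<longrightarrow>
    (\<forall>b\<in>carrier B. \<exists>a\<in>carrier A. sat A (v(x := a)) p \<longleftrightarrow> sat B (w(x := b)) p) \<and>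
    (\<forall>a\<in>carrier A. \<exists>b\<in>carrier B. sat A (v(x := a)) p \<longleftrightarrow> sat B (w(x := b)) p)" by (rule exE)
  show ?case
    unfolding agree_def
  proof (intro exI[of _ n] allI impI)
    fix v w assume "range v \<subseteq> carrier A" "range w \<subseteq> carrier B" "sim l n A v B w"
    from n[rule_format, OF this] show "sat A v (All x p) \<longleftrightarrow> sat B w (All x p)"
      unfolding sat.simps by blast
  qed
next
  case (Ex x p)
  then obtain m where m: "agree A B l m p" by auto
  have x: "x < l" using Ex.prems by simp
  from forth_quantifier[OF AB BA x m] obtain n where n: "\<forall>v w. range v \<subseteq> carrier A \<longrightarrow>
    range w \<subseteq> carrier B \<longrightarrow> sim l n A v B w \<longrightarrow>
    (\<forall>b\<in>carrier B. \<exists>a\<in>carrier A. sat A (v(x := a)) p \<longleftrightarrow> sat B (w(x := b)) p) \<and>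
    (\<forall>a\<in>carrier A. \<exists>b\<in>carrier B. sat A (v(x := a)) p \<longleftrightarrow> sat B (w(x := b)) p)" by (rule exE)
  show ?case
    unfolding agree_def
  proof (intro exI[of _ n] allI impI)
    fix v w assume "range v \<subseteq> carrier A" "range w \<subseteq> carrier B" "sim l n A v B w"
    from n[rule_format, OF this] show "sat A v (Ex x p) \<longleftrightarrow> sat B w (Ex x p)"
      unfolding sat.simps by blast
  qed
qed


section \<open>The index\<close>

text \<open>\<open>solvable\<close> with an assignment for the parameters, which fits the
  back-and-forth setting.\<close>

definition solv :: "'a hstruct \<Rightarrow> nat \<Rightarrow> system \<Rightarrow> (nat \<Rightarrow> 'a) \<Rightarrow> bool" where
  "solv A l S v \<longleftrightarrow> (\<exists>q\<in>carrier A. eval A (v(l := q)) (fst S) = one A \<and>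
     (\<forall>s\<in>set (snd S). eval A (v(l := q)) s \<noteq> one A))"

lemma systems_iff:
  "S \<in> systems l d \<longleftrightarrow> fst S \<in> ipc_formulas (Suc l) d \<and> set (snd S) \<subseteq> ipc_formulas (Suc l) d"
  by (cases S) (simp add: systems_def)

lemma solv_cong:
  assumes "S \<in> systems l d" "\<And>i q. i \<le> l \<Longrightarrow> (f q) i = (v(l := q)) i"
  shows "(\<exists>q\<in>carrier A. eval A (f q) (fst S) = one A \<and> (\<forall>s\<in>set (snd S). eval A (f q) s \<noteq> one A)) \<longleftrightarrow>
    solv A l S v"
proof -
  have "eval A (f q) t = eval A (v(l := q)) t" if "t \<in> ipc_formulas (Suc l) d" for t q
    using that by (rule eval_cong_formulas) (use assms(2) less_Suc_eq_le in blast)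
  then show ?thesis using assms(1) unfolding solv_def systems_iff by (simp add: subset_iff)
qed

lemma solvable_map: "S \<in> systems l d \<Longrightarrow> solvable A S (map v [0..<l]) \<longleftrightarrow> solv A l S v"
  unfolding solvable_def by (rule solv_cong) (auto simp: nth_append)

lemma Th_map: "Th A n (map v [0..<l]) = Th A n (map w [0..<l]) \<longleftrightarrow> sim l n A v A w"
proof -
  have "eval A (nth (map v [0..<l])) t = eval A v t" if "t \<in> ipc_formulas l n" for v t
    using that by (rule eval_cong_formulas) simp
  then have "Th A n (map v [0..<l]) = {t \<in> ipc_formulas l n. eval A v t = one A}" for v
    unfolding Th_def by auto
  then show ?thesis unfolding sim_def by blast
qed

text \<open>Assignments replace tuples, and as \<open>sim\<close> is symmetric, one implication
  between the solvabilities suffices, just as in \<open>FC\<close>.\<close>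

lemma index_bound_iff:
  assumes A: "heyting_algebra A"
  shows "index_bound l d A n \<longleftrightarrow> (\<forall>v w. range v \<subseteq> carrier A \<longrightarrow> range w \<subseteq> carrier A \<longrightarrow>
    sim l n A v A w \<longrightarrow> (\<forall>S\<in>systems l d. solv A l S v \<longrightarrow> solv A l S w))"
    (is "_ \<longleftrightarrow> ?R")
proof
  assume ib: "index_bound l d A n"
  show ?R
  proof (intro allI impI ballI)
    fix v w S assume v: "range v \<subseteq> carrier A" "range w \<subseteq> carrier A"
      and s: "sim l n A v A w" and S: "S \<in> systems l d" and sv: "solv A l S v"
    have "map v [0..<l] \<in> tuples A l" "map w [0..<l] \<in> tuples A l" using v by (auto simp: tuples_def)
    moreover have "Th A n (map v [0..<l]) = Th A n (map w [0..<l])" using s by (simp add: Th_map)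
    ultimately have "solvable A S (map v [0..<l]) \<longleftrightarrow> solvable A S (map w [0..<l])"
      using ib S unfolding index_bound_def by blast
    then show "solv A l S w" using sv solvable_map[OF S] by blast
  qed
next
  interpret heyting A by (rule heytingI[OF A])
  assume R: ?R
  show "index_bound l d A n"
    unfolding index_bound_def
  proof (intro ballI impI)
    fix as as' S assume as: "as \<in> tuples A l" "as' \<in> tuples A l" and th: "Th A n as = Th A n as'"
      and S: "S \<in> systems l d"
    define v where "v i = (if i < l then as ! i else zero A)" for i
    define w where "w i = (if i < l then as' ! i else zero A)" for i
    have vw: "range v \<subseteq> carrier A" "range w \<subseteq> carrier A"
      using as by (auto simp: v_def w_def tuples_def subset_iff)
    have m: "as = map v [0..<l]" "as' = map w [0..<l]"
      using as by (auto simp: v_def w_def tuples_def intro!: nth_equalityI)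
    have s: "sim l n A v A w" using th unfolding m Th_map .
    show "solvable A S as \<longleftrightarrow> solvable A S as'"
      unfolding m solvable_map[OF S]
      using R[rule_format, OF vw s S] R[rule_format, OF vw(2,1) sim_sym[OF s] S] by blast
  qed
qed

lemma index_finite_iff: "index l d A < \<infinity> \<longleftrightarrow> (\<exists>n. index_bound l d A n)"
  by (simp add: index_def)

lemma index_bound_index: "index l d A < \<infinity> \<Longrightarrow> index_bound l d A (the_enat (index l d A))"
  by (auto simp: index_def intro: LeastI split: if_splits)

lemma index_cong:
  assumes "\<And>n. index_bound l d A n \<longleftrightarrow> index_bound l d B n"
  shows "index l d A = index l d B"
proof -
  have "index_bound l d A = index_bound l d B" using assms by (intro ext)
  then show ?thesis by (simp add: index_def)
qed

lemma forth_index_bound: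
  assumes A: "heyting_algebra A" and f: "forth A A"
  shows "\<exists>n. index_bound l d A n"
proof -
  obtain n where n: "\<forall>v w. range v \<subseteq> carrier A \<longrightarrow> range w \<subseteq> carrier A \<longrightarrow> sim l n A v A w \<longrightarrow>
    (\<forall>b\<in>carrier A. \<exists>a\<in>carrier A. sim (Suc l) d A (v(l := a)) A (w(l := b)))"
    using f[unfolded forth_def, THEN spec[of _ l], THEN spec[of _ d]] by (rule exE)
  have "index_bound l d A n"
    unfolding index_bound_iff[OF A]
  proof (intro allI impI ballI)
    fix v w S assume v: "range v \<subseteq> carrier A" "range w \<subseteq> carrier A"
      and s: "sim l n A v A w" and S: "S \<in> systems l d" and sv: "solv A l S v"
    obtain q where q: "q \<in> carrier A" "eval A (v(l := q)) (fst S) = one A"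
      "\<forall>s\<in>set (snd S). eval A (v(l := q)) s \<noteq> one A" using sv unfolding solv_def by blast
    obtain a where a: "a \<in> carrier A" "sim (Suc l) d A (w(l := a)) A (v(l := q))"
      using n[rule_format, OF v(2,1) sim_sym[OF s] q(1)] by blast
    have "eval A (w(l := a)) t = one A \<longleftrightarrow> eval A (v(l := q)) t = one A"
      if "t \<in> ipc_formulas (Suc l) d" for t
      using a(2) that unfolding sim_def by blast
    then show "solv A l S w" using q a(1) S unfolding solv_def systems_iff by blast
  qed
  then show ?thesis by blast
qed

text \<open>By finiteness of the representatives the whole type of \<open>b\<close> over
  \<open>w\<close> is one system; its solution over \<open>v\<close> realises the same type.\<close>

lemma index_bound_forth:
  assumes A: "heyting_algebra A" and ib: "\<And>l d. \<exists>n. index_bound l d A n"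
  shows "forth A A"
  unfolding forth_def
proof (intro allI)
  fix l d
  obtain n where n: "index_bound l d A n" using ib by blast
  show "\<exists>n. \<forall>v w. range v \<subseteq> carrier A \<longrightarrow> range w \<subseteq> carrier A \<longrightarrow> sim l n A v A w \<longrightarrow>
    (\<forall>b\<in>carrier A. \<exists>a\<in>carrier A. sim (Suc l) d A (v(l := a)) A (w(l := b)))"
  proof (intro exI[of _ n] allI impI ballI)
    fix v w b assume v: "range v \<subseteq> carrier A" "range w \<subseteq> carrier A"
      and s: "sim l n A v A w" and b: "b \<in> carrier A"
    interpret heyting A by (rule heytingI[OF A])
    let ?T = "\<lambda>t. eval A (w(l := b)) t = one A" and ?R = "ipc_reps (Suc l) d"
    define S where "S = (big_and (filter ?T ?R), filter (\<lambda>t. \<not> ?T t) ?R)"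
    have S: "S \<in> systems l d"
      using ipc_reps(1)[of "Suc l" d] unfolding systems_iff by (auto simp: S_def big_formulas)
    have r: "range (v(l := a)) \<subseteq> carrier A" "range (w(l := a)) \<subseteq> carrier A" if "a \<in> carrier A" for a
      using v that by auto
    have "solv A l S w"
      unfolding solv_def using b eval_big_and_eq_one[OF r(2)[OF b]]
      by (intro bexI[of _ b]) (simp_all add: S_def)
    then have "solv A l S v"
      using n[unfolded index_bound_iff[OF A], rule_format, OF v(2,1) sim_sym[OF s] S] by blast
    then obtain a where a: "a \<in> carrier A" "eval A (v(l := a)) (fst S) = one A"
      "\<forall>s\<in>set (snd S). eval A (v(l := a)) s \<noteq> one A" unfolding solv_def by blast
    have "sim (Suc l) d A (v(l := a)) A (w(l := b))"
    proof (rule sim_reps[OF A r(1)[OF a(1)] A r(2)[OF b]])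
      fix t assume t: "t \<in> set ?R"
      show "eval A (v(l := a)) t = one A \<longleftrightarrow> ?T t"
        using a(2,3) t eval_big_and_eq_one[OF r(1)[OF a(1)]] by (auto simp: S_def)
    qed
    then show "\<exists>a\<in>carrier A. sim (Suc l) d A (v(l := a)) A (w(l := b))" using a(1) by blast
  qed
qed

theorem ex_closed_QE:
  assumes "ex_closed A"
  shows "QE_property A"
  unfolding QE_property_def index_finite_iff
  using forth_index_bound ex_closed_forth ex_closed_heyting assms by metis


section \<open>Density, Splitting and QE imply existential closedness\<close>

lemma existential_prenex:
  "existential p \<Longrightarrow> \<exists>xs q. p = foldr Ex xs q \<and> quantifier_free q"
proof (induction rule: existential.induct)
  case (1 p)
  then show ?case by (intro exI[of _ "[]"] exI[of _ p]) simp
next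
  case (2 p x)
  then obtain xs q where "p = foldr Ex xs q" "quantifier_free q" by blast
  then show ?case by (intro exI[of _ "x # xs"] exI[of _ q]) simp
qed

lemma sat_foldr_Ex:
  "sat A v (foldr Ex xs q) \<longleftrightarrow>
    (\<exists>u. (\<forall>i. i \<notin> set xs \<longrightarrow> u i = v i) \<and> (\<forall>i\<in>set xs. u i \<in> carrier A) \<and> sat A u q)"
proof (induction xs arbitrary: v)
  case Nil
  have "u = v" if "\<forall>i. u i = v i" for u using that by blast
  then show ?case by auto
next
  case (Cons x xs)
  show ?case (is "?L \<longleftrightarrow> ?R")
  proof
    assume ?L
    then obtain a u where "a \<in> carrier A" "\<forall>i. i \<notin> set xs \<longrightarrow> u i = (v(x := a)) i"
      "\<forall>i\<in>set xs. u i \<in> carrier A" "sat A u q" using Cons.IH by auto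
    then show ?R by (intro exI[of _ u]) (auto split: if_splits)
  next
    assume ?R
    then obtain u where u: "\<forall>i. i \<notin> set (x # xs) \<longrightarrow> u i = v i" "\<forall>i\<in>set (x # xs). u i \<in> carrier A" "sat A u q"
      by blast
    have "sat A (v(x := u x)) (foldr Ex xs q)"
      unfolding Cons.IH by (rule exI[of _ u]) (use u in auto)
    then show ?L using u(2) by auto
  qed
qed

lemma fm_vars_foldr_Ex: "fm_vars (foldr Ex xs q) = set xs \<union> fm_vars q"
  by (induction xs) auto

lemma partial_embeddingD:
  assumes "partial_embedding \<rho> K E H"
  shows "inj_on \<rho> E" "\<rho> (one K) = one H" "\<rho> (zero K) = zero H"
  using assms by (simp_all add: partial_embedding_def)

lemma embeddingD:
  assumes "embedding e A B"
  shows "inj_on e (carrier A)" "e (one A) = one B" "e (zero A) = zero B" "e ` carrier A \<subseteq> carrier B"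
  using assms by (simp_all add: embedding_def)

lemma partial_embedding_sat:
  assumes p: "partial_embedding \<rho> K E H" and E: "eval K u ` ipc_formulas l n \<subseteq> E"
    and w: "\<And>i. i < l \<Longrightarrow> w i = \<rho> (u i)"
    and q: "quantifier_free q" "fm_vars q \<subseteq> {..<l}" "fm_degree q \<le> n"
  shows "sat H w q \<longleftrightarrow> sat K u q"
  using q
proof (induction q)
  case (Eq s t)
  then have st: "s \<in> ipc_formulas l n" "t \<in> ipc_formulas l n" by (auto simp: ipc_formulas_def)
  have "eval K u s \<in> E" "eval K u t \<in> E" using E st by auto
  then have "\<rho> (eval K u s) = \<rho> (eval K u t) \<longleftrightarrow> eval K u s = eval K u t"
    using inj_on_eq_iff[OF partial_embeddingD(1)[OF p]] by simp
  then show ?case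
    using partial_embedding_eval[OF p E w st(1)] partial_embedding_eval[OF p E w st(2)] by simp
qed auto

lemma embedding_nontrivial:
  assumes "heyting_algebra A" "embedding e A B"
  shows "nontrivial B \<longleftrightarrow> nontrivial A"
proof -
  interpret heyting A by (rule heytingI[OF assms(1)])
  show ?thesis
    using inj_on_eq_iff[OF embeddingD(1)[OF assms(2)] zero_closed one_closed] embeddingD(2,3)[OF assms(2)]
    unfolding nontrivial_def by simp
qed

theorem density_splitting_forth_ex_closed:
  fixes H :: "'a hstruct"
  assumes H: "heyting_algebra H" "density H" "splitting H" and f: "forth H H"
  shows "ex_closed H"
  unfolding ex_closed_def
proof (intro conjI H(1) allI impI, elim conjE)
  fix K :: "('a + nat) hstruct" and e p and v :: "nat \<Rightarrow> 'a"
  assume K: "heyting_algebra K" and e: "embedding e H K" and p: "existential p"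
    and v: "range v \<subseteq> carrier H" and sp: "sat K (e \<circ> v) p"
  interpret H: heyting H by (rule heytingI[OF H(1)])
  interpret K: heyting K by (rule heytingI[OF K])
  obtain xs q where q: "p = foldr Ex xs q" "quantifier_free q" using existential_prenex[OF p] by blast
  obtain l where l: "fm_vars p \<subseteq> {..<l}" by (rule fm_vars_bound)
  obtain m where m: "agree H H l m p" using sat_back_and_forth[OF H(1) H(1) f f l] by blast
  \<comment> \<open>Large enough for \<open>H\<close> to decide \<open>p\<close> and to carry every
    term of \<open>q\<close>.\<close>
  define n where "n = max m (fm_degree q)"
  obtain u where u: "\<forall>i. i \<notin> set xs \<longrightarrow> u i = (e \<circ> v) i" "\<forall>i\<in>set xs. u i \<in> carrier K" "sat K u q"
    using sp unfolding q sat_foldr_Ex by blast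
  have ev: "range (e \<circ> v) \<subseteq> carrier K" using e v unfolding embedding_def by auto
  have ru: "range u \<subseteq> carrier K"
  proof
    fix y assume "y \<in> range u"
    then obtain i where "y = u i" by blast
    then show "y \<in> carrier K" using u(1,2) ev by (cases "i \<in> set xs") auto
  qed
  define E where "E = eval K (e \<circ> v) ` ipc_formulas l n \<union> eval K u ` ipc_formulas l n"
  have E: "finite E" "E \<subseteq> carrier K" "zero K \<in> E" "one K \<in> E"
  proof -
    show "finite E" unfolding E_def using finite_eval_formulas[OF K] ev ru by blast
    show "E \<subseteq> carrier K" unfolding E_def using K.eval_closed[OF ev] K.eval_closed[OF ru] by blast
    show "zero K \<in> E" unfolding E_def using image_eqI[of "zero K" "eval K u" Bot "ipc_formulas l n"] by simp
    show "one K \<in> E" unfolding E_def using image_eqI[of "one K" "eval K u" Top "ipc_formulas l n"] by simp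
  qed
  obtain \<rho> where \<rho>: "partial_embedding \<rho> K E H"
    using partial_embedding_exists[OF H K embedding_nontrivial[OF H(1) e] E] .
  have sub: "eval K (e \<circ> v) ` ipc_formulas l n \<subseteq> E" "eval K u ` ipc_formulas l n \<subseteq> E"
    by (simp_all add: E_def)
  have var: "(e \<circ> v) i \<in> E \<and> u i \<in> E" if "i < l" for i
    using sub that image_eqI[of _ "eval K u" "Var i" "ipc_formulas l n"]
      image_eqI[of _ "eval K (e \<circ> v)" "Var i" "ipc_formulas l n"] by auto
  have \<rho>E: "\<rho> x \<in> carrier H" if "x \<in> E" for x using \<rho> that unfolding partial_embedding_def by blast
  \<comment> \<open>In general \<open>w\<close> differs from \<open>v\<close>, since \<rho> does not
    invert \<open>e\<close>; hence the detour through \<open>agree\<close>.\<close>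
  define w where "w i = (if i < l then \<rho> ((e \<circ> v) i) else one H)" for i
  define w' where "w' i = (if i < l then \<rho> (u i) else one H)" for i
  have rw: "range w \<subseteq> carrier H" "range w' \<subseteq> carrier H"
    unfolding w_def w'_def using var \<rho>E by auto
  have "sat H w' q"
    using partial_embedding_sat[OF \<rho> sub(2), of w' q] u(3) q l
    by (simp add: w'_def n_def fm_vars_foldr_Ex)
  then have "sat H w p"
    unfolding q sat_foldr_Ex using u(1) rw(2) by (intro exI[of _ w']) (auto simp: w_def w'_def)
  moreover have "sim l n H v H w"
    unfolding sim_def
  proof
    fix t assume t: "t \<in> ipc_formulas l n"
    have inE: "eval K (e \<circ> v) t \<in> E" using sub t by blast
    have "eval H w t = \<rho> (eval K (e \<circ> v) t)"
      by (rule partial_embedding_eval[OF \<rho> sub(1) _ t]) (simp add: w_def)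
    then have "eval H w t = one H \<longleftrightarrow> eval K (e \<circ> v) t = one K"
      using inj_on_eq_iff[OF partial_embeddingD(1)[OF \<rho>] inE E(4)] partial_embeddingD(2)[OF \<rho>] by simp
    also have "\<dots> \<longleftrightarrow> eval H v t = one H"
      unfolding eval_embedding[OF H(1) e v]
      using inj_on_eq_iff[OF embeddingD(1)[OF e] H.eval_closed[OF v] H.one_closed, of t]
        embeddingD(2)[OF e] by simp
    finally show "eval H v t = one H \<longleftrightarrow> eval H w t = one H" by simp
  qed
  ultimately show "sat H v p"
    using agreeD[OF m v rw(1)] sim_mono[of l n H v H w l m] by (simp add: n_def)
qed

theorem ex_closed_iff:
  assumes "heyting_algebra H"
  shows "ex_closed H \<longleftrightarrow> density H \<and> splitting H \<and> QE_property H"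
proof
  assume "density H \<and> splitting H \<and> QE_property H"
  then show "ex_closed H"
    using density_splitting_forth_ex_closed[OF assms] index_bound_forth[OF assms]
    unfolding QE_property_def index_finite_iff by blast
qed (simp add: ex_closed_density ex_closed_splitting ex_closed_QE)


section \<open>The axioms FC\<close>

lemma sat_alls:
  "sat A v (alls n p) \<longleftrightarrow> (\<forall>u. (\<forall>i<n. u i \<in> carrier A) \<longrightarrow> (\<forall>i\<ge>n. u i = v i) \<longrightarrow> sat A u p)"
proof (induction n arbitrary: p)
  case 0
  have "u = v" if "\<forall>i. u i = v i" for u using that by blast
  then show ?case by (auto simp: alls_0)
next
  case (Suc n)
  show ?case
    unfolding alls_Suc Suc.IH
  proof (intro iffI allI impI)
    fix u assume *: "\<forall>u. (\<forall>i<n. u i \<in> carrier A) \<longrightarrow> (\<forall>i\<ge>n. u i = v i) \<longrightarrow> sat A u (All n p)"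
      and u: "\<forall>i<Suc n. u i \<in> carrier A" "\<forall>i\<ge>Suc n. u i = v i"
    have "sat A (u(n := v n)) (All n p)"
      by (rule *[rule_format]) (use u in \<open>auto simp: Suc_le_eq\<close>)
    then have "\<forall>a\<in>carrier A. sat A (u(n := a)) p" by simp
    from bspec[OF this, of "u n"] show "sat A u p" using u(1) by simp
  next
    fix u assume *: "\<forall>u. (\<forall>i<Suc n. u i \<in> carrier A) \<longrightarrow> (\<forall>i\<ge>Suc n. u i = v i) \<longrightarrow> sat A u p"
      and u: "\<forall>i<n. u i \<in> carrier A" "\<forall>i\<ge>n. u i = v i"
    have "sat A (u(n := a)) p" if "a \<in> carrier A" for a
      by (rule *[rule_format]) (use u that in \<open>auto simp: less_Suc_eq\<close>)
    then show "sat A u (All n p)" by simp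
  qed
qed

lemma system_reps_subset: "set (system_reps l d) \<subseteq> systems l d"
proof
  let ?R = "ipc_reps (Suc l) d"
  fix S assume "S \<in> set (system_reps l d)"
  then have S: "fst S \<in> set ?R" "snd S \<in> set (subseqs ?R)" by (auto simp: system_reps_def)
  then have "set (snd S) \<subseteq> set ?R" using subseqs_powset[of ?R] by blast
  then show "S \<in> systems l d" unfolding systems_iff using S(1) ipc_reps(1)[of "Suc l" d] by blast
qed

text \<open>Solvability depends only on the set of negated formulas and on formulas up to
  equivalence, and \<open>subseqs\<close> lists every subset of the representatives.\<close>

lemma system_reps:
  fixes A :: "'a hstruct"
  assumes A: "heyting_algebra A" and "S \<in> systems l d"
  shows "\<exists>S'\<in>set (system_reps l d). \<forall>v. range v \<subseteq> carrier A \<longrightarrow>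
      (solv A l S' v \<longleftrightarrow> solv A l S v)"
proof -
  let ?R = "ipc_reps (Suc l) d"
  have S: "fst S \<in> ipc_formulas (Suc l) d" "set (snd S) \<subseteq> ipc_formulas (Suc l) d"
    using assms(2) by (simp_all add: systems_iff)
  define r where "r s = (SOME t. t \<in> set ?R \<and> ipc_equiv s t)" for s
  have r: "r s \<in> set ?R \<and> ipc_equiv s (r s)" if "s \<in> ipc_formulas (Suc l) d" for s
    unfolding r_def by (rule someI_ex) (use ipc_reps(2)[OF that] in blast)
  have "r ` set (snd S) \<in> Pow (set ?R)" using r S(2) by blast
  then obtain ss where ss: "ss \<in> set (subseqs ?R)" "set ss = r ` set (snd S)"
    unfolding subseqs_powset[symmetric] by blast
  show "\<exists>S'\<in>set (system_reps l d). \<forall>v. range v \<subseteq> carrier A \<longrightarrow> (solv A l S' v \<longleftrightarrow> solv A l S v)"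
  proof (intro bexI[of _ "(r (fst S), ss)"] allI impI)
    show "(r (fst S), ss) \<in> set (system_reps l d)"
      unfolding system_reps_def using ss(1) r[OF S(1)] by simp
    fix v :: "nat \<Rightarrow> 'a" assume v: "range v \<subseteq> carrier A"
    have "eval A (v(l := q)) (r s) = eval A (v(l := q)) s"
      if "q \<in> carrier A" "s \<in> ipc_formulas (Suc l) d" for q s
    proof -
      have "range (v(l := q)) \<subseteq> carrier A" using v that(1) by auto
      then show ?thesis using ipc_equiv_any_type[OF conjunct2[OF r[OF that(2)]] A] by simp
    qed
    then show "solv A l (r (fst S), ss) v \<longleftrightarrow> solv A l S v"
      using S unfolding solv_def ss(2) fst_conv snd_conv by (simp add: subset_iff cong: bex_cong)
  qed
qed

lemma sat_FC:
  assumes A: "heyting_algebra A" and v: "range v \<subseteq> carrier A"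
  shows "sat A v (FC l d n) \<longleftrightarrow> index_bound l d A n"
proof -
  let ?r = "\<lambda>i. if i < l then i else 2 * l" and ?r' = "\<lambda>i. l + i"
  define Hyp where "Hyp u \<longleftrightarrow> (\<forall>t\<in>set (ipc_reps l n). eval A u t = one A \<longleftrightarrow> eval A (\<lambda>i. u (l + i)) t = one A)" for u
  have sys: "sat A u (Ex (2 * l) (system_fm ?r S)) \<longleftrightarrow> solv A l S u"
    "sat A u (Ex (2 * l) (system_fm ?r' S)) \<longleftrightarrow> solv A l S (\<lambda>i. u (l + i))" if S: "S \<in> systems l d" for u S
  proof -
    have "sat A u (Ex (2 * l) (system_fm r S)) \<longleftrightarrow> (\<exists>q\<in>carrier A. eval A (u(2 * l := q) \<circ> r) (fst S) = one A \<and>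
      (\<forall>s\<in>set (snd S). eval A (u(2 * l := q) \<circ> r) s \<noteq> one A))" for r
      by (simp add: system_fm_def eval_map_ipc)
    note e = this
    show "sat A u (Ex (2 * l) (system_fm ?r S)) \<longleftrightarrow> solv A l S u"
      unfolding e by (rule solv_cong[OF S]) auto
    show "sat A u (Ex (2 * l) (system_fm ?r' S)) \<longleftrightarrow> solv A l S (\<lambda>i. u (l + i))"
      unfolding e by (rule solv_cong[OF S]) auto
  qed
  have hyp: "sat A u (conjs (map (\<lambda>t. Iff (Eq (map_ipc ?r t) Top) (Eq (map_ipc ?r' t) Top)) (ipc_reps l n))) \<longleftrightarrow> Hyp u" for u
  proof -
    have "eval A u (map_ipc ?r t) = eval A u t" "eval A u (map_ipc ?r' t) = eval A (\<lambda>i. u (l + i)) t"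
      if "t \<in> set (ipc_reps l n)" for t
    proof -
      have t: "t \<in> ipc_formulas l n" using that ipc_reps(1) by blast
      show "eval A u (map_ipc ?r t) = eval A u t"
        unfolding eval_map_ipc by (rule eval_cong_formulas[OF t]) simp
      show "eval A u (map_ipc ?r' t) = eval A (\<lambda>i. u (l + i)) t"
        unfolding eval_map_ipc by (rule eval_cong_formulas[OF t]) simp
    qed
    then show ?thesis unfolding Hyp_def by auto
  qed
  have "sat A v (FC l d n) \<longleftrightarrow> (\<forall>S\<in>set (system_reps l d). \<forall>u. (\<forall>i<2 * l. u i \<in> carrier A) \<longrightarrow>
      (\<forall>i\<ge>2 * l. u i = v i) \<longrightarrow> Hyp u \<longrightarrow> solv A l S (\<lambda>i. u (l + i)) \<longrightarrow> solv A l S u)"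
  proof -
    have "sat A v (FC l d n) \<longleftrightarrow> (\<forall>S\<in>set (system_reps l d). sat A v (alls (2 * l) (Impl (Conj
      (conjs (map (\<lambda>t. Iff (Eq (map_ipc ?r t) Top) (Eq (map_ipc ?r' t) Top)) (ipc_reps l n)))
      (Ex (2 * l) (system_fm ?r' S))) (Ex (2 * l) (system_fm ?r S)))))"
      unfolding FC_def Let_def by (simp only: sat_conjs set_map ball_simps)
    also have "\<dots> \<longleftrightarrow> (\<forall>S\<in>set (system_reps l d). \<forall>u. (\<forall>i<2 * l. u i \<in> carrier A) \<longrightarrow>
      (\<forall>i\<ge>2 * l. u i = v i) \<longrightarrow> Hyp u \<longrightarrow> sat A u (Ex (2 * l) (system_fm ?r' S)) \<longrightarrow>
      sat A u (Ex (2 * l) (system_fm ?r S)))"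
      unfolding sat_alls sat.simps(3,5) hyp imp_conjL by (rule refl)
    also have "\<dots> \<longleftrightarrow> (\<forall>S\<in>set (system_reps l d). \<forall>u. (\<forall>i<2 * l. u i \<in> carrier A) \<longrightarrow>
      (\<forall>i\<ge>2 * l. u i = v i) \<longrightarrow> Hyp u \<longrightarrow> solv A l S (\<lambda>i. u (l + i)) \<longrightarrow> solv A l S u)"
    proof (rule ball_cong[OF refl])
      fix S assume "S \<in> set (system_reps l d)"
      then have S: "S \<in> systems l d" using system_reps_subset by blast
      show "(\<forall>u. (\<forall>i<2 * l. u i \<in> carrier A) \<longrightarrow> (\<forall>i\<ge>2 * l. u i = v i) \<longrightarrow> Hyp u \<longrightarrow>
          sat A u (Ex (2 * l) (system_fm ?r' S)) \<longrightarrow> sat A u (Ex (2 * l) (system_fm ?r S))) \<longleftrightarrow>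
        (\<forall>u. (\<forall>i<2 * l. u i \<in> carrier A) \<longrightarrow> (\<forall>i\<ge>2 * l. u i = v i) \<longrightarrow> Hyp u \<longrightarrow>
          solv A l S (\<lambda>i. u (l + i)) \<longrightarrow> solv A l S u)"
        unfolding sys(1)[OF S] sys(2)[OF S] by (rule refl)
    qed
    finally show ?thesis .
  qed
  also have "\<dots> \<longleftrightarrow> index_bound l d A n"
    unfolding index_bound_iff[OF A]
  proof (intro iffI allI impI ballI)
    fix w1 w2 S
    assume *: "\<forall>S\<in>set (system_reps l d). \<forall>u. (\<forall>i<2 * l. u i \<in> carrier A) \<longrightarrow>
      (\<forall>i\<ge>2 * l. u i = v i) \<longrightarrow> Hyp u \<longrightarrow> solv A l S (\<lambda>i. u (l + i)) \<longrightarrow> solv A l S u"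
      and w: "range w1 \<subseteq> carrier A" "range w2 \<subseteq> carrier A" and s: "sim l n A w1 A w2"
      and S: "S \<in> systems l d" and so: "solv A l S w1"
    obtain S' where S': "S' \<in> set (system_reps l d)"
      "\<And>v. range v \<subseteq> carrier A \<Longrightarrow> solv A l S' v \<longleftrightarrow> solv A l S v"
      using system_reps[OF A S] by blast
    have S'': "S' \<in> systems l d" using S'(1) system_reps_subset by blast
    \<comment> \<open>In \<open>FC\<close> the first block is the tuple for which a solution is
      wanted and the second the one for which it is given, so \<open>w2\<close> precedes
      \<open>w1\<close>.\<close>
    define u where "u i = (if i < l then w2 i else if i < 2 * l then w1 (i - l) else v i)" for i
    have u2: "eval A u t = eval A w2 t" "eval A (\<lambda>i. u (l + i)) t = eval A w1 t"
      if "t \<in> ipc_formulas l n" for t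
      by (rule eval_cong_formulas[OF that], simp add: u_def)+
    have "Hyp u"
      unfolding Hyp_def
    proof
      fix t assume "t \<in> set (ipc_reps l n)"
      then have t: "t \<in> ipc_formulas l n" using ipc_reps(1) by blast
      show "eval A u t = one A \<longleftrightarrow> eval A (\<lambda>i. u (l + i)) t = one A"
        unfolding u2[OF t] using s[unfolded sim_def, rule_format, OF t] by simp
    qed
    moreover have "u i \<in> carrier A" if "i < 2 * l" for i using w that by (auto simp: u_def)
    moreover have "u i = v i" if "i \<ge> 2 * l" for i using that by (auto simp: u_def)
    ultimately have "solv A l S' (\<lambda>i. u (l + i)) \<longrightarrow> solv A l S' u"
      using *[rule_format, OF S'(1), of u] by blast
    moreover have "solv A l S' (\<lambda>i. u (l + i)) \<longleftrightarrow> solv A l S' w1"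
      unfolding solv_def[of A l S' "\<lambda>i. u (l + i)"] by (rule solv_cong[OF S'']) (auto simp: u_def)
    moreover have "solv A l S' u \<longleftrightarrow> solv A l S' w2"
      unfolding solv_def[of A l S' u] by (rule solv_cong[OF S'']) (auto simp: u_def)
    ultimately have "solv A l S' w1 \<longrightarrow> solv A l S' w2" by blast
    then show "solv A l S w2" using so S'(2)[OF w(1)] S'(2)[OF w(2)] by blast
  next
    fix S u
    assume *: "\<forall>w1 w2. range w1 \<subseteq> carrier A \<longrightarrow> range w2 \<subseteq> carrier A \<longrightarrow> sim l n A w1 A w2 \<longrightarrow>
      (\<forall>S\<in>systems l d. solv A l S w1 \<longrightarrow> solv A l S w2)"
      and S: "S \<in> set (system_reps l d)" and u: "\<forall>i<2 * l. u i \<in> carrier A" "\<forall>i\<ge>2 * l. u i = v i"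
      and h: "Hyp u" and so: "solv A l S (\<lambda>i. u (l + i))"
    have ru: "u i \<in> carrier A" for i using u v by (cases "i < 2 * l") auto
    then have r: "range u \<subseteq> carrier A" "range (\<lambda>i. u (l + i)) \<subseteq> carrier A" by auto
    have "sim l n A (\<lambda>i. u (l + i)) A u"
      by (rule sim_reps[OF A r(2) A r(1)]) (use h in \<open>auto simp: Hyp_def\<close>)
    from *[rule_format, OF r(2,1) this _ so] show "solv A l S u"
      using S system_reps_subset by blast
  qed
  finally show ?thesis .
qed

lemma models_FC:
  assumes "heyting_algebra A"
  shows "models A {FC l d n} \<longleftrightarrow> index_bound l d A n"
proof -
  have "fo_structure A" using assms by (simp add: heyting_algebra_def)
  then have "range (\<lambda>_ :: nat. zero A) \<subseteq> carrier A" by (auto simp: fo_structure_def closed_under_ops_def)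
  then show ?thesis using sat_FC[OF assms] \<open>fo_structure A\<close> unfolding models_def by blast
qed

section \<open>Elementary equivalence of non-trivial existentially closed algebras\<close>

lemma (in heyting) boolean_ops:
  "join A (zero A) (zero A) = zero A" "join A (zero A) (one A) = one A"
  "join A (one A) (zero A) = one A" "join A (one A) (one A) = one A"
  "meet A (zero A) (zero A) = zero A" "meet A (zero A) (one A) = zero A"
  "meet A (one A) (zero A) = zero A" "meet A (one A) (one A) = one A"
  "imp A (zero A) (zero A) = one A" "imp A (zero A) (one A) = one A"
  "imp A (one A) (zero A) = zero A" "imp A (one A) (one A) = one A"
proof -
  have z: "imp A (one A) (zero A) \<notin> F" if F: "F \<in> prime_filters A" for F
    using imp_in_prime[OF F one_closed zero_closed] F one_in_prime[OF F] zero_notin_prime[OF F] by blast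
  show "imp A (one A) (zero A) = zero A" by (subst eq_iff_prime) (use z in auto)
  show "imp A (zero A) (zero A) = one A" "imp A (zero A) (one A) = one A" "imp A (one A) (one A) = one A"
    by (simp_all add: imp_eq_one zero_le le_refl)
qed (simp_all add: eq_iff_prime)

text \<open>With \<open>one\<close> for every variable, a term takes the same value,
  \<open>zero\<close> or \<open>one\<close>, in both algebras.\<close>

lemma sim_constants:
  assumes A: "heyting_algebra A" "nontrivial A" and B: "heyting_algebra B" "nontrivial B"
  shows "sim l n A (\<lambda>_. one A) B (\<lambda>_. one B)"
proof -
  interpret A: heyting A by (rule heytingI[OF A(1)])
  interpret B: heyting B by (rule heytingI[OF B(1)])
  have "eval A (\<lambda>_. one A) t = one A \<and> eval B (\<lambda>_. one B) t = one B \<or>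
    eval A (\<lambda>_. one A) t = zero A \<and> eval B (\<lambda>_. one B) t = zero B" for t :: "nat ipc"
    by (induction t) (auto simp: A.boolean_ops B.boolean_ops)
  then show ?thesis using A(2) B(2) unfolding sim_def nontrivial_def by metis
qed

text \<open>The truth of a sentence does not depend on the assignment, so the back-and-forth
  argument may start at constant tuples, which see only the two-element subalgebra.\<close>

theorem ex_closed_elementarily_equivalent:
  assumes A: "ex_closed A" "nontrivial A" and B: "ex_closed B" "nontrivial B" and p: "sentence p"
    and v: "range v \<subseteq> carrier A" "range w \<subseteq> carrier B"
  shows "sat A v p \<longleftrightarrow> sat B w p"
proof -
  note HA = ex_closed_heyting[OF A(1)] and HB = ex_closed_heyting[OF B(1)]
  obtain l where l: "fm_vars p \<subseteq> {..<l}" by (rule fm_vars_bound)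
  obtain n where n: "agree A B l n p"
    using sat_back_and_forth[OF HA HB ex_closed_forth[OF A(1) HB] ex_closed_forth[OF B(1) HA] l] by blast
  have "sat A (\<lambda>_. one A) p \<longleftrightarrow> sat B (\<lambda>_. one B) p"
    by (rule agreeD[OF n _ _ sim_constants[OF HA A(2) HB B(2)]])
      (use heyting.one_closed[OF heytingI[OF HA]] heyting.one_closed[OF heytingI[OF HB]] in auto)
  moreover have "sat A v p \<longleftrightarrow> sat A (\<lambda>_. one A) p" "sat B w p \<longleftrightarrow> sat B (\<lambda>_. one B) p"
    by (rule sat_cong, use p in \<open>simp add: sentence_def\<close>)+
  ultimately show ?thesis by simp
qed

lemma free_vars_conjs: "free_vars (conjs ps) = (\<Union>p\<in>set ps. free_vars p)"
  by (induction ps) (auto simp: conjs_def)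

lemma free_vars_alls: "free_vars (alls n p) = free_vars p - {..<n}"
  by (induction n arbitrary: p) (auto simp: alls_0 alls_Suc less_Suc_eq)

lemma sentence_FC: "sentence (FC l d n)"
proof -
  let ?r = "\<lambda>i. if i < l then i else 2 * l" and ?r' = "\<lambda>i. l + i"
  have 1: "set_ipc (map_ipc ?r t) \<subseteq> {..<2 * l}" "set_ipc (map_ipc ?r' t) \<subseteq> {..<2 * l}"
    if "t \<in> set (ipc_reps l n)" for t
    using that ipc_reps(1)[of l n] by (fastforce simp: ipc.set_map ipc_formulas_def)+
  have 2: "set_ipc (map_ipc ?r t) \<subseteq> {..2 * l}" "set_ipc (map_ipc ?r' t) \<subseteq> {..2 * l}"
    if "t \<in> ipc_formulas (Suc l) d" for t
    using that by (fastforce simp: ipc.set_map ipc_formulas_def)+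
  have 3: "free_vars (Ex (2 * l) (system_fm ?r S)) \<subseteq> {..<2 * l}"
    "free_vars (Ex (2 * l) (system_fm ?r' S)) \<subseteq> {..<2 * l}" if S: "S \<in> systems l d" for S
  proof -
    have "free_vars (system_fm r S) \<subseteq> {..2 * l}"
      if "\<And>t. t \<in> ipc_formulas (Suc l) d \<Longrightarrow> set_ipc (map_ipc r t) \<subseteq> {..2 * l}" for r
    proof -
      have "free_vars (system_fm r S) =
          set_ipc (map_ipc r (fst S)) \<union> (\<Union>s\<in>set (snd S). set_ipc (map_ipc r s))"
        by (auto simp: system_fm_def free_vars_conjs)
      then show ?thesis using S[unfolded systems_iff] that by blast
    qed
    note this[OF 2(1)] this[OF 2(2)]
    then show "free_vars (Ex (2 * l) (system_fm ?r S)) \<subseteq> {..<2 * l}"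
      "free_vars (Ex (2 * l) (system_fm ?r' S)) \<subseteq> {..<2 * l}" by fastforce+
  qed
  have 4: "free_vars (conjs (map (\<lambda>t. Iff (Eq (map_ipc ?r t) Top) (Eq (map_ipc ?r' t) Top)) (ipc_reps l n))) \<subseteq> {..<2 * l}"
    using 1 by (simp add: free_vars_conjs UN_subset_iff)
  have sys: "S \<in> systems l d" if "S \<in> set (system_reps l d)" for S
    using system_reps_subset that by blast
  show ?thesis
    unfolding sentence_def FC_def Let_def free_vars_conjs free_vars_alls set_map
    using 3[OF sys] 4 by (simp add: free_vars_alls del: free_vars.simps(7)) blast
qed

text \<open>A bound on the index is expressed by the sentence \<open>FC\<close>, whose truth value
  is the same in both algebras.\<close>

theorem ex_closed_index_eq:
  assumes A: "ex_closed A" "nontrivial A" and B: "ex_closed B" "nontrivial B"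
  shows "index l d A = index l d B"
proof (rule index_cong)
  fix n
  note HA = ex_closed_heyting[OF A(1)] and HB = ex_closed_heyting[OF B(1)]
  have v: "range (\<lambda>_ :: nat. one A) \<subseteq> carrier A" "range (\<lambda>_ :: nat. one B) \<subseteq> carrier B"
    using heyting.one_closed[OF heytingI[OF HA]] heyting.one_closed[OF heytingI[OF HB]] by auto
  show "index_bound l d A n \<longleftrightarrow> index_bound l d B n"
    using ex_closed_elementarily_equivalent[OF A B sentence_FC v] sat_FC[OF HA v(1)] sat_FC[OF HB v(2)]
    by simp
qed


section \<open>Subalgebras and isomorphic copies\<close>

lemma restr_simps [simp]:
  "carrier (restr A X) = X" "zero (restr A X) = zero A" "one (restr A X) = one A"
  "join (restr A X) = join A" "meet (restr A X) = meet A" "imp (restr A X) = imp A"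
  by (simp_all add: restr_def)

lemma closed_under_ops_restr [simp]: "closed_under_ops (restr A Y) X \<longleftrightarrow> closed_under_ops A X"
  by (simp add: closed_under_ops_def)

lemma restr_restr [simp]: "restr (restr A Y) X = restr A X"
  by (simp add: restr_def)

lemma subalgebra_restr: "subalgebra (restr A Y) X \<longleftrightarrow> X \<subseteq> Y \<and> closed_under_ops A X"
  by (simp add: subalgebra_def)

lemma le_restr: "le (restr A X) = le A"
  by (simp add: le_def fun_eq_iff)

lemma heyting_restr:
  assumes A: "heyting_algebra A" and X: "subalgebra A X"
  shows "heyting_algebra (restr A X)"
proof -
  interpret heyting A by (rule heytingI[OF A])
  have c: "x \<in> carrier A" if "x \<in> X" for x using X that by (auto simp: subalgebra_def)
  show ?thesis
  proof (rule heyting_algebraI)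
    show "fo_structure (restr A X)" using X by (simp add: fo_structure_def subalgebra_def)
    fix x y assume "x \<in> carrier (restr A X)" "y \<in> carrier (restr A X)"
    then show "join (restr A X) x y = join (restr A X) y x" "meet (restr A X) x y = meet (restr A X) y x"
      using c join_commute meet_commute by simp_all
  qed (simp_all add: c meet_one join_zero join_absorb meet_absorb join_assoc meet_assoc le_imp_iff
      le_restr)
qed

lemma subalgebra_generated:
  assumes A: "fo_structure A" and X: "X \<subseteq> carrier A"
  shows "subalgebra A (generated A X)" "X \<subseteq> generated A X"
proof -
  have "subalgebra A (carrier A)" using A by (simp add: subalgebra_def fo_structure_def)
  then have "generated A X \<subseteq> carrier A" using X unfolding generated_def by blast
  moreover have "closed_under_ops A (generated A X)"
    unfolding closed_under_ops_def generated_def by (auto simp: subalgebra_def closed_under_ops_def)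
  ultimately show "subalgebra A (generated A X)" by (simp add: subalgebra_def)
  show "X \<subseteq> generated A X" unfolding generated_def by blast
qed

lemma generated_least: "subalgebra A Y \<Longrightarrow> X \<subseteq> Y \<Longrightarrow> generated A X \<subseteq> Y"
  unfolding generated_def by blast

lemma subalgebra_image:
  assumes A: "fo_structure A" and e: "embedding e A B"
  shows "subalgebra B (e ` carrier A)"
proof -
  have z: "zero A \<in> carrier A" "one A \<in> carrier A"
    and op: "\<And>x y. x \<in> carrier A \<Longrightarrow> y \<in> carrier A \<Longrightarrow>
      join A x y \<in> carrier A \<and> meet A x y \<in> carrier A \<and> imp A x y \<in> carrier A"
    using A by (simp_all add: fo_structure_def closed_under_ops_def)
  have eo: "join B (e x) (e y) = e (join A x y)" "meet B (e x) (e y) = e (meet A x y)"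
    "imp B (e x) (e y) = e (imp A x y)" if "x \<in> carrier A" "y \<in> carrier A" for x y
    using e that unfolding embedding_def by simp_all
  have "zero B \<in> e ` carrier A" "one B \<in> e ` carrier A" using e z unfolding embedding_def by (metis imageI)+
  moreover have "e ` carrier A \<subseteq> carrier B" using e unfolding embedding_def by blast
  ultimately show ?thesis
    using eo op unfolding subalgebra_def closed_under_ops_def by auto
qed

lemma embedding_comp:
  assumes "embedding f A B" "embedding g B C"
  shows "embedding (g \<circ> f) A C"
proof -
  have f: "f x \<in> carrier B" if "x \<in> carrier A" for x using assms(1) that unfolding embedding_def by blast
  have "inj_on g (f ` carrier A)" using assms unfolding embedding_def by (meson inj_on_subset)
  then show ?thesis
    using assms f unfolding embedding_def by (simp add: comp_inj_on image_subset_iff)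
qed

lemma embedding_restr:
  assumes "Y \<subseteq> carrier B"
  shows "embedding e A (restr B Y) \<longleftrightarrow> embedding e A B \<and> e ` carrier A \<subseteq> Y"
  using assms unfolding embedding_def by auto

lemma embedding_restr_domain: "embedding e A B \<Longrightarrow> X \<subseteq> carrier A \<Longrightarrow> embedding e (restr A X) B"
  unfolding embedding_def using inj_on_subset by (simp add: subset_iff image_subset_iff) blast

lemma embedding_inverse:
  assumes A: "fo_structure A" and e: "embedding e A B" and im: "e ` carrier A = carrier B"
  shows "embedding (the_inv_into (carrier A) e) B A"
proof -
  let ?i = "the_inv_into (carrier A) e"
  have inj: "inj_on e (carrier A)" using e by (simp add: embedding_def)
  have i: "?i (e x) = x" if "x \<in> carrier A" for x using the_inv_into_f_f[OF inj that] .
  have z: "zero A \<in> carrier A" "one A \<in> carrier A"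
    and op: "\<And>x y. x \<in> carrier A \<Longrightarrow> y \<in> carrier A \<Longrightarrow>
      join A x y \<in> carrier A \<and> meet A x y \<in> carrier A \<and> imp A x y \<in> carrier A"
    using A by (simp_all add: fo_structure_def closed_under_ops_def)
  have eo: "join B (e x) (e y) = e (join A x y)" "meet B (e x) (e y) = e (meet A x y)"
    "imp B (e x) (e y) = e (imp A x y)" if "x \<in> carrier A" "y \<in> carrier A" for x y
    using e that unfolding embedding_def by simp_all
  have ez: "zero B = e (zero A)" "one B = e (one A)" using e by (simp_all add: embedding_def)
  have "inj_on ?i (carrier B)" unfolding im[symmetric] using inj_on_the_inv_into[OF inj] .
  then show ?thesis
    unfolding embedding_def im[symmetric] using i z op eo ez by (auto simp: image_subset_iff)
qed

lemma heyting_iso: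
  assumes A: "heyting_algebra A" and e: "embedding e A B" and im: "e ` carrier A = carrier B"
  shows "heyting_algebra B"
proof -
  interpret heyting A by (rule heytingI[OF A])
  have inj: "inj_on e (carrier A)" using e by (simp add: embedding_def)
  have eo: "join B (e x) (e y) = e (join A x y)" "meet B (e x) (e y) = e (meet A x y)"
    "imp B (e x) (e y) = e (imp A x y)" if "x \<in> carrier A" "y \<in> carrier A" for x y
    using e that unfolding embedding_def by simp_all
  have ez: "zero B = e (zero A)" "one B = e (one A)" using e by (simp_all add: embedding_def)
  have el: "le B (e x) (e y) \<longleftrightarrow> le A x y" if "x \<in> carrier A" "y \<in> carrier A" for x y
    unfolding le_def eo(2)[OF that] using inj_on_eq_iff[OF inj] that by simp
  have ex: "\<exists>a\<in>carrier A. x = e a" if "x \<in> carrier B" for x using that im by blast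
  have cl: "e x \<in> carrier B" if "x \<in> carrier A" for x using that im by blast
  show ?thesis
  proof (rule heyting_algebraI)
    show "fo_structure B"
      unfolding fo_structure_def closed_under_ops_def im[symmetric] ez by (auto simp: eo)
  qed (drule ex, (drule ex)?, (drule ex)?, elim bexE, simp add: eo ez el meet_one join_zero join_absorb
      meet_absorb join_assoc meet_assoc le_imp_iff; metis join_commute meet_commute)+
qed

text \<open>The construction of \<open>H0\<close> works with extensions carried by
  \<open>nat\<close>; other finite algebras are transported there along an injection.\<close>

lemma finite_algebra_on_nat:
  assumes A: "heyting_algebra A" and fin: "finite (carrier A)"
  obtains B :: "nat hstruct" and j where "heyting_algebra B" "finite (carrier B)" "embedding j A B"
proof -
  interpret heyting A by (rule heytingI[OF A])
  obtain j :: "'a \<Rightarrow> nat" where j: "inj_on j (carrier A)"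
    using finite_imp_inj_to_nat_seg[OF fin] by blast
  let ?i = "the_inv_into (carrier A) j"
  have i: "?i (j x) = x" if "x \<in> carrier A" for x using the_inv_into_f_f[OF j that] .
  define B where "B = \<lparr>carrier = j ` carrier A, zero = j (zero A), one = j (one A),
    join = (\<lambda>x y. j (join A (?i x) (?i y))), meet = (\<lambda>x y. j (meet A (?i x) (?i y))),
    imp = (\<lambda>x y. j (imp A (?i x) (?i y)))\<rparr>"
  have e: "embedding j A B" using j i by (simp add: embedding_def B_def)
  have im: "j ` carrier A = carrier B" by (simp add: B_def)
  show ?thesis
  proof
    show "heyting_algebra B" by (rule heyting_iso[OF A e im])
    show "finite (carrier B)" using fin by (simp add: B_def)
  qed (rule e)
qed


section \<open>The algebra of the construction is existentially closed\<close>

text \<open>Everything happens inside the image of the finite algebra \<open>D\<close>, which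
  contains both generating sets and therefore the subalgebra they generate.\<close>

lemma extend_step:
  assumes Ht: "heyting_algebra Ht" and C: "finite C" "subalgebra Ht C" and X: "X \<subseteq> C"
    and st: "extend_step Ht (X, B, e) C C'"
  shows "finite C'" "subalgebra Ht C'" "C \<subseteq> C'"
    "\<exists>g. embedding g B (restr Ht C') \<and> (\<forall>x\<in>X. g (e x) = x)"
proof -
  obtain D :: "nat hstruct" and f g \<phi> where D: "heyting_algebra D" "finite (carrier D)"
    and f: "embedding f (restr Ht C) D" and g: "embedding g B D" and gf: "\<forall>x\<in>X. g (e x) = f x"
    and \<phi>: "embedding \<phi> D Ht" "\<forall>c\<in>C. \<phi> (f c) = c"
    and C': "C' = generated Ht (C \<union> \<phi> ` g ` carrier B)"
    using st unfolding extend_step_def by (simp only: prod.case) blast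
  have fo: "fo_structure Ht" "fo_structure D" using Ht D(1) by (simp_all add: heyting_algebra_def)
  have im: "subalgebra Ht (\<phi> ` carrier D)" by (rule subalgebra_image[OF fo(2) \<phi>(1)])
  have "c \<in> \<phi> ` carrier D" if "c \<in> C" for c
  proof -
    have "f c \<in> carrier D" using f that unfolding embedding_def by auto
    then show ?thesis using \<phi>(2) that by (metis imageI)
  qed
  moreover have "g ` carrier B \<subseteq> carrier D" using g unfolding embedding_def by blast
  ultimately have sub: "C \<union> \<phi> ` g ` carrier B \<subseteq> \<phi> ` carrier D" by blast
  have "C' \<subseteq> \<phi> ` carrier D" unfolding C' by (rule generated_least[OF im sub])
  then show "finite C'" using D(2) finite_surj by blast
  have "\<phi> ` carrier D \<subseteq> carrier Ht" using im by (simp add: subalgebra_def)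
  then have sub': "C \<union> \<phi> ` g ` carrier B \<subseteq> carrier Ht" using sub by blast
  show sa: "subalgebra Ht C'" unfolding C' by (rule subalgebra_generated(1)[OF fo(1) sub'])
  have gen: "C \<union> \<phi> ` g ` carrier B \<subseteq> C'" unfolding C' by (rule subalgebra_generated(2)[OF fo(1) sub'])
  then show "C \<subseteq> C'" by blast
  show "\<exists>g. embedding g B (restr Ht C') \<and> (\<forall>x\<in>X. g (e x) = x)"
  proof (intro exI[of _ "\<phi> \<circ> g"] conjI ballI)
    have "C' \<subseteq> carrier Ht" using sa by (simp add: subalgebra_def)
    then show "embedding (\<phi> \<circ> g) B (restr Ht C')"
      unfolding embedding_restr[OF \<open>C' \<subseteq> carrier Ht\<close>]
      using embedding_comp[OF g \<phi>(1)] gen unfolding image_comp by blast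
    show "(\<phi> \<circ> g) (e x) = x" if "x \<in> X" for x using that gf \<phi>(2) X by auto
  qed
qed

text \<open>The copy of an extension, once adjoined, survives because later sets only grow.\<close>

lemma extend_steps:
  assumes Ht: "heyting_algebra Ht" and st: "extend_steps Ht Es C C'"
    and C: "finite C" "subalgebra Ht C" and Es: "\<forall>E\<in>set Es. fst E \<subseteq> C"
  shows "finite C' \<and> subalgebra Ht C' \<and> C \<subseteq> C' \<and>
    (\<forall>(X, B, e)\<in>set Es. \<exists>g. embedding g B (restr Ht C') \<and> (\<forall>x\<in>X. g (e x) = x))"
  using st C Es
proof induction
  case (1 C)
  then show ?case by simp
next
  case (2 E C C1 Es C2)
  obtain X B e where E: "E = (X, B, e)" by (cases E) auto
  have XC: "X \<subseteq> C" using 2 E by simp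
  note s = extend_step[OF Ht 2(4,5) XC 2(1)[unfolded E]]
  have "\<forall>E\<in>set Es. fst E \<subseteq> C1" using 2(6) s(3) by auto
  from 2(3)[OF s(1,2) this] have IH: "finite C2" "subalgebra Ht C2" "C1 \<subseteq> C2"
    "\<forall>(X, B, e)\<in>set Es. \<exists>g. embedding g B (restr Ht C2) \<and> (\<forall>x\<in>X. g (e x) = x)" by auto
  obtain g where g: "embedding g B (restr Ht C1)" "\<forall>x\<in>X. g (e x) = x" using s(4) by blast
  have c: "C1 \<subseteq> carrier Ht" "C2 \<subseteq> carrier Ht" using s(2) IH(2) by (simp_all add: subalgebra_def)
  have "embedding g B (restr Ht C2)"
    using g(1) IH(3) unfolding embedding_restr[OF c(1)] embedding_restr[OF c(2)] by blast
  then show ?case using IH g(2) s(3) E by auto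
qed

text \<open>Only representatives are adjoined, but every minimal extension is isomorphic over
  \<open>X\<close> to one of them, and composing with the isomorphism embeds it as well.\<close>

lemma next_stage:
  assumes Ht: "heyting_algebra Ht" and st: "next_stage Ht n H H'" and H: "finite H" "subalgebra Ht H"
  shows "finite H'" "subalgebra Ht H'" "H \<subseteq> H'"
    and "\<And>X B e. subalgebra (restr Ht H) X \<Longrightarrow> card {x. join_irreducible (restr Ht X) x} \<le> n \<Longrightarrow>
      min_extension (restr Ht X) (B, e) \<Longrightarrow>
      \<exists>g. embedding g B (restr Ht H') \<and> (\<forall>x\<in>X. g (e x) = x)"
proof -
  obtain Xs Bss where Xs: "set Xs = {X. subalgebra (restr Ht H) X \<and> card {x. join_irreducible (restr Ht X) x} \<le> n}"
    and Bss: "list_all2 (\<lambda>X Bs. min_extension_reps (restr Ht X) Bs) Xs Bss"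
    and es: "extend_steps Ht (concat (map2 (\<lambda>X Bs. map (Pair X) Bs) Xs Bss)) H H'"
    using st unfolding next_stage_def by blast
  have "fst E \<subseteq> H" if E: "E \<in> set (concat (map2 (\<lambda>X Bs. map (Pair X) Bs) Xs Bss))" for E
  proof -
    have "fst E \<in> set Xs" using E by (auto dest: set_zip_leftD)
    then show ?thesis unfolding Xs by (simp add: subalgebra_restr)
  qed
  then have "\<forall>E\<in>set (concat (map2 (\<lambda>X Bs. map (Pair X) Bs) Xs Bss)). fst E \<subseteq> H" by blast
  from extend_steps[OF Ht es H this]
  show "finite H'" "subalgebra Ht H'" "H \<subseteq> H'"
    by blast+
  note all = extend_steps[OF Ht es H \<open>\<forall>E\<in>_. fst E \<subseteq> H\<close>, THEN conjunct2, THEN conjunct2, THEN conjunct2]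
  fix X B e assume X: "subalgebra (restr Ht H) X" "card {x. join_irreducible (restr Ht X) x} \<le> n"
    and m: "min_extension (restr Ht X) (B, e)"
  have "X \<in> set Xs" unfolding Xs using X by simp
  then obtain i where i: "i < length Xs" "X = Xs ! i" by (metis in_set_conv_nth)
  have len: "length Bss = length Xs" using Bss by (simp add: list_all2_lengthD)
  have "min_extension_reps (restr Ht X) (Bss ! i)" using list_all2_nthD[OF Bss i(1)] i(2) by simp
  then obtain E' where E': "E' \<in> set (Bss ! i)" "iso_over (restr Ht X) (B, e) E'"
    using m unfolding min_extension_reps_def by blast
  obtain B' e' where Be: "E' = (B', e')" by fastforce
  obtain f where f: "embedding f B B'" "\<forall>a\<in>X. f (e a) = e' a"
    using E'(2) unfolding Be iso_over_def by auto
  have "(X, Bss ! i) \<in> set (zip Xs Bss)" using i len by (metis in_set_zip fst_conv snd_conv)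
  then have "(X, B', e') \<in> set (concat (map2 (\<lambda>X Bs. map (Pair X) Bs) Xs Bss))"
    using E'(1) unfolding Be by force
  from bspec[OF all this] obtain g where g: "embedding g B' (restr Ht H')" "\<forall>x\<in>X. g (e' x) = x" by auto
  show "\<exists>g. embedding g B (restr Ht H') \<and> (\<forall>x\<in>X. g (e x) = x)"
    by (rule exI[of _ "g \<circ> f"]) (use embedding_comp[OF f(1) g(1)] f(2) g(2) in simp)
qed

text \<open>A finite extension of a finite subalgebra is reached by finitely many minimal ones, each
  realised at some stage. Filtering an extension \<open>K\<close> through a finite set that contains
  the image of a stage gives such a finite extension, and its embedding fixes the
  parameters.\<close>

theorem H0_construction_ex_closed:
  fixes Ht H0 :: "'b hstruct"
  assumes Ht: "heyting_algebra Ht" and con: "H0_construction Ht H0"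
  shows "ex_closed H0"
proof -
  interpret Ht: heyting Ht by (rule heytingI[OF Ht])
  obtain H :: "nat \<Rightarrow> 'b set" where H: "H 0 = {zero Ht, one Ht}" "\<And>n. next_stage Ht n (H n) (H (Suc n))"
    and H0: "H0 = restr Ht (\<Union>n. H n)" using con unfolding H0_construction_def by blast
  define U where "U = (\<Union>n. H n)"
  have fs: "finite (H n) \<and> subalgebra Ht (H n)" for n
  proof (induction n)
    case 0
    show ?case unfolding H subalgebra_def closed_under_ops_def by (auto simp: Ht.boolean_ops)
  next
    case (Suc n)
    then show ?case using next_stage(1,2)[OF Ht H(2)] by blast
  qed
  have step: "H n \<subseteq> H (Suc n)" for n using next_stage(3)[OF Ht H(2)] fs by blast
  have mono: "H m \<subseteq> H n" if "m \<le> n" for m n using lift_Suc_mono_le[of H, OF step that] .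
  have dir: "\<exists>n. X \<subseteq> H n" if "finite X" "X \<subseteq> U" for X
    using that
  proof (induction X)
    case (insert x X)
    then obtain m n where mn: "x \<in> H m" "X \<subseteq> H n" unfolding U_def by auto
    have "insert x X \<subseteq> H (max m n)"
      using mn mono[of m "max m n"] mono[of n "max m n"] by auto
    then show ?case by blast
  qed simp
  have Hc: "H n \<subseteq> carrier Ht" for n using fs by (simp add: subalgebra_def)
  then have Uc: "U \<subseteq> carrier Ht" unfolding U_def by blast
  have HU: "H n \<subseteq> U" for n unfolding U_def by blast
  have "subalgebra Ht U"
    unfolding subalgebra_def closed_under_ops_def
  proof (intro conjI ballI Uc)
    show "zero Ht \<in> U" "one Ht \<in> U" using HU[of 0] H(1) by auto
    fix x y assume "x \<in> U" "y \<in> U"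
    then obtain n where "{x, y} \<subseteq> H n" using dir[of "{x, y}"] by auto
    then have "join Ht x y \<in> H n" "meet Ht x y \<in> H n" "imp Ht x y \<in> H n"
      using fs[of n] by (simp_all add: subalgebra_def closed_under_ops_def)
    then show "join Ht x y \<in> U" "meet Ht x y \<in> U" "imp Ht x y \<in> U" using HU by blast+
  qed
  then have hU: "heyting_algebra (restr Ht U)" by (rule heyting_restr[OF Ht])
  \<comment> \<open>Induction on the number of elements of \<open>B\<close> outside the image of
    \<open>X\<close>.\<close>
  have ext: "\<exists>g. embedding g B (restr Ht U) \<and> (\<forall>x\<in>X. g (e x) = x)"
    if "finite X" "X \<subseteq> U" "subalgebra Ht X" "heyting_algebra B" "finite (carrier B)"
      "embedding e (restr Ht X) B" for X e and B :: "nat hstruct"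
    using that
  proof (induction "card (carrier B) - card X" arbitrary: X e rule: less_induct)
    case less
    note X = less.prems(1-3) and B = less.prems(4,5) and e = less.prems(6)
    have hX: "heyting_algebra (restr Ht X)" by (rule heyting_restr[OF Ht X(3)])
    then have foX: "fo_structure (restr Ht X)" by (simp add: heyting_algebra_def)
    have Xc: "X \<subseteq> carrier Ht" using X(3) by (simp add: subalgebra_def)
    have inje: "inj_on e X" and eX: "e ` X \<subseteq> carrier B" using e by (simp_all add: embedding_def)
    show ?case
    proof (cases "e ` X = carrier B")
      case True
      have "embedding (the_inv_into X e) B (restr Ht X)"
        using embedding_inverse[OF foX e] True by simp
      then have "embedding (the_inv_into X e) B (restr Ht U)"
        unfolding embedding_restr[OF Xc] embedding_restr[OF Uc] using X(2) by blast
      then show ?thesis using the_inv_into_f_f[OF inje] by blast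
    next
      case False
      have fB: "fo_structure B" using B(1) by (simp add: heyting_algebra_def)
      \<comment> \<open>A subalgebra of least size that properly contains the image of
        \<open>X\<close> is a minimal extension of it.\<close>
      have "\<exists>Y. (subalgebra B Y \<and> e ` X \<subset> Y) \<and> (\<forall>Z. subalgebra B Z \<and> e ` X \<subset> Z \<longrightarrow> card Y \<le> card Z)"
      proof (rule ex_has_least_nat)
        show "subalgebra B (carrier B) \<and> e ` X \<subset> carrier B"
          using fB False eX by (auto simp: subalgebra_def fo_structure_def)
      qed
      then obtain Y where Y0: "(subalgebra B Y \<and> e ` X \<subset> Y) \<and>
        (\<forall>Z. subalgebra B Z \<and> e ` X \<subset> Z \<longrightarrow> card Y \<le> card Z)" by (rule exE)
      then have Y: "subalgebra B Y" "e ` X \<subset> Y" by simp_all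
      have least: "card Y \<le> card Z" if "subalgebra B Z" "e ` X \<subset> Z" for Z
        using Y0[THEN conjunct2, rule_format, of Z] that by simp
      have Yc: "Y \<subseteq> carrier B" using Y(1) by (simp add: subalgebra_def)
      have finY: "finite Y" using Yc B(2) by (rule finite_subset)
      have hY: "heyting_algebra (restr B Y)" by (rule heyting_restr[OF B(1) Y(1)])
      then have foY: "fo_structure (restr B Y)" by (simp add: heyting_algebra_def)
      have min: "min_extension (restr Ht X) (restr B Y, e)"
        unfolding min_extension_def prod.case
      proof (intro conjI allI impI hY)
        show "finite (carrier (restr B Y))" using finY by simp
        show "embedding e (restr Ht X) (restr B Y)"
          unfolding embedding_restr[OF Yc] using e Y(2) by auto
        show "e ` carrier (restr Ht X) \<noteq> carrier (restr B Y)" using Y(2) by auto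
        fix Z assume Z: "subalgebra (restr B Y) Z \<and> e ` carrier (restr Ht X) \<subseteq> Z"
        then have ZY: "Z \<subseteq> Y" "subalgebra B Z" "e ` X \<subseteq> Z"
          using Yc by (auto simp: subalgebra_restr subalgebra_def)
        show "Z = e ` carrier (restr Ht X) \<or> Z = carrier (restr B Y)"
        proof (cases "Z = e ` X")
          case False
          then have "e ` X \<subset> Z" using ZY(3) by auto
          then have "card Y \<le> card Z" by (rule least[OF ZY(2)])
          then have "Z = Y" using card_seteq[OF finY ZY(1)] by simp
          then show ?thesis by simp
        qed simp
      qed
      obtain m where m: "X \<subseteq> H m" using dir[OF X(1,2)] by blast
      \<comment> \<open>Stage \<open>n\<close> must contain \<open>X\<close> and also admit
        subalgebras with as many join-irreducible elements as \<open>X\<close> has.\<close>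
      define n where "n = max m (card {x. join_irreducible (restr Ht X) x})"
      have "X \<subseteq> H n" using m mono[of m n] by (auto simp: n_def)
      then have sub: "subalgebra (restr Ht (H n)) X" using X(3) by (simp add: subalgebra_restr subalgebra_def)
      obtain g where g: "embedding g (restr B Y) (restr Ht (H (Suc n)))" "\<forall>x\<in>X. g (e x) = x"
        using next_stage(4)[OF Ht H(2) _ _ sub _ min] fs by (auto simp: n_def)
      have gHt: "embedding g (restr B Y) Ht" and gY: "g ` Y \<subseteq> H (Suc n)"
        using g(1) unfolding embedding_restr[OF Hc] by simp_all
      \<comment> \<open>The realised copy of \<open>Y\<close> takes the place of \<open>X\<close>,
        and the inverse of \<open>g\<close> that of \<open>e\<close>.\<close>
      define X' where "X' = g ` Y"
      have X': "finite X'" "X' \<subseteq> U" "subalgebra Ht X'"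
        using finY gY HU subalgebra_image[OF foY gHt] unfolding X'_def by auto
      have X'c: "X' \<subseteq> carrier Ht" using X'(3) by (simp add: subalgebra_def)
      have injg: "inj_on g Y" using g(1) by (simp add: embedding_def)
      let ?e = "the_inv_into Y g"
      have gX': "embedding g (restr B Y) (restr Ht X')"
        unfolding embedding_restr[OF X'c] using gHt by (simp add: X'_def)
      have "embedding ?e (restr Ht X') (restr B Y)"
        using embedding_inverse[OF foY gX'] by (simp add: X'_def)
      then have e': "embedding ?e (restr Ht X') B" unfolding embedding_restr[OF Yc] by blast
      have "card X < card Y"
        using psubset_card_mono[OF finY Y(2)] card_image[OF inje] by simp
      moreover have "card X' = card Y" unfolding X'_def by (rule card_image[OF injg])
      moreover have "card Y \<le> card (carrier B)" using card_mono[OF B(2) Yc] .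
      ultimately have "card (carrier B) - card X' < card (carrier B) - card X" by linarith
      from less.hyps[OF this X' B e'] obtain h where
        h: "embedding h B (restr Ht U)" "\<forall>x\<in>X'. h (?e x) = x" by blast
      have "h (e x) = x" if x: "x \<in> X" for x
      proof -
        have eY: "e x \<in> Y" using Y(2) x by blast
        have gx: "g (e x) = x" using g(2) x by blast
        have "x \<in> X'" unfolding X'_def using imageI[OF eY, of g] gx by simp
        moreover have "?e x = e x" using the_inv_into_f_f[OF injg eY] gx by simp
        ultimately show ?thesis using h(2) by metis
      qed
      then show ?thesis using h(1) by blast
    qed
  qed
  have "ex_closed (restr Ht U)"
    unfolding ex_closed_def
  proof (intro conjI hU allI impI, elim conjE)
    fix K :: "('b + nat) hstruct" and e p and v :: "nat \<Rightarrow> 'b"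
    assume K: "heyting_algebra K" and e: "embedding e (restr Ht U) K" and p: "existential p"
      and v: "range v \<subseteq> carrier (restr Ht U)" and sp: "sat K (e \<circ> v) p"
    interpret K: heyting K by (rule heytingI[OF K])
    obtain xs q where q: "p = foldr Ex xs q" "quantifier_free q" using existential_prenex[OF p] by blast
    obtain l where l: "fm_vars p \<subseteq> {..<l}" by (rule fm_vars_bound)
    define n where "n = fm_degree q"
    obtain u where u: "\<forall>i. i \<notin> set xs \<longrightarrow> u i = (e \<circ> v) i" "\<forall>i\<in>set xs. u i \<in> carrier K" "sat K u q"
      using sp unfolding q sat_foldr_Ex by blast
    have eU: "e x \<in> carrier K" if "x \<in> U" for x using e that unfolding embedding_def by auto
    have vU: "v i \<in> U" for i using v by auto
    have ru: "range u \<subseteq> carrier K"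
    proof
      fix y assume "y \<in> range u"
      then obtain i where "y = u i" by blast
      then show "y \<in> carrier K" using u(1,2) eU[OF vU] by (cases "i \<in> set xs") auto
    qed
    have "finite (v ` {..<l})" "v ` {..<l} \<subseteq> U" using v by auto
    from dir[OF this] obtain k where k: "v ` {..<l} \<subseteq> H k" by blast
    \<comment> \<open>A whole stage is taken instead of the parameters alone, because it is a finite
      subalgebra.\<close>
    define X where "X = H k"
    have X: "finite X" "X \<subseteq> U" "subalgebra Ht X" using fs HU by (simp_all add: X_def)
    have clX: "zero Ht \<in> X" "one Ht \<in> X" "\<And>x y. x \<in> X \<Longrightarrow> y \<in> X \<Longrightarrow>
      join Ht x y \<in> X \<and> meet Ht x y \<in> X \<and> imp Ht x y \<in> X"
      using X(3) by (simp_all add: subalgebra_def closed_under_ops_def)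
    have eX: "embedding e (restr Ht X) K"
      using embedding_restr_domain[OF e, of X] X(2) by simp
    \<comment> \<open>The image of \<open>X\<close> is closed under the operations, so filtration
      restricts to a full embedding there; the remaining values serve to evaluate
      \<open>q\<close>.\<close>
    define E where "E = e ` X \<union> eval K u ` ipc_formulas l n"
    have eXE: "e x \<in> E" if "x \<in> X" for x using that by (simp add: E_def)
    have E: "finite E" "E \<subseteq> carrier K" "zero K \<in> E" "one K \<in> E"
    proof -
      show "finite E" unfolding E_def using finite_eval_formulas[OF K ru] X(1) by blast
      show "E \<subseteq> carrier K" unfolding E_def using K.eval_closed[OF ru] eU X(2) by blast
      show "zero K \<in> E" "one K \<in> E"
        using eXE[OF clX(1)] eXE[OF clX(2)] eX by (simp_all add: embedding_def)
    qed
    let ?P = "traces K E"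
    define h where "h c = {T \<in> ?P. c \<in> T}" for c
    have h: "partial_embedding h K E (upalg ?P (\<subseteq>))"
      unfolding h_def by (rule filtration[OF K E(2-4)])
    have hc: "h ` E \<subseteq> carrier (upalg ?P (\<subseteq>))"
      and hop: "\<And>x y. x \<in> E \<Longrightarrow> y \<in> E \<Longrightarrow> (join K x y \<in> E \<longrightarrow> h (join K x y) = join (upalg ?P (\<subseteq>)) (h x) (h y)) \<and>
        (meet K x y \<in> E \<longrightarrow> h (meet K x y) = meet (upalg ?P (\<subseteq>)) (h x) (h y)) \<and>
        (imp K x y \<in> E \<longrightarrow> h (imp K x y) = imp (upalg ?P (\<subseteq>)) (h x) (h y))"
      using h unfolding partial_embedding_def by blast+
    have he: "embedding (h \<circ> e) (restr Ht X) (upalg ?P (\<subseteq>))"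
      unfolding embedding_def
    proof (intro conjI ballI)
      have "inj_on e X" using eX by (simp add: embedding_def)
      moreover have "inj_on h (e ` X)"
        by (rule inj_on_subset[OF partial_embeddingD(1)[OF h]]) (simp add: E_def)
      ultimately show "inj_on (h \<circ> e) (carrier (restr Ht X))" by (simp add: comp_inj_on)
      show "(h \<circ> e) ` carrier (restr Ht X) \<subseteq> carrier (upalg ?P (\<subseteq>))"
        using hc eXE by (simp add: image_subset_iff del: upalg_simps(1))
      show "(h \<circ> e) (zero (restr Ht X)) = zero (upalg ?P (\<subseteq>))"
        "(h \<circ> e) (one (restr Ht X)) = one (upalg ?P (\<subseteq>))"
        using eX partial_embeddingD(2,3)[OF h] by (simp_all add: embedding_def)
      fix x y assume xy: "x \<in> carrier (restr Ht X)" "y \<in> carrier (restr Ht X)"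
      have eo: "join K (e x) (e y) = e (join Ht x y)" "meet K (e x) (e y) = e (meet Ht x y)"
        "imp K (e x) (e y) = e (imp Ht x y)"
        using eX xy unfolding embedding_def by simp_all
      have inE: "e (join Ht x y) \<in> E" "e (meet Ht x y) \<in> E" "e (imp Ht x y) \<in> E" "e x \<in> E" "e y \<in> E"
        using clX(3)[of x y] xy eXE by simp_all
      note ho = hop[OF inE(4,5), unfolded eo]
      show "(h \<circ> e) (join (restr Ht X) x y) = join (upalg ?P (\<subseteq>)) ((h \<circ> e) x) ((h \<circ> e) y)"
        "(h \<circ> e) (meet (restr Ht X) x y) = meet (upalg ?P (\<subseteq>)) ((h \<circ> e) x) ((h \<circ> e) y)"
        "(h \<circ> e) (imp (restr Ht X) x y) = imp (upalg ?P (\<subseteq>)) ((h \<circ> e) x) ((h \<circ> e) y)"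
        using ho inE by (simp_all del: upalg_simps)
    qed
    have "carrier (upalg ?P (\<subseteq>)) \<subseteq> Pow ?P" by auto
    then have finU: "finite (carrier (upalg ?P (\<subseteq>)))"
      using finite_traces[OF E(1), of K] by (meson finite_Pow_iff finite_subset)
    obtain B :: "nat hstruct" and j where B: "heyting_algebra B" "finite (carrier B)"
      "embedding j (upalg ?P (\<subseteq>)) B"
      using finite_algebra_on_nat[OF heyting_upalg_subset finU] .
    obtain g where g: "embedding g B (restr Ht U)" "\<forall>x\<in>X. g ((j \<circ> (h \<circ> e)) x) = x"
      using ext[OF X B(1,2) embedding_comp[OF he B(3)]] by blast
    define \<rho> where "\<rho> = g \<circ> (j \<circ> h)"
    have \<rho>: "partial_embedding \<rho> K E (restr Ht U)"
      unfolding \<rho>_def by (rule partial_embedding_comp[OF partial_embedding_comp[OF h B(3)] g(1)])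
    have \<rho>e: "\<rho> (e x) = x" if "x \<in> X" for x using g(2) that by (simp add: \<rho>_def)
    have \<rho>E: "\<rho> x \<in> U" if "x \<in> E" for x using \<rho> that unfolding partial_embedding_def by auto
    have sub: "eval K u ` ipc_formulas l n \<subseteq> E" by (simp add: E_def)
    have var: "u i \<in> E" if "i < l" for i
      using sub that image_eqI[of _ "eval K u" "Var i" "ipc_formulas l n"] by auto
    \<comment> \<open>Variables outside the quantified block keep their values, because \<rho>
      inverts \<open>e\<close> on \<open>X\<close>.\<close>
    define w where "w i = (if i < l then \<rho> (u i) else v i)" for i
    have "sat (restr Ht U) w q"
      using partial_embedding_sat[OF \<rho> sub, of w q] u(3) q l
      by (simp add: w_def n_def fm_vars_foldr_Ex)
    moreover have "w i = v i" if "i \<notin> set xs" for i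
    proof (cases "i < l")
      case True
      then have "v i \<in> X" using k by (auto simp: X_def)
      then show ?thesis using True u(1) that \<rho>e by (simp add: w_def)
    qed (simp add: w_def)
    moreover have "w i \<in> carrier (restr Ht U)" if "i \<in> set xs" for i
    proof -
      have "i < l" using l that by (auto simp: q fm_vars_foldr_Ex)
      then show ?thesis using \<rho>E var by (simp add: w_def)
    qed
    ultimately show "sat (restr Ht U) v p" unfolding q sat_foldr_Ex by blast
  qed
  then show ?thesis by (simp add: H0 U_def)
qed


section \<open>Ultrapowers\<close>

text \<open>The predicate \<open>ae\<close> holds of the properties whose extension belongs to the ultrafilter.\<close>

locale ultrapower =
  fixes ae :: "('i \<Rightarrow> bool) \<Rightarrow> bool" and A :: "'b hstruct"
  assumes ae_conj: "ae (\<lambda>i. P i \<and> Q i) \<longleftrightarrow> ae P \<and> ae Q"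
    and ae_not: "ae (\<lambda>i. \<not> P i) \<longleftrightarrow> \<not> ae P"
    and fo: "fo_structure A"
begin

lemma ae_mono: "ae P \<Longrightarrow> (\<And>i. P i \<Longrightarrow> Q i) \<Longrightarrow> ae Q"
proof -
  assume P: "ae P" and PQ: "\<And>i. P i \<Longrightarrow> Q i"
  have "(\<lambda>i. P i \<and> Q i) = P" using PQ by (auto simp: fun_eq_iff)
  then show "ae Q" using ae_conj[of P Q] P by simp
qed

lemma ae_True: "(\<And>i. P i) \<Longrightarrow> ae P"
  using ae_not[of "\<lambda>_. True"] ae_mono[of "\<lambda>i. \<not> True" P] ae_mono[of "\<lambda>_. True" P] by blast

lemma ae_mono2: "ae P \<Longrightarrow> ae Q \<Longrightarrow> (\<And>i. P i \<Longrightarrow> Q i \<Longrightarrow> R i) \<Longrightarrow> ae R"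
  using ae_conj[of P Q] ae_mono[of "\<lambda>i. P i \<and> Q i" R] by blast

text \<open>For \<open>f\<close> with values in \<open>A\<close>, a chosen representative of its
  class modulo the ultrafilter. Elements of the ultrapower are thus functions themselves, and
  equality almost everywhere becomes equality.\<close>

definition canon :: "('i \<Rightarrow> 'b) \<Rightarrow> 'i \<Rightarrow> 'b" where
  "canon f = (SOME g. (\<forall>i. g i \<in> carrier A) \<and> ae (\<lambda>i. f i = g i))"

definition upow :: "('i \<Rightarrow> 'b) hstruct" where
  "upow = \<lparr>carrier = canon ` {f. \<forall>i. f i \<in> carrier A}, zero = canon (\<lambda>_. zero A), one = canon (\<lambda>_. one A),
     join = (\<lambda>f g. canon (\<lambda>i. join A (f i) (g i))), meet = (\<lambda>f g. canon (\<lambda>i. meet A (f i) (g i))),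
     imp = (\<lambda>f g. canon (\<lambda>i. imp A (f i) (g i)))\<rparr>"

lemma canon:
  assumes "\<And>i. f i \<in> carrier A"
  shows "canon f i \<in> carrier A" "ae (\<lambda>i. f i = canon f i)" "canon f \<in> carrier upow"
proof -
  have "(\<forall>i. f i \<in> carrier A) \<and> ae (\<lambda>i. f i = f i)" using assms ae_True[of "\<lambda>i. f i = f i"] by simp
  then have "(\<forall>i. canon f i \<in> carrier A) \<and> ae (\<lambda>i. f i = canon f i)"
    unfolding canon_def by (rule someI[where P = "\<lambda>g. (\<forall>i. g i \<in> carrier A) \<and> ae (\<lambda>i. f i = g i)"])
  then show "canon f i \<in> carrier A" "ae (\<lambda>i. f i = canon f i)" by blast+
  show "canon f \<in> carrier upow" using assms by (simp add: upow_def)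
qed

lemma canon_eq:
  assumes "ae (\<lambda>i. f i = g i)"
  shows "canon f = canon g"
proof -
  have "ae (\<lambda>i. f i = h i) \<longleftrightarrow> ae (\<lambda>i. g i = h i)" for h
    using ae_mono2[OF assms, of "\<lambda>i. f i = h i" "\<lambda>i. g i = h i"]
      ae_mono2[OF assms, of "\<lambda>i. g i = h i" "\<lambda>i. f i = h i"] by auto
  then show ?thesis by (simp add: canon_def)
qed

lemma upowD:
  assumes "h \<in> carrier upow"
  shows "h i \<in> carrier A" "canon h = h"
proof -
  obtain f where f: "\<And>i. f i \<in> carrier A" "h = canon f" using assms by (auto simp: upow_def)
  show "h i \<in> carrier A" unfolding f(2) by (rule canon(1)[OF f(1)])
  show "canon h = h" unfolding f(2) using canon_eq[OF canon(2)[OF f(1)]] by simp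
qed

lemma upow_eq_iff:
  assumes "h \<in> carrier upow" "h' \<in> carrier upow"
  shows "h = h' \<longleftrightarrow> ae (\<lambda>i. h i = h' i)"
  using canon_eq[of h h'] upowD(2)[OF assms(1)] upowD(2)[OF assms(2)] ae_True[of "\<lambda>i. h i = h' i"] by auto

lemma A_closed:
  "zero A \<in> carrier A" "one A \<in> carrier A"
  "x \<in> carrier A \<Longrightarrow> y \<in> carrier A \<Longrightarrow> join A x y \<in> carrier A"
  "x \<in> carrier A \<Longrightarrow> y \<in> carrier A \<Longrightarrow> meet A x y \<in> carrier A"
  "x \<in> carrier A \<Longrightarrow> y \<in> carrier A \<Longrightarrow> imp A x y \<in> carrier A"
  using fo by (simp_all add: fo_structure_def closed_under_ops_def)

lemma upow_ops:
  "zero upow = canon (\<lambda>_. zero A)" "one upow = canon (\<lambda>_. one A)"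
  "join upow f g = canon (\<lambda>i. join A (f i) (g i))" "meet upow f g = canon (\<lambda>i. meet A (f i) (g i))"
  "imp upow f g = canon (\<lambda>i. imp A (f i) (g i))"
  by (simp_all add: upow_def)

lemma fo_upow: "fo_structure upow"
  unfolding fo_structure_def closed_under_ops_def upow_ops
  by (intro conjI ballI canon(3) A_closed upowD(1))

lemma eval_upow:
  assumes v: "range v \<subseteq> carrier upow"
  shows "eval upow v t \<in> carrier upow \<and> ae (\<lambda>i. eval upow v t i = eval A (\<lambda>x. v x i) t)"
proof (induction t)
  case (Var x)
  then show ?case using v ae_True[of "\<lambda>i. v x i = v x i"] by auto
next
  case Bot
  show ?case using canon(2,3)[of "\<lambda>_. zero A"] A_closed(1) by (simp add: upow_ops eq_commute)
next
  case Top
  show ?case using canon(2,3)[of "\<lambda>_. one A"] A_closed(2) by (simp add: upow_ops eq_commute)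
next
  case (Or s t)
  let ?f = "\<lambda>i. join A (eval upow v s i) (eval upow v t i)"
  have c: "?f i \<in> carrier A" for i using Or upowD(1) A_closed(3) by blast
  have p: "ae (\<lambda>i. ?f i = eval A (\<lambda>x. v x i) (Or s t))"
    by (rule ae_mono2[OF conjunct2[OF Or(1)] conjunct2[OF Or(2)]]) simp
  have "ae (\<lambda>i. canon ?f i = eval A (\<lambda>x. v x i) (Or s t))"
    by (rule ae_mono2[OF p canon(2)[of ?f, OF c]]) simp
  then show ?case using canon(3)[of ?f] c by (simp add: upow_ops)
next
  case (And s t)
  let ?f = "\<lambda>i. meet A (eval upow v s i) (eval upow v t i)"
  have c: "?f i \<in> carrier A" for i using And upowD(1) A_closed(4) by blast
  have p: "ae (\<lambda>i. ?f i = eval A (\<lambda>x. v x i) (And s t))"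
    by (rule ae_mono2[OF conjunct2[OF And(1)] conjunct2[OF And(2)]]) simp
  have "ae (\<lambda>i. canon ?f i = eval A (\<lambda>x. v x i) (And s t))"
    by (rule ae_mono2[OF p canon(2)[of ?f, OF c]]) simp
  then show ?case using canon(3)[of ?f] c by (simp add: upow_ops)
next
  case (To s t)
  let ?f = "\<lambda>i. imp A (eval upow v s i) (eval upow v t i)"
  have c: "?f i \<in> carrier A" for i using To upowD(1) A_closed(5) by blast
  have p: "ae (\<lambda>i. ?f i = eval A (\<lambda>x. v x i) (To s t))"
    by (rule ae_mono2[OF conjunct2[OF To(1)] conjunct2[OF To(2)]]) simp
  have "ae (\<lambda>i. canon ?f i = eval A (\<lambda>x. v x i) (To s t))"
    by (rule ae_mono2[OF p canon(2)[of ?f, OF c]]) simp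
  then show ?case using canon(3)[of ?f] c by (simp add: upow_ops)
qed

text \<open>Witnesses are chosen index by index, with \<open>zero A\<close> where there is none.
  This is the quantifier step of the theorem of Los.\<close>

lemma ae_ex: "(\<exists>h\<in>carrier upow. ae (\<lambda>i. Q i (h i))) \<longleftrightarrow> ae (\<lambda>i. \<exists>a\<in>carrier A. Q i a)"
proof
  assume "\<exists>h\<in>carrier upow. ae (\<lambda>i. Q i (h i))"
  then obtain h where h: "h \<in> carrier upow" "ae (\<lambda>i. Q i (h i))" by blast
  show "ae (\<lambda>i. \<exists>a\<in>carrier A. Q i a)"
    by (rule ae_mono[OF h(2)]) (use upowD(1)[OF h(1)] in blast)
next
  assume *: "ae (\<lambda>i. \<exists>a\<in>carrier A. Q i a)"
  define f where "f i = (if \<exists>a\<in>carrier A. Q i a then SOME a. a \<in> carrier A \<and> Q i a else zero A)" for i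
  have some: "f i \<in> carrier A \<and> Q i (f i)" if "\<exists>a\<in>carrier A. Q i a" for i
    unfolding f_def using that by (simp, intro someI_ex[of "\<lambda>a. a \<in> carrier A \<and> Q i a"]) blast
  have c: "f i \<in> carrier A" for i
  proof (cases "\<exists>a\<in>carrier A. Q i a")
    case False
    then show ?thesis using A_closed(1) unfolding f_def by simp
  qed (use some in blast)
  have "ae (\<lambda>i. Q i (canon f i))"
    by (rule ae_mono2[OF * canon(2)[of f, OF c]]) (use some in metis)
  then show "\<exists>h\<in>carrier upow. ae (\<lambda>i. Q i (h i))" using canon(3)[of f] c by blast
qed

theorem Los:
  "range v \<subseteq> carrier upow \<Longrightarrow> sat upow v p \<longleftrightarrow> ae (\<lambda>i. sat A (\<lambda>x. v x i) p)"
proof (induction p arbitrary: v)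
  case (Eq s t)
  note es = eval_upow[OF Eq, of s] and et = eval_upow[OF Eq, of t]
  have "sat upow v (Eq s t) \<longleftrightarrow> ae (\<lambda>i. eval upow v s i = eval upow v t i)"
    using upow_eq_iff es et by simp
  also have "\<dots> \<longleftrightarrow> ae (\<lambda>i. eval A (\<lambda>x. v x i) s = eval A (\<lambda>x. v x i) t)"
  proof -
    have b: "ae (\<lambda>i. eval upow v s i = eval A (\<lambda>x. v x i) s \<and> eval upow v t i = eval A (\<lambda>x. v x i) t)"
      unfolding ae_conj by (rule conjI[OF conjunct2[OF es] conjunct2[OF et]])
    show ?thesis
    proof
      assume "ae (\<lambda>i. eval upow v s i = eval upow v t i)"
      then show "ae (\<lambda>i. eval A (\<lambda>x. v x i) s = eval A (\<lambda>x. v x i) t)" by (rule ae_mono2[OF b]) metis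
    next
      assume "ae (\<lambda>i. eval A (\<lambda>x. v x i) s = eval A (\<lambda>x. v x i) t)"
      then show "ae (\<lambda>i. eval upow v s i = eval upow v t i)" by (rule ae_mono2[OF b]) metis
    qed
  qed
  finally show ?case by simp
next
  case (Neg p)
  then show ?case using ae_not by simp
next
  case (Conj p q)
  then show ?case using ae_conj by simp
next
  case (Disj p q)
  have "ae (\<lambda>i. sat A (\<lambda>x. v x i) p \<or> sat A (\<lambda>x. v x i) q) \<longleftrightarrow>
      \<not> ae (\<lambda>i. \<not> sat A (\<lambda>x. v x i) p \<and> \<not> sat A (\<lambda>x. v x i) q)"
    unfolding ae_not[symmetric] by simp
  then show ?case using Disj by (simp add: ae_conj ae_not)
next
  case (Impl p q)
  have "ae (\<lambda>i. sat A (\<lambda>x. v x i) p \<longrightarrow> sat A (\<lambda>x. v x i) q) \<longleftrightarrow>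
      \<not> ae (\<lambda>i. sat A (\<lambda>x. v x i) p \<and> \<not> sat A (\<lambda>x. v x i) q)"
    unfolding ae_not[symmetric] by simp
  then show ?case using Impl by (simp add: ae_conj ae_not)
next
  case (All x p)
  have upd: "sat upow (v(x := h)) p \<longleftrightarrow> ae (\<lambda>i. sat A ((\<lambda>y. v y i)(x := h i)) p)" if "h \<in> carrier upow" for h
  proof -
    have r: "range (v(x := h)) \<subseteq> carrier upow" using All.prems that by auto
    have eq: "(\<lambda>y. (v(x := h)) y i) = (\<lambda>y. v y i)(x := h i)" for i by auto
    show ?thesis using All.IH[OF r] unfolding eq .
  qed
  have "sat upow v (All x p) \<longleftrightarrow> \<not> (\<exists>h\<in>carrier upow. ae (\<lambda>i. \<not> sat A ((\<lambda>y. v y i)(x := h i)) p))"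
    unfolding ae_not using upd by auto
  also have "\<dots> \<longleftrightarrow> \<not> ae (\<lambda>i. \<exists>a\<in>carrier A. \<not> sat A ((\<lambda>y. v y i)(x := a)) p)"
    using ae_ex[of "\<lambda>i a. \<not> sat A ((\<lambda>y. v y i)(x := a)) p"] by simp
  also have "\<dots> \<longleftrightarrow> ae (\<lambda>i. sat A (\<lambda>y. v y i) (All x p))"
    unfolding ae_not[symmetric] by simp
  finally show ?case .
next
  case (Ex x p)
  have upd: "sat upow (v(x := h)) p \<longleftrightarrow> ae (\<lambda>i. sat A ((\<lambda>y. v y i)(x := h i)) p)" if "h \<in> carrier upow" for h
  proof -
    have r: "range (v(x := h)) \<subseteq> carrier upow" using Ex.prems that by auto
    have eq: "(\<lambda>y. (v(x := h)) y i) = (\<lambda>y. v y i)(x := h i)" for i by auto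
    show ?thesis using Ex.IH[OF r] unfolding eq .
  qed
  have "sat upow v (Ex x p) \<longleftrightarrow> (\<exists>h\<in>carrier upow. ae (\<lambda>i. sat A ((\<lambda>y. v y i)(x := h i)) p))"
    using upd by auto
  also have "\<dots> \<longleftrightarrow> ae (\<lambda>i. sat A (\<lambda>y. v y i) (Ex x p))"
    using ae_ex[of "\<lambda>i a. sat A ((\<lambda>y. v y i)(x := a)) p"] by simp
  finally show ?case .
qed

lemma models_upow:
  assumes "models A T"
  shows "models upow T"
  unfolding models_def
proof (intro conjI fo_upow ballI allI impI)
  fix p and v :: "nat \<Rightarrow> 'i \<Rightarrow> 'b" assume p: "p \<in> T" and v: "range v \<subseteq> carrier upow"
  have r: "range (\<lambda>x. v x i) \<subseteq> carrier A" for i using v upowD(1) by auto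
  have "sat A w p" if "range w \<subseteq> carrier A" for w
    using assms p that by (simp add: models_def)
  from this[OF r] show "sat upow v p" unfolding Los[OF v] by (rule ae_True)
qed

end

section \<open>Embedding into an ultrapower\<close>

text \<open>For the discrete order every subset is an up-set, so the prime filters of this algebra
  are ultrafilters and the prime filter theorem applies.\<close>

lemma ultrafilter_exists:
  fixes F :: "'i set set"
  assumes "UNIV \<in> F" "{} \<notin> F" "\<And>X Y. X \<in> F \<Longrightarrow> Y \<in> F \<Longrightarrow> X \<inter> Y \<in> F"
    "\<And>X Y. X \<in> F \<Longrightarrow> X \<subseteq> Y \<Longrightarrow> Y \<in> F"
  obtains \<U> where "F \<subseteq> \<U>" "\<forall>X Y. X \<inter> Y \<in> \<U> \<longleftrightarrow> X \<in> \<U> \<and> Y \<in> \<U>" "\<forall>X. - X \<in> \<U> \<longleftrightarrow> X \<notin> \<U>"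
proof -
  let ?P = "upalg (UNIV :: 'i set) (=)"
  interpret P: heyting ?P by (rule heytingI[OF heyting_upalg]) auto
  have c: "X \<in> carrier ?P" for X by simp
  have "hfilter ?P F"
    unfolding hfilter_def
  proof (intro conjI ballI impI)
    show "F \<subseteq> carrier ?P" by auto
    show "one ?P \<in> F" using assms(1) by simp
    fix X assume X: "X \<in> F"
    show "meet ?P X Y \<in> F" if "Y \<in> F" for Y using assms(3)[OF X that] by simp
    show "Y \<in> F" if "le ?P X Y" for Y
      by (rule assms(4)[OF X]) (use that in \<open>auto simp: le_def\<close>)
  qed
  then obtain \<U> where \<U>: "\<U> \<in> prime_filters ?P" "F \<subseteq> \<U>" "{} \<notin> \<U>"
    using P.prime_filter_theorem[OF _ c assms(2)] by blast
  have int: "X \<inter> Y \<in> \<U> \<longleftrightarrow> X \<in> \<U> \<and> Y \<in> \<U>" for X Y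
    using P.meet_in_prime[OF \<U>(1) c c] by (simp only: upalg_simps(5))
  have un: "X \<union> Y \<in> \<U> \<longleftrightarrow> X \<in> \<U> \<or> Y \<in> \<U>" for X Y
    using P.join_in_prime[OF \<U>(1) c c] by (simp only: upalg_simps(4))
  have "UNIV \<in> \<U>" using \<U>(2) assms(1) by blast
  then have "- X \<in> \<U> \<longleftrightarrow> X \<notin> \<U>" for X
    using un[of X "- X"] int[of X "- X"] \<U>(3) by auto
  with \<U>(2) int show ?thesis using that by simp
qed

text \<open>
  By \<open>partial_embedding_exists\<close> every finite part of \<open>M\<close> embeds into \<open>A\<close>, hence \<open>M\<close> embeds into an
  ultrapower of \<open>A\<close>.
\<close>

theorem embedding_into_ultrapower:
  fixes M :: "'a hstruct" and A :: "'b hstruct"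
  assumes M: "heyting_algebra M" and A: "heyting_algebra A" "density A" "splitting A"
    and nt: "nontrivial M \<longleftrightarrow> nontrivial A" and T: "models A T"
  obtains N :: "('a set \<Rightarrow> 'b) hstruct" and e where "models N T" "embedding e M N"
proof -
  interpret M: heyting M by (rule heytingI[OF M])
  interpret A: heyting A by (rule heytingI[OF A(1)])
  define good where "good E \<longleftrightarrow> finite E \<and> E \<subseteq> carrier M \<and> zero M \<in> E \<and> one M \<in> E" for E
  \<comment> \<open>Finitely many cones always meet. An ultrafilter that contains them puts any
    given finite set of elements of \<open>M\<close> into almost every \<open>E\<close>.\<close>
  define cone where "cone S = {E. good E \<and> S \<subseteq> E}" for S
  define F where "F = {X. \<exists>S. finite S \<and> S \<subseteq> carrier M \<and> cone S \<subseteq> X}"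
  have ne: "cone S \<noteq> {}" if "finite S" "S \<subseteq> carrier M" for S
  proof -
    have "insert (zero M) (insert (one M) S) \<in> cone S" using that by (auto simp: cone_def good_def)
    then show ?thesis by blast
  qed
  have F1: "UNIV \<in> F" unfolding F_def by blast
  have F2: "{} \<notin> F" unfolding F_def using ne by blast
  have F3: "X \<inter> Y \<in> F" if XY: "X \<in> F" "Y \<in> F" for X Y
  proof -
    obtain S S' where S: "finite S" "S \<subseteq> carrier M" "cone S \<subseteq> X" and S': "finite S'" "S' \<subseteq> carrier M" "cone S' \<subseteq> Y"
      using XY unfolding F_def by blast
    have "cone (S \<union> S') \<subseteq> X \<inter> Y" using S(3) S'(3) by (auto simp: cone_def)
    then show ?thesis using S S' unfolding F_def by blast
  qed
  have F4: "Y \<in> F" if "X \<in> F" "X \<subseteq> Y" for X Y using that unfolding F_def by blast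
  obtain \<U> where \<U>: "F \<subseteq> \<U>" "\<forall>X Y. X \<inter> Y \<in> \<U> \<longleftrightarrow> X \<in> \<U> \<and> Y \<in> \<U>" "\<forall>X. - X \<in> \<U> \<longleftrightarrow> X \<notin> \<U>"
    using ultrafilter_exists[OF F1 F2 F3 F4] .
  define ae where "ae P \<longleftrightarrow> {E. P E} \<in> \<U>" for P
  interpret ultrapower ae A
  proof
    show "ae (\<lambda>i. P i \<and> Q i) \<longleftrightarrow> ae P \<and> ae Q" for P Q
      unfolding ae_def Collect_conj_eq by (rule \<U>(2)[rule_format])
    show "ae (\<lambda>i. \<not> P i) \<longleftrightarrow> \<not> ae P" for P
      unfolding ae_def Collect_neg_eq by (rule \<U>(3)[rule_format])
    show "fo_structure A" using A(1) by (simp add: heyting_algebra_def)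
  qed
  have ae_cone: "ae (\<lambda>E. good E \<and> S \<subseteq> E)" if "finite S" "S \<subseteq> carrier M" for S
    using \<U>(1) that unfolding ae_def F_def cone_def by blast
  have "\<exists>\<rho>. partial_embedding \<rho> M E A" if "good E" for E
    using partial_embedding_exists[OF A M nt, of E] that unfolding good_def by metis
  then obtain \<rho> where \<rho>: "\<And>E. good E \<Longrightarrow> partial_embedding (\<rho> E) M E A" by metis
  \<comment> \<open>For a fixed \<open>m\<close> in \<open>M\<close> the default value is taken only
    off a cone, hence almost nowhere.\<close>
  define f where "f m E = (if good E \<and> m \<in> E then \<rho> E m else zero A)" for m E
  have \<rho>c: "\<rho> E m \<in> carrier A" if "good E" "m \<in> E" for E m
    using \<rho>[OF that(1)] that(2) unfolding partial_embedding_def by blast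
  have fc: "f m E \<in> carrier A" for m E unfolding f_def using \<rho>c by simp
  define e where "e m = canon (f m)" for m
  have ec: "e m \<in> carrier upow" for m unfolding e_def by (rule canon(3)[OF fc])
  have ef: "ae (\<lambda>E. f m E = e m E)" for m unfolding e_def by (rule canon(2)[OF fc])
  have op: "\<rho> E (join M x y) = join A (\<rho> E x) (\<rho> E y)" if "good E" "x \<in> E" "y \<in> E" "join M x y \<in> E" for E x y
    using \<rho>[OF that(1)] that unfolding partial_embedding_def by simp
  have op2: "\<rho> E (meet M x y) = meet A (\<rho> E x) (\<rho> E y)" if "good E" "x \<in> E" "y \<in> E" "meet M x y \<in> E" for E x y
    using \<rho>[OF that(1)] that unfolding partial_embedding_def by simp
  have op3: "\<rho> E (imp M x y) = imp A (\<rho> E x) (\<rho> E y)" if "good E" "x \<in> E" "y \<in> E" "imp M x y \<in> E" for E x y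
    using \<rho>[OF that(1)] that unfolding partial_embedding_def by simp
  have "embedding e M upow"
    unfolding embedding_def
  proof (intro conjI ballI)
    show "e ` carrier M \<subseteq> carrier upow" using ec by blast
    show "inj_on e (carrier M)"
    proof (rule inj_onI)
      fix x y assume xy: "x \<in> carrier M" "y \<in> carrier M" "e x = e y"
      have "ae (\<lambda>E. f x E = f y E)"
        by (rule ae_mono2[OF ef[of x] ef[of y]]) (use xy(3) in simp)
      moreover have "ae (\<lambda>E. good E \<and> {x, y} \<subseteq> E)" by (rule ae_cone) (use xy in auto)
      \<comment> \<open>A property that holds almost everywhere holds somewhere; injectivity of the
        partial embedding at one such \<open>E\<close> decides.\<close>
      ultimately have "ae (\<lambda>E. good E \<and> {x, y} \<subseteq> E \<and> f x E = f y E)" by (rule ae_mono2) blast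
      then obtain E where E: "good E" "x \<in> E" "y \<in> E" "f x E = f y E"
        using ae_not[of "\<lambda>_. True"] ae_True[of "\<lambda>_. True"] ae_mono[of _ "\<lambda>_. \<not> True"] by auto
      then have "\<rho> E x = \<rho> E y" by (simp add: f_def)
      then show "x = y" using inj_onD[OF partial_embeddingD(1)[OF \<rho>[OF E(1)]]] E by blast
    qed
    have "ae (\<lambda>E. good E \<and> {} \<subseteq> E)" by (rule ae_cone) auto
    then have g: "ae good" by (rule ae_mono) blast
    show "e (zero M) = zero upow"
      unfolding e_def upow_ops
      by (rule canon_eq, rule ae_mono[OF g])
        (use partial_embeddingD(3)[OF \<rho>] in \<open>auto simp: f_def good_def\<close>)
    show "e (one M) = one upow"
      unfolding e_def upow_ops
      by (rule canon_eq, rule ae_mono[OF g])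
        (use partial_embeddingD(2)[OF \<rho>] in \<open>auto simp: f_def good_def\<close>)
    fix x y assume xy: "x \<in> carrier M" "y \<in> carrier M"
    have exy: "ae (\<lambda>E. f x E = e x E \<and> f y E = e y E)"
      unfolding ae_conj by (rule conjI[OF ef ef])
    have "ae (\<lambda>E. good E \<and> {x, y, join M x y} \<subseteq> E)" by (rule ae_cone) (use xy in auto)
    from ae_mono2[OF exy this, of "\<lambda>E. f (join M x y) E = join A (e x E) (e y E)"]
    show "e (join M x y) = join upow (e x) (e y)"
      unfolding upow_ops e_def[of "join M x y"] by (intro canon_eq) (auto simp: f_def op)
    have "ae (\<lambda>E. good E \<and> {x, y, meet M x y} \<subseteq> E)" by (rule ae_cone) (use xy in auto)
    from ae_mono2[OF exy this, of "\<lambda>E. f (meet M x y) E = meet A (e x E) (e y E)"]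
    show "e (meet M x y) = meet upow (e x) (e y)"
      unfolding upow_ops e_def[of "meet M x y"] by (intro canon_eq) (auto simp: f_def op2)
    have "ae (\<lambda>E. good E \<and> {x, y, imp M x y} \<subseteq> E)" by (rule ae_cone) (use xy in auto)
    from ae_mono2[OF exy this, of "\<lambda>E. f (imp M x y) E = imp A (e x E) (e y E)"]
    show "e (imp M x y) = imp upow (e x) (e y)"
      unfolding upow_ops e_def[of "imp M x y"] by (intro canon_eq) (auto simp: f_def op3)
  qed
  with models_upow[OF T] show ?thesis by (rule that)
qed


section \<open>The model completion\<close>

lemma models_Un: "models A (S \<union> T) \<longleftrightarrow> models A S \<and> models A T"
  unfolding models_def by blast

lemma models_mc_axioms:
  "models A (mc_axioms H0) \<longleftrightarrow> heyting_algebra A \<and> density A \<and> splitting A \<and>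
    (\<forall>l d. index_bound l d A (the_enat (index l d H0)))"
proof (cases "heyting_algebra A")
  case True
  then have fo: "fo_structure A" by (simp add: heyting_algebra_def)
  have "models A {FC l d (the_enat (index l d H0)) | l d. True} \<longleftrightarrow>
      (\<forall>l d. models A {FC l d (the_enat (index l d H0))})"
    using fo unfolding models_def by auto
  moreover have "models A {density_axiom, splitting_axiom} \<longleftrightarrow> density A \<and> splitting A"
    using models_Un[of A "{density_axiom}" "{splitting_axiom}"]
      models_density_axiom[OF fo] models_splitting_axiom[OF fo] by (simp add: insert_commute)
  ultimately show ?thesis
    unfolding mc_axioms_def models_Un models_heyting_axioms using models_FC[OF True] by simp
next
  case False
  then show ?thesis unfolding mc_axioms_def models_Un models_heyting_axioms by simp
qed

text \<open>QE makes the index finite, so \<open>the_enat\<close> returns the genuine common index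
  of \<open>A\<close> and \<open>H0\<close>.\<close>

lemma ex_closed_models_mc_axioms:
  assumes "ex_closed A" "nontrivial A" "ex_closed H0" "nontrivial H0"
  shows "models A (mc_axioms H0)"
proof -
  have "index_bound l d A (the_enat (index l d H0))" for l d
    using index_bound_index[of l d A] ex_closed_QE[OF assms(1)] ex_closed_index_eq[OF assms]
    unfolding QE_property_def by simp
  then show ?thesis
    unfolding models_mc_axioms
    using assms(1) ex_closed_heyting ex_closed_density ex_closed_splitting by blast
qed

lemma models_mc_axioms_ex_closed:
  assumes "models A (mc_axioms H0)"
  shows "ex_closed A"
  using assms density_splitting_forth_ex_closed index_bound_forth unfolding models_mc_axioms by blast

text \<open>All extensions of a trivial algebra are trivial, so the model completion must admit it.
  Density and Splitting hold vacuously, and the index conditions hold because all assignments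
  coincide.\<close>

lemma trivial_models_mc_axioms:
  assumes A: "heyting_algebra A" "\<not> nontrivial A"
  shows "models A (mc_axioms H0)"
proof -
  interpret heyting A by (rule heytingI[OF A(1)])
  have t: "x = one A" if "x \<in> carrier A" for x using trivial_carrier[OF A(2) that] .
  have "index_bound l d A n" for l d n
    unfolding index_bound_iff[OF A(1)]
  proof (intro allI impI ballI)
    fix v w :: "nat \<Rightarrow> 'a" and S
    assume v: "range v \<subseteq> carrier A" "range w \<subseteq> carrier A" and s: "solv A l S v"
    have "v i \<in> carrier A" "w i \<in> carrier A" for i using v by auto
    then have "v i = w i" for i using t[of "v i"] t[of "w i"] by simp
    then have "v = w" by blast
    then show "solv A l S w" using s by simp
  qed
  moreover have "density A" unfolding density_def using t by blast
  moreover have "splitting A" unfolding splitting_def using t by blast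
  ultimately show ?thesis unfolding models_mc_axioms using A(1) by blast
qed

lemma sentence_mc_axioms: "\<forall>p\<in>heyting_axioms \<union> mc_axioms H0. sentence p"
proof -
  have "\<forall>p\<in>heyting_axioms. sentence p"
    unfolding heyting_axioms_def Let_def by (auto simp: sentence_def free_vars_alls le_fm_def)
  moreover have "sentence density_axiom"
    unfolding density_axiom_def Let_def
    by (auto simp: sentence_def free_vars_alls le_fm_def strong_gt_fm_def)
  moreover have "sentence splitting_axiom"
    unfolding splitting_axiom_def Let_def
    by (auto simp: sentence_def free_vars_alls free_vars_conjs le_fm_def strong_gt_fm_def)
  ultimately show ?thesis unfolding mc_axioms_def using sentence_FC by auto
qed

text \<open>Embeddings preserve and reflect the equations t = 1, so the two images of the parameters
  are related by \<open>sim\<close> at every degree.\<close>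

lemma ex_closed_extensions_equivalent:
  assumes M: "heyting_algebra M" "range v \<subseteq> carrier M"
    and N1: "ex_closed N1" "embedding e1 M N1" and N2: "ex_closed N2" "embedding e2 M N2"
  shows "sat N1 (e1 \<circ> v) p \<longleftrightarrow> sat N2 (e2 \<circ> v) p"
proof -
  interpret heyting M by (rule heytingI[OF M(1)])
  note H1 = ex_closed_heyting[OF N1(1)] and H2 = ex_closed_heyting[OF N2(1)]
  obtain l where l: "fm_vars p \<subseteq> {..<l}" by (rule fm_vars_bound)
  obtain n where n: "agree N1 N2 l n p"
    using sat_back_and_forth[OF H1 H2 ex_closed_forth[OF N1(1) H2] ex_closed_forth[OF N2(1) H1] l] by blast
  have "eval N1 (e1 \<circ> v) t = one N1 \<longleftrightarrow> eval M v t = one M" "eval N2 (e2 \<circ> v) t = one N2 \<longleftrightarrow> eval M v t = one M"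
    for t :: "nat ipc"
    unfolding eval_embedding[OF M(1) N1(2) M(2)] eval_embedding[OF M(1) N2(2) M(2)]
      embeddingD(2)[OF N1(2), symmetric] embeddingD(2)[OF N2(2), symmetric]
    using inj_on_eq_iff[OF embeddingD(1)[OF N1(2)] eval_closed[OF M(2)] one_closed]
      inj_on_eq_iff[OF embeddingD(1)[OF N2(2)] eval_closed[OF M(2)] one_closed] by blast+
  then have "sim l n N1 (e1 \<circ> v) N2 (e2 \<circ> v)" by (simp add: sim_def)
  moreover have "range (e1 \<circ> v) \<subseteq> carrier N1" "range (e2 \<circ> v) \<subseteq> carrier N2"
    using M(2) embeddingD(4)[OF N1(2)] embeddingD(4)[OF N2(2)] by auto
  ultimately show ?thesis using agreeD[OF n] by blast
qed

text \<open>The ultrapower that extends a non-trivial \<open>M\<close> lives on a larger type; the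
  downward Loewenheim-Skolem theorem cuts it down to \<open>'a + nat\<close>. Uniqueness holds
  because all models of the axioms are existentially closed.\<close>

theorem model_completion_mc_axioms:
  fixes Ht H0 :: "'b hstruct"
  assumes Ht: "ex_closed Ht" "nontrivial Ht" and H0: "ex_closed H0" "nontrivial H0"
  shows "model_completion TYPE('a) heyting_axioms (mc_axioms H0)"
  unfolding model_completion_def
proof (intro conjI allI impI sentence_mc_axioms)
  fix M :: "'a hstruct"
  show "models M heyting_axioms" if "models M (mc_axioms H0)"
    using that unfolding models_mc_axioms models_heyting_axioms by blast
  assume "models M heyting_axioms"
  then have M: "heyting_algebra M" by (simp add: models_heyting_axioms)
  then have fo: "fo_structure M" by (simp add: heyting_algebra_def)
  show "\<exists>(N :: ('a + nat) hstruct) e. models N (mc_axioms H0) \<and> embedding e M N"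
  proof (cases "nontrivial M")
    case True
    note HHt = ex_closed_heyting[OF Ht(1)] ex_closed_density[OF Ht(1)] ex_closed_splitting[OF Ht(1)]
    obtain N :: "('a set \<Rightarrow> 'b) hstruct" and e where N: "models N (mc_axioms H0)" "embedding e M N"
      using embedding_into_ultrapower[OF M HHt _ ex_closed_models_mc_axioms[OF Ht H0]] True Ht(2) by metis
    obtain L :: "('a + nat) hstruct" and f where "models L (mc_axioms H0)" "embedding f M L"
      using elementary_subextension[OF fo N] by metis
    then show ?thesis by blast
  next
    case False
    \<comment> \<open>A trivial algebra is itself a model and only has to be moved to the type
      \<open>'a + nat\<close>.\<close>
    have "embedding (\<lambda>x. x) M M" by (auto simp: embedding_def)
    then obtain L :: "('a + nat) hstruct" and f where "models L (mc_axioms H0)" "embedding f M L"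
      using elementary_subextension[OF fo trivial_models_mc_axioms[OF M False]] by metis
    then show ?thesis by blast
  qed
  fix N1 :: "('a + nat) hstruct" and e1 and N2 :: "('a + nat) hstruct" and e2 p
    and v :: "nat \<Rightarrow> 'a"
  assume N: "models N1 (mc_axioms H0) \<and> embedding e1 M N1 \<and> models N2 (mc_axioms H0) \<and> embedding e2 M N2"
    and v: "range v \<subseteq> carrier M"
  show "sat N1 (e1 \<circ> v) p \<longleftrightarrow> sat N2 (e2 \<circ> v) p"
    using N by (intro ex_closed_extensions_equivalent[OF M v] models_mc_axioms_ex_closed) blast+
qed

text \<open>The criterion by indices is confined to non-trivial \<open>H\<close>: the trivial
  algebra is existentially closed with all indices 0, whereas \<open>index 1 1 H0\<close> is
  positive. Indeed the element 0 and any element of \<open>H0\<close> other than 0 and 1 satisfy the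
  same formulas of degree 0, but only the former satisfies p -> 0 = 1.\<close>

theorem theorem4p6:
  fixes H :: "'a hstruct" and Ht H0 :: "'b hstruct"
  assumes "ex_closed Ht" and "nontrivial Ht" and "H0_construction Ht H0"
    and "heyting_algebra H"
  shows "(ex_closed H \<longleftrightarrow> density H \<and> splitting H \<and> QE_property H) \<and>
    (nontrivial H \<longrightarrow>
      (ex_closed H \<longleftrightarrow> density H \<and> splitting H \<and> (\<forall>l d. index l d H = index l d H0))) \<and>
    model_completion TYPE('a) heyting_axioms (mc_axioms H0)"
proof (intro conjI impI)
  have H0: "ex_closed H0"
    by (rule H0_construction_ex_closed[OF ex_closed_heyting[OF assms(1)] assms(3)])
  have nt: "nontrivial H0"
    using assms(2,3) unfolding H0_construction_def nontrivial_def by auto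
  show iff: "ex_closed H \<longleftrightarrow> density H \<and> splitting H \<and> QE_property H"
    by (rule ex_closed_iff[OF assms(4)])
  show "ex_closed H \<longleftrightarrow> density H \<and> splitting H \<and> (\<forall>l d. index l d H = index l d H0)"
    if "nontrivial H"
  proof
    assume "ex_closed H"
    then show "density H \<and> splitting H \<and> (\<forall>l d. index l d H = index l d H0)"
      using iff ex_closed_index_eq[OF _ that H0 nt] by blast
  next
    assume "density H \<and> splitting H \<and> (\<forall>l d. index l d H = index l d H0)"
    \<comment> \<open>The indices of \<open>H0\<close> are finite, so equality with them gives
      QE.\<close>
    then show "ex_closed H"
      using iff ex_closed_QE[OF H0] unfolding QE_property_def by simp
  qed
  show "model_completion TYPE('a) heyting_axioms (mc_axioms H0)"
    by (rule model_completion_mc_axioms[OF assms(1,2) H0 nt])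
qed

end
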